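(* Let $w=\sqrt2$ and fix $N\in\mathbb N$. The set $\mathcal P_N$ of connection points $P$ of $L_8$ with $N(P)=N$ decomposes into a finite number of $\mathrm{SL}(L_8)$-orbits.
   Context: A translation surface $X$ is obtained from finitely many euclidean polygons by gluing parallel sides by translations; $S(X)$ is its set of singularities (images of vertices). $\mathrm{Aff}(X)$ is the group of orientation-preserving self-homeomorphisms of $X$ mapping $S(X)$ to itself and locally affine on $X-S(X)$; the Veech group $\mathrm{SL}(X)<\mathrm{SL}_2(\mathbb R)$ is the image of $\mathrm{Aff}(X)$ under the derivative map. With $w=\sqrt2$, the surface $L_8$ is obtained from the L-shaped polygon with vertices $(0,0),(1+w,0),(1+w,1),(1,1),(1,w),(0,w)$ by the translations identifying $[0,1]\times\{0\}$ with $[0,1]\times\{w\}$, $[1,1+w]\times\{0\}$ with $[1,1+w]\times\{1\}$, $\{0\}\times[0,1]$ with $\{1+w\}\times[0,1]$, and $\{0\}\times[1,w]$ with $\{1\}\times[1,w]$. It has genus $2$ and one singularity. The derivative map $\mathrm{Aff}(L_8)\to\mathrm{SL}(L_8)$ is an isomorphism, so $\mathrm{SL}(L_8)$ acts on the points of $L_8$. Points are given by their coordinates in the polygon (for points on identified sides, the representative with smaller coordinates is chosen). A separatrix is a geodesic emanating from a singularity; a saddle connection is a geodesic joining two singularities with no singularity in its interior. A nonsingular point $P$ is a connection point if every separatrix without singularities in its interior that passes through $P$ can be extended to a saddle connection. The connection points of $L_8$ are the (nonsingular) points $P=(x_r+x_iw;\,y_r+y_iw)$ with $x_r,x_i,y_r,y_i\in\mathbb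 Q$; $N(P)$ denotes the least common denominator of the reduced fractions $x_r,x_i,y_r,y_i$. The set $\mathcal P_N$ is invariant under $\mathrm{SL}(L_8)$. *)

theory Defs
  imports "HOL-Analysis.Analysis" "HOL-Library.Disjoint_Sets"
begin

definition L8_polygon :: "(real^2) set" where
  "L8_polygon = {vector [0, 0] .. vector [1 + sqrt 2, 1]} \<union> {vector [0, 0] .. vector [1, sqrt 2]}"

inductive L8_glue :: "real^2 \<Rightarrow> real^2 \<Rightarrow> bool" where
  "t \<in> {0..1} \<Longrightarrow> L8_glue (vector [t, 0]) (vector [t, sqrt 2])"
| "t \<in> {1..1 + sqrt 2} \<Longrightarrow> L8_glue (vector [t, 0]) (vector [t, 1])"
| "t \<in> {0..1} \<Longrightarrow> L8_glue (vector [0, t]) (vector [1 + sqrt 2, t])"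
| "t \<in> {1..sqrt 2} \<Longrightarrow> L8_glue (vector [0, t]) (vector [1, t])"

text \<open>A point of the surface is a class of identified points of the polygon.\<close>

type_synonym surface_point = "(real^2) set"

definition L8_proj :: "real^2 \<Rightarrow> surface_point" where
  "L8_proj p = {q. equivclp L8_glue p q}"

definition L8 :: "surface_point topology" where
  "L8 = topology (\<lambda>U. U \<subseteq> L8_proj ` L8_polygon \<and>
           openin (top_of_set L8_polygon) {p \<in> L8_polygon. L8_proj p \<in> U})"

lemma openin_L8:
  "openin L8 U \<longleftrightarrow> U \<subseteq> L8_proj ` L8_polygon \<and>
     openin (top_of_set L8_polygon) {p \<in> L8_polygon. L8_proj p \<in> U}"
proof -
  have "istopology (\<lambda>U. U \<subseteq> L8_proj ` L8_polygon \<and>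
           openin (top_of_set L8_polygon) {p \<in> L8_polygon. L8_proj p \<in> U})"
    unfolding istopology_def
  proof (intro conjI allI impI; (elim conjE)?)
    fix S T :: "surface_point set"
    assume "openin (top_of_set L8_polygon) {p \<in> L8_polygon. L8_proj p \<in> S}"
      and "openin (top_of_set L8_polygon) {p \<in> L8_polygon. L8_proj p \<in> T}"
    then have "openin (top_of_set L8_polygon)
        ({p \<in> L8_polygon. L8_proj p \<in> S} \<inter> {p \<in> L8_polygon. L8_proj p \<in> T})"
      by (rule openin_Int)
    moreover have "{p \<in> L8_polygon. L8_proj p \<in> S} \<inter> {p \<in> L8_polygon. L8_proj p \<in> T}
        = {p \<in> L8_polygon. L8_proj p \<in> S \<inter> T}"
      by blast
    ultimately show "openin (top_of_set L8_polygon) {p \<in> L8_polygon. L8_proj p \<in> S \<inter> T}"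
      by simp
  next
    fix K :: "surface_point set set"
    assume K: "\<forall>S\<in>K. S \<subseteq> L8_proj ` L8_polygon \<and>
        openin (top_of_set L8_polygon) {p \<in> L8_polygon. L8_proj p \<in> S}"
    have "openin (top_of_set L8_polygon) (\<Union>S\<in>K. {p \<in> L8_polygon. L8_proj p \<in> S})"
      using K by (intro openin_Union) blast
    moreover have "(\<Union>S\<in>K. {p \<in> L8_polygon. L8_proj p \<in> S}) = {p \<in> L8_polygon. L8_proj p \<in> \<Union>K}"
      by blast
    ultimately show "openin (top_of_set L8_polygon) {p \<in> L8_polygon. L8_proj p \<in> \<Union>K}"
      by simp
  qed blast+
  then show ?thesis
    by (simp add: L8_def)
qed

lemma topspace_L8: "topspace L8 = L8_proj ` L8_polygon"
proof
  show "topspace L8 \<subseteq> L8_proj ` L8_polygon"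
    using openin_L8 openin_topspace by blast
  have "{p \<in> L8_polygon. L8_proj p \<in> L8_proj ` L8_polygon} = L8_polygon"
    by blast
  then have "openin L8 (L8_proj ` L8_polygon)"
    by (simp add: openin_L8)
  then show "L8_proj ` L8_polygon \<subseteq> topspace L8"
    by (rule openin_subset)
qed

lemma quotient_map_L8_proj: "quotient_map (top_of_set L8_polygon) L8 L8_proj"
  by (auto simp: quotient_map_def topspace_L8 openin_L8)

definition L8_singularities :: "surface_point set" where
  "L8_singularities = L8_proj ` {vector [0, 0], vector [1 + sqrt 2, 0], vector [1 + sqrt 2, 1],
                                  vector [1, 1], vector [1, sqrt 2], vector [0, sqrt 2]}"

text \<open>On \<^typ>\<open>real^2\<close> the order is componentwise, so this is the representative whose two
  coordinates are both smallest.\<close>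

definition L8_coords :: "surface_point \<Rightarrow> real^2" where
  "L8_coords P = (LEAST p. p \<in> P)"

text \<open>Charts are homeomorphisms, away from the singularities, onto open subsets of the plane that
  restrict to translations on the polygon.\<close>

definition translation_chart :: "surface_point set \<Rightarrow> (surface_point \<Rightarrow> real^2) \<Rightarrow> bool" where
  "translation_chart U \<phi> \<longleftrightarrow>
     openin L8 U \<and> U \<inter> L8_singularities = {} \<and> open (\<phi> ` U) \<and>
     homeomorphic_map (subtopology L8 U) (top_of_set (\<phi> ` U)) \<phi> \<and>
     (\<forall>p\<in>L8_polygon. L8_proj p \<in> U \<longrightarrow>
        (\<exists>c. \<exists>e>0. \<forall>q \<in> L8_polygon \<inter> ball p e. L8_proj q \<in> U \<longrightarrow> \<phi> (L8_proj q) = q + c))"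

definition affine_near ::
    "(surface_point \<Rightarrow> surface_point) \<Rightarrow> real^2^2 \<Rightarrow> surface_point \<Rightarrow> bool" where
  "affine_near f A P \<longleftrightarrow>
     (\<exists>U \<phi> V \<psi> b. translation_chart U \<phi> \<and> translation_chart V \<psi> \<and> P \<in> U \<and> f ` U \<subseteq> V \<and>
        (\<forall>Q\<in>U. \<psi> (f Q) = A *v \<phi> Q + b))"

definition Aff_L8 :: "(surface_point \<Rightarrow> surface_point) set" where
  "Aff_L8 = {f. homeomorphic_map L8 L8 f \<and> f ` L8_singularities \<subseteq> L8_singularities \<and>
                (\<forall>P \<in> topspace L8 - L8_singularities. \<exists>A. det A > 0 \<and> affine_near f A P)}"

text \<open>Coordinate changes between charts are locally translations and the surface minus its
  singularities is connected, so the linear part is the same at all nonsingular points.\<close>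

definition affine_derivative :: "(surface_point \<Rightarrow> surface_point) \<Rightarrow> real^2^2 \<Rightarrow> bool" where
  "affine_derivative f A \<longleftrightarrow> (\<forall>P \<in> topspace L8 - L8_singularities. affine_near f A P)"

definition SL_L8 :: "(real^2^2) set" where
  "SL_L8 = {A. \<exists>f\<in>Aff_L8. affine_derivative f A}"

text \<open>A matrix in the Veech group acts on points as the affine homeomorphism with that derivative.\<close>

definition SL_L8_orbit :: "surface_point \<Rightarrow> surface_point set" where
  "SL_L8_orbit P = {f P | f A. A \<in> SL_L8 \<and> f \<in> Aff_L8 \<and> affine_derivative f A}"

definition straight_path :: "real set \<Rightarrow> real^2 \<Rightarrow> (real \<Rightarrow> surface_point) \<Rightarrow> bool" where
  "straight_path I v g \<longleftrightarrow>
     continuous_map (top_of_set I) L8 g \<and>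
     (\<forall>t\<in>I. g t \<notin> L8_singularities \<longrightarrow>
        (\<exists>U \<phi> b. \<exists>e>0. translation_chart U \<phi> \<and>
           (\<forall>s\<in>I. \<bar>s - t\<bar> < e \<longrightarrow> g s \<in> U \<and> \<phi> (g s) = s *\<^sub>R v + b)))"

text \<open>Separatrices may be bounded or unbounded, with or without their far endpoint; those considered
  here have no singularities in their interior.\<close>

definition separatrix :: "real set \<Rightarrow> real^2 \<Rightarrow> (real \<Rightarrow> surface_point) \<Rightarrow> bool" where
  "separatrix I v g \<longleftrightarrow>
     is_interval I \<and> 0 \<in> I \<and> I \<subseteq> {0..} \<and> v \<noteq> 0 \<and> straight_path I v g \<and>
     g 0 \<in> L8_singularities \<and> (\<forall>t \<in> interior I. g t \<notin> L8_singularities)"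

definition saddle_connection :: "real \<Rightarrow> real^2 \<Rightarrow> (real \<Rightarrow> surface_point) \<Rightarrow> bool" where
  "saddle_connection T v g \<longleftrightarrow> T > 0 \<and> separatrix {0..T} v g \<and> g T \<in> L8_singularities"

definition connection_point :: "surface_point \<Rightarrow> bool" where
  "connection_point P \<longleftrightarrow>
     P \<in> topspace L8 - L8_singularities \<and>
     (\<forall>I v g. separatrix I v g \<and> P \<in> g ` I \<longrightarrow>
        (\<exists>T h. saddle_connection T v h \<and> I \<subseteq> {0..T} \<and> (\<forall>t\<in>I. h t = g t)))"

definition denominator :: "rat \<Rightarrow> nat" where
  "denominator r = nat (snd (quotient_of r))"

definition has_common_denominator :: "surface_point \<Rightarrow> nat \<Rightarrow> bool" where
  "has_common_denominator P N \<longleftrightarrow>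
     (\<exists>xr xi yr yi :: rat.
        L8_coords P = vector [of_rat xr + of_rat xi * sqrt 2, of_rat yr + of_rat yi * sqrt 2] \<and>
        N = Lcm (denominator ` {xr, xi, yr, yi}))"

definition connection_points :: "nat \<Rightarrow> surface_point set" where
  "connection_points N = {P. connection_point P \<and> has_common_denominator P N}"

end

theory Submission
  imports Defs
begin

text \<open>
  The common denominator is an orbit invariant: an affine automorphism with derivative \<open>A\<close>
  maps the holonomies of saddle connections, which span the lattice \<open>\<int>[\<surd>2]\<^sup>2\<close>, into this
  lattice, and in the polygon it acts as \<open>A\<close> modulo the lattice. For finiteness, consider next
  to the coordinates \<open>(x, y)\<close> their Galois conjugates \<open>(x', y')\<close>. The multitwists along the
  horizontal and the vertical cylinders act on the conjugates, up to a bounded error, by steps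
  of size \<open>(\<surd>2 - 1) |y'|\<close> for \<open>x'\<close> and \<open>\<surd>2 |x'|\<close> for \<open>y'\<close>. Since \<open>(\<surd>2 - 1) \<surd>2 < 1\<close>,
  alternating them brings every point into a region where the conjugates are bounded. As
  \<open>\<int>[\<surd>2]\<close> is discrete in the plane under its two embeddings, only finitely many points with
  denominator \<open>N\<close> lie there.
\<close>

section \<open>The polygon and its gluings\<close>

text \<open>The multitwists are shears by \<open>1 + sqrt 2\<close> and \<open>sqrt 2\<close>. What
  contracts is the conjugate pair \<open>1 - sqrt 2\<close> and \<open>- sqrt 2\<close>, whose
  product is below 1 in absolute value. The obstacle is that a twisted point returns to the polygon
  only after full turns are removed; their number grows with the power of the twist, and the
  conjugate of a circumference is not small. This number is, however, fixed up to rounding by the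
  actual displacement, which per single twist is at most a constant because the polygon is bounded.
  So the removed turns change the conjugate step by a bounded amount, and the step is nonzero as
  soon as the coordinate that drives it is large. This is why the descent keeps the coordinates
  above a threshold and does not make them as small as possible. Local computations take place in
  strips covering the cylinders, where full turns are translations and a multitwist is a shear. On
  the boundary of two cylinders the strips of the transverse direction take over.\<close>

definition oth :: "2 \<Rightarrow> 2" where "oth k = (if k = 1 then 2 else 1)"

lemma oth_oth [simp]: "oth (oth k) = k"
  using exhaust_2[of k] by (auto simp: oth_def)

lemma oth_neq [simp]: "oth k \<noteq> k" "k \<noteq> oth k"
  using exhaust_2[of k] by (auto simp: oth_def)

lemma all_oth: "(\<forall>i. P i) \<longleftrightarrow> P k \<and> P (oth k)"
  using exhaust_2[of k] by (auto simp: oth_def forall_2)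

lemma vec2_eq_iff: "(p :: real^2) = q \<longleftrightarrow> p $ k = q $ k \<and> p $ oth k = q $ oth k"
  unfolding vec_eq_iff by (rule all_oth)

definition dir :: "2 \<Rightarrow> real^2" where "dir k = axis k 1"

lemma dir_nth [simp]: "dir k $ k = 1" "dir k $ oth k = 0" "dir (oth k) $ k = 0"
  by (auto simp: dir_def axis_def)

lemma norm_dir [simp]: "norm (dir k) = 1"
  by (simp add: dir_def)

text \<open>Apart from these two lengths the L is symmetric under exchanging the coordinates, so
  horizontal and vertical statements are proved once, for a symbolic direction
  \<open>k\<close>.\<close>

definition len :: "2 \<Rightarrow> real" where "len k = (if k = 1 then 1 + sqrt 2 else sqrt 2)"

lemma sqrt2_bounds: "7/5 < sqrt 2" "sqrt 2 < 3/2"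
proof -
  show "7/5 < sqrt 2" by (rule real_less_rsqrt) (simp add: power2_eq_square)
  show "sqrt 2 < 3/2" by (rule real_less_lsqrt) (auto simp: power2_eq_square)
qed

lemma len_bounds: "7/5 < len k" "len k < 5/2"
  using sqrt2_bounds by (auto simp: len_def)

lemma len_pos [simp]: "0 < len k" "0 \<le> len k" "1 < len k" "1 \<le> len k" "len k \<noteq> 0" "len k
    \<noteq> 1" "\<not> len k \<le> 1" "\<not> len k < 1"
  using len_bounds[of k] by auto

lemma mem_L8_polygon:
  "p \<in> L8_polygon \<longleftrightarrow>
     0 \<le> p $ k \<and> p $ k \<le> len k \<and> 0 \<le> p $ oth k \<and> p $ oth k \<le> len (oth k)
         \<and> (p $ k \<le> 1 \<or> p $ oth k \<le> 1)"
  using exhaust_2[of k] sqrt2_bounds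
  by (auto simp: L8_polygon_def less_eq_vec_def forall_2 len_def oth_def)

lemma compact_L8_polygon: "compact L8_polygon"
  unfolding L8_polygon_def interval_cbox by (intro compact_Un compact_cbox)

definition glue :: "2 \<Rightarrow> real^2 \<Rightarrow> real^2 \<Rightarrow> bool" where
  "glue k p q \<longleftrightarrow> p $ k = 0 \<and>
     (0 \<le> p $ oth k \<and> p $ oth k \<le> 1 \<and> q = p + len k *\<^sub>R dir k \<or>
      1 \<le> p $ oth k \<and> p $ oth k \<le> len (oth k) \<and> q = p + dir k)"

lemma L8_glue_iff: "L8_glue p q \<longleftrightarrow> (\<exists>k. glue k p q)"
proof
  assume "L8_glue p q"
  then have "glue 1 p q \<or> glue 2 p q"
    by cases (auto simp: glue_def vec2_eq_iff[where k=1] oth_def len_def dir_def axis_def)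
  then show "\<exists>k. glue k p q" by blast
next
  have v: "p = vector [p $ 1, p $ 2]" for p :: "real^2"
    by (simp add: vec_eq_iff forall_2)
  assume "\<exists>k. glue k p q"
  then consider "glue 1 p q" | "glue 2 p q" using exhaust_2 by metis
  then show "L8_glue p q"
  proof cases
    case 1
    then show ?thesis
      using v[of p] v[of q] L8_glue.intros(3,4)[of "p $ 2"]
      by (auto simp: glue_def oth_def len_def dir_def axis_def)
  next
    case 2
    then show ?thesis
      using v[of p] v[of q] L8_glue.intros(1,2)[of "p $ 1"]
      by (auto simp: glue_def oth_def len_def dir_def axis_def)
  qed
qed

text \<open>Eight points: the six corners together with (1,0) and (0,1), where a side changes its
  partner. Those two are identified with the corners and hence singular.\<close>

definition vertices :: "(real^2) set" where
  "vertices = {p \<in> L8_polygon. \<forall>i. p $ i \<in> {0, 1, len i}}"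

text \<open>An explicit normal form for the equivalence closure: chains of gluings are replaced by
  an equation between values of \<open>rep\<close>. Off the vertices it moves a right or upper end
  of a cylinder back to 0.\<close>

definition rep :: "real^2 \<Rightarrow> real^2" where
  "rep p = (if p \<in> vertices then 0
            else \<chi> i. if p $ i = len i \<or> p $ i = 1 \<and> 1 \<le> p $ oth i then 0 else p $ i)"

lemma mem_vertices:
  "p \<in> vertices \<longleftrightarrow> p \<in> L8_polygon \<and> p $ k \<in> {0, 1, len k} \<and> p
      $ oth k \<in> {0, 1, len (oth k)}"
  by (auto simp: vertices_def all_oth[where k=k])

lemma rep_vertex: "p \<in> vertices \<Longrightarrow> rep p = 0"
  by (simp add: rep_def)

lemma rep_nth:
  "p \<notin> vertices \<Longrightarrow> rep p $ i = (if p $ i = len i \<or> p $ i = 1 \<and> 1 \<le> p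
      $ oth i then 0 else p $ i)"
  by (simp add: rep_def)

lemma glue_polygon: "glue k p q \<Longrightarrow> p \<in> L8_polygon \<and> q \<in> L8_polygon"
  using len_pos(3)[of "oth k"]
  by (auto simp: glue_def mem_L8_polygon[where k=k] simp del: len_pos(3))

lemma glue_rep: "glue k p q \<Longrightarrow> rep p = rep q"
proof -
  assume g: "glue k p q"
  have P: "p \<in> L8_polygon" "q \<in> L8_polygon" using glue_polygon[OF g] by auto
  have o: "q $ oth k = p $ oth k" "p $ k = 0" "q $ k \<in> {0,1,len k}"
    using g by (auto simp: glue_def)
  have v: "p \<in> vertices \<longleftrightarrow> q \<in> vertices"
    using P o by (auto simp: mem_vertices[where k=k])
  show ?thesis
  proof (cases "p \<in> vertices")
    case True
    then show ?thesis using v by (simp add: rep_vertex)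
  next
    case False
    then have "p $ oth k \<noteq> 0" "p $ oth k \<noteq> 1" "p $ oth k \<noteq> len (oth k)"
      using P o by (auto simp: mem_vertices[where k=k])
    then show ?thesis
      using False v g by (auto simp: vec2_eq_iff[where k=k] rep_nth glue_def)
  qed
qed

lemma equivclp_rep: "equivclp L8_glue p q \<Longrightarrow> rep p = rep q"
  by (induction rule: equivclp_induct) (auto simp: L8_glue_iff dest: glue_rep)

lemma equivclp_polygon: "equivclp L8_glue p q \<Longrightarrow> p \<in> L8_polygon \<Longrightarrow> q
    \<in> L8_polygon"
  by (induction rule: equivclp_induct) (auto simp: L8_glue_iff dest: glue_polygon)

abbreviation eqv where "eqv \<equiv> equivclp L8_glue"

lemma glue_eqv: "glue k p q \<Longrightarrow> eqv p q" "glue k p q \<Longrightarrow> eqv q p"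
  using r_into_equivclp[of L8_glue p q] equivclp_sym[of L8_glue p q] by (auto simp: L8_glue_iff)

lemma vertices_eqv: 
  assumes "p \<in> vertices" shows "eqv p 0"
proof -
  have A: "eqv (len k *\<^sub>R dir k) 0" for k
    by (rule glue_eqv(2)[of k]) (simp add: glue_def)
  have B: "eqv (len k *\<^sub>R dir k + dir (oth k)) (dir (oth k))" for k
    by (rule glue_eqv(2)[of k]) (simp add: glue_def)
  have C: "eqv (dir k + dir (oth k)) (dir (oth k))" for k
    by (rule glue_eqv(2)[of k]) (simp add: glue_def)
  have D: "eqv (dir k + len (oth k) *\<^sub>R dir (oth k)) (len (oth k) *\<^sub>R dir (oth k))" for k
    by (rule glue_eqv(2)[of k]) (simp add: glue_def)
  \<comment> \<open>From \<open>dir k\<close> across to the corner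
    \<open>dir k + len (oth k) *\<^sub>R dir (oth k)\<close>, along to
    \<open>len (oth k) *\<^sub>R dir (oth k)\<close>, and back to the origin.\<close>
  have E: "eqv (dir k) 0" for k
    using equivclp_trans[OF equivclp_sym[OF B[of "oth k"]]] A[of "oth k"] D[of k]
    by (metis add.commute equivclp_trans oth_oth)
  have "p $ 1 \<in> {0,1,len 1}" "p $ 2 \<in> {0,1,len 2}" and P: "p \<in> L8_polygon"
    using assms by (auto simp: vertices_def)
  then have "p = (p$1) *\<^sub>R dir 1 + (p$2) *\<^sub>R dir 2"
    by (auto simp: vec_eq_iff forall_2 dir_def axis_def)
  moreover have "oth 1 = 2" "oth 2 = 1" by (auto simp: oth_def)
  moreover have "\<not> (p$1 = len 1 \<and> p $2 = len 2)"
    using P by (auto simp: mem_L8_polygon[where k=1] oth_def not_le)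
  ultimately show ?thesis
    using \<open>p $ 1 \<in> _\<close> \<open>p $ 2 \<in> _\<close> A[of 1] A[of 2] B[of 1] B[of 2]
        C[of 1] D[of 1] D[of 2] E[of 1] E[of 2]
    by (auto simp: add.commute intro: equivclp_trans)
qed

lemma eqv_rep:
  assumes "p \<in> L8_polygon" shows "eqv p (rep p)"
proof (cases "p \<in> vertices")
  case True
  then show ?thesis by (simp add: rep_vertex vertices_eqv)
next
  case False
  show ?thesis
  proof (cases "rep p = p")
    case True
    then show ?thesis by simp
  next
    assume "rep p \<noteq> p"
    then obtain k where k: "rep p $ k \<noteq> p $ k" by (auto simp: vec_eq_iff)
    then have pk: "p $ k = len k \<or> p $ k = 1 \<and> 1 \<le> p $ oth k" and "rep p $ k = 0"
      using False by (auto simp: rep_nth split: if_splits)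
    have o: "p $ oth k \<notin> {0,1,len (oth k)}"
      using False assms pk by (auto simp: mem_vertices[where k=k])
    have "rep p = p - (p $ k) *\<^sub>R dir k"
      using False pk o by (auto simp: vec2_eq_iff[where k=k] rep_nth)
    moreover have "glue k (p - (p $ k) *\<^sub>R dir k) p"
      using pk assms by (auto simp: glue_def mem_L8_polygon[where k=k] not_le)
    ultimately show ?thesis using glue_eqv by metis
  qed
qed

lemma L8_proj_eq_iff: "L8_proj p = L8_proj q \<longleftrightarrow> eqv p q"
  unfolding L8_proj_def set_eq_iff mem_Collect_eq
  by (meson equivclp_refl equivclp_sym equivclp_trans)

lemma L8_proj_eq_rep:
  "p \<in> L8_polygon \<Longrightarrow> q \<in> L8_polygon \<Longrightarrow> L8_proj p = L8_proj q
      \<longleftrightarrow> rep p = rep q"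
  unfolding L8_proj_eq_iff using eqv_rep equivclp_rep equivclp_sym equivclp_trans by metis

lemma rep_polygon: "p \<in> L8_polygon \<Longrightarrow> rep p \<in> L8_polygon"
  using eqv_rep equivclp_polygon by blast

lemma L8_proj_rep: "p \<in> L8_polygon \<Longrightarrow> L8_proj (rep p) = L8_proj p"
  unfolding L8_proj_eq_iff by (rule equivclp_sym[OF eqv_rep])

lemma rep_le: "p \<in> L8_polygon \<Longrightarrow> rep p \<le> p"
  unfolding rep_def less_eq_vec_def by (auto simp: mem_L8_polygon[of p 1] forall_2 oth_def)

text \<open>The order is only partial, so a least element has to be exhibited: all members of a
  class share the value of \<open>rep\<close>, and it lies below each of them.\<close>

lemma L8_coords_proj:
  assumes "p \<in> L8_polygon" shows "L8_coords (L8_proj p) = rep p"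
  unfolding L8_coords_def
proof (rule Least_equality)
  show "rep p \<in> L8_proj p" using assms by (simp add: L8_proj_def eqv_rep)
  fix q assume "q \<in> L8_proj p"
  then have "eqv p q" by (simp add: L8_proj_def)
  then show "rep p \<le> q" using equivclp_rep equivclp_polygon rep_le assms by metis
qed

lemma zero_vertex [simp]: "0 \<in> vertices"
  by (simp add: vertices_def mem_L8_polygon[where k=1])

lemma vertices_polygon: "p \<in> vertices \<Longrightarrow> p \<in> L8_polygon"
  by (simp add: vertices_def)

lemma zero_polygon [simp]: "0 \<in> L8_polygon" by (simp add: vertices_polygon)

lemma rep_eq_0_iff: "p \<in> L8_polygon \<Longrightarrow> rep p = 0 \<longleftrightarrow> p \<in> vertices"
  by (auto simp: rep_vertex) (auto simp: rep_def vec_eq_iff vertices_def split: if_splits)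

lemma proj_vertex_iff: "p \<in> L8_polygon \<Longrightarrow> L8_proj p = L8_proj 0
    \<longleftrightarrow> p \<in> vertices"
  using rep_eq_0_iff[of p] by (simp add: L8_proj_eq_rep rep_vertex[of 0])

lemma L8_singularities_eq: "L8_singularities = {L8_proj 0}"
proof -
  have "{vector [0, 0], vector [1 + sqrt 2, 0], vector [1 + sqrt 2, 1],
          vector [1, 1], vector [1, sqrt 2], vector [0, sqrt 2]} \<subseteq> vertices"
    using sqrt2_bounds by (auto simp: vertices_def mem_L8_polygon[where k=1] oth_def forall_2 len_def)
  then have "\<forall>v \<in> {vector [0, 0], vector [1 + sqrt 2, 0], vector [1 + sqrt 2, 1],
          vector [1, 1], vector [1, sqrt 2], vector [0, sqrt 2]}. L8_proj v = L8_proj 0"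
    using vertices_polygon proj_vertex_iff by blast
  then show ?thesis unfolding L8_singularities_def by auto
qed

lemma proj_singular_iff: "p \<in> L8_polygon \<Longrightarrow> L8_proj p \<in> L8_singularities
    \<longleftrightarrow> p \<in> vertices"
  by (simp add: L8_singularities_eq proj_vertex_iff)

lemma topspace_L8_cases:
  assumes "P \<in> topspace L8" obtains p where "p \<in> L8_polygon" "P = L8_proj p"
  using assms by (auto simp: topspace_L8)

lemma proj_topspace [simp]: "p \<in> L8_polygon \<Longrightarrow> L8_proj p \<in> topspace L8"
  by (simp add: topspace_L8)

text \<open>Away from the vertices chains of gluings collapse: two distinct nonsingular
  representatives of one point are related by a single gluing. This finite description makes the
  identification relation accessible to topology.\<close>

lemma proj_eq_cases:
  assumes "p \<in> L8_polygon" "q \<in> L8_polygon"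
  shows "L8_proj p = L8_proj q \<longleftrightarrow>
    p = q \<or> (\<exists>k. glue k p q) \<or> (\<exists>k. glue k q p) \<or> p \<in> vertices \<and> q
        \<in> vertices"
  (is "_ \<longleftrightarrow> ?R")
proof
  assume ?R then show "L8_proj p = L8_proj q"
    using glue_rep rep_vertex unfolding L8_proj_eq_rep[OF assms] by metis
next
  assume "L8_proj p = L8_proj q"
  then have r: "rep p = rep q" using assms by (simp add: L8_proj_eq_rep)
  show ?R
  proof (cases "p \<in> vertices")
    case True
    then show ?thesis using r rep_eq_0_iff assms by metis
  next
    case F: False
    then have G: "q \<notin> vertices" using r rep_eq_0_iff assms by metis
    show ?thesis
    proof (cases "p = q")
      case False
      then obtain k where k: "p $ k \<noteq> q $ k" by (auto simp: vec_eq_iff)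
      have rk: "rep p $ i = rep q $ i" for i using r by simp
      have e: "p $ k = len k \<or> p $ k = 1 \<and> 1 \<le> p $ oth k \<or> q $ k = len k \<or> q $ k =
          1 \<and> 1 \<le> q $ oth k"
        using rk[of k] k F G by (auto simp: rep_nth split: if_splits)
      \<comment> \<open>Here \<open>a\<close> is the end that \<open>rep\<close> moves. The
        transverse coordinates agree and decide where the moved end lies, so \<open>b\<close> could
        be a moved end only by being equal to \<open>a\<close>; hence it is the end at 0.\<close>
      have *: "glue k b a" if "a \<in> L8_polygon" "b \<in> L8_polygon" "a \<notin> vertices" "b
          \<notin> vertices" "rep a = rep b" 
        "a $ k = len k \<or> a $ k = 1 \<and> 1 \<le> a $ oth k" "a $ k \<noteq> b $ k" for a b
      proof -
        have rk: "rep a $ i = rep b $ i" for i using that by simp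
        have o: "a $ oth k \<notin> {0,1,len (oth k)}"
          using that by (auto simp: mem_vertices[where k=k])
        have ra: "rep a $ k = 0" "rep a $ oth k = a $ oth k" "a $ oth k \<noteq> 0"
          using o that(6) by (auto simp: rep_nth[OF that(3)])
        have b0: "rep b $ k = 0" "rep b $ oth k = a $ oth k"
          using ra(1,2) unfolding rk[of k] rk[of "oth k"] by auto
        have bo: "b $ oth k = a $ oth k" 
          using b0(2) ra(3) by (auto simp: rep_nth[OF that(4)] split: if_splits)
        have "b $ k = 0 \<or> b $ k = len k \<or> b $ k = 1 \<and> 1 \<le> b $ oth k"
          using b0(1) by (auto simp: rep_nth[OF that(4)] split: if_splits)
        then have "b $ k = 0"
          using that(1,2,6,7) o bo by (auto simp: mem_L8_polygon[where k=k] not_le)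
        then show ?thesis
          using that bo by (auto simp: glue_def vec2_eq_iff[where k=k] mem_L8_polygon[where k=k] not_le)
      qed
      show ?thesis using e *[of p q] *[of q p] assms F G r k by metis
    qed simp
  qed
qed

section \<open>Cylinders and charts\<close>

lemma continuous_map_proj: "continuous_map (top_of_set L8_polygon) L8 L8_proj"
  by (rule quotient_imp_continuous_map[OF quotient_map_L8_proj])

lemma finite_vertices: "finite vertices"
proof -
  have "vertices \<subseteq> (\<lambda>(x, y). vector [x, y]) ` ({0,1,len 1} \<times> {0,1,len 2})"
  proof
    fix p assume "p \<in> vertices"
    then have "p $ 1 \<in> {0,1,len 1}" "p $ 2 \<in> {0,1,len 2}" by (auto simp: vertices_def)
    moreover have "p = vector [p $ 1, p $ 2]" by (simp add: vec_eq_iff forall_2)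
    ultimately show "p \<in> (\<lambda>(x, y). vector [x, y]) ` ({0,1,len 1} \<times> {0,1,len 2})"
      by (metis (no_types, lifting) SigmaI case_prod_conv imageI)
  qed
  then show ?thesis by (rule finite_subset) simp
qed

text \<open>By \<open>proj_eq_cases\<close> the relation is a finite union of closed pieces.
  Compactness of the polygon then turns this into closedness of the projection.\<close>

lemma closed_proj_relation:
  "closed {z. fst z \<in> L8_polygon \<and> snd z \<in> L8_polygon \<and> L8_proj (fst z) = L8_proj
      (snd z)}"
proof -
  have cl: "closed {z :: (real^2) \<times> (real^2). glue k (fst z) (snd z)}" for k
    unfolding glue_def
    by (intro closed_Collect_conj closed_Collect_disj closed_Collect_eq closed_Collect_le continuous_intros)
  have cl': "closed {z :: (real^2) \<times> (real^2). glue k (snd z) (fst z)}" for k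
    unfolding glue_def
    by (intro closed_Collect_conj closed_Collect_disj closed_Collect_eq closed_Collect_le continuous_intros)
  have "{z. fst z \<in> L8_polygon \<and> snd z \<in> L8_polygon \<and> L8_proj (fst z) = L8_proj (snd z)}
     = {z. fst z = snd z} \<inter> L8_polygon \<times> L8_polygon \<union> {z. glue 1 (fst z) (snd z)}
         \<union> {z. glue 2 (fst z) (snd z)}
       \<union> {z. glue 1 (snd z) (fst z)} \<union> {z. glue 2 (snd z) (fst z)} \<union> vertices
           \<times> vertices"
    (is "?L = ?R")
  proof (intro set_eqI)
    fix z :: "(real^2) \<times> (real^2)"
    have ex: "(\<exists>k. Q k) \<longleftrightarrow> Q 1 \<or> Q 2" for Q :: "2 \<Rightarrow> bool"
        using exhaust_2 by metis
    show "z \<in> ?L \<longleftrightarrow> z \<in> ?R"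
    proof (cases "fst z \<in> L8_polygon \<and> snd z \<in> L8_polygon")
      case True
      then show ?thesis using proj_eq_cases[of "fst z" "snd z"] by (cases z) (auto simp: ex)
    next
      case False
      then have "\<not> glue k (fst z) (snd z)" "\<not> glue k (snd z) (fst z)" for k using
          glue_polygon by blast+
      moreover have "z \<notin> vertices \<times> vertices" using False vertices_polygon by auto
      ultimately show ?thesis using False by (cases z) auto
    qed
  qed
  also have "closed \<dots>"
    using finite_imp_closed[OF finite_vertices] compact_imp_closed[OF compact_L8_polygon]
    by (intro closed_Un closed_Int cl cl' closed_Times closed_Collect_eq continuous_intros)
  finally show ?thesis .
qed

lemma closed_map_proj: "closed_map (top_of_set L8_polygon) L8 L8_proj"
  unfolding closed_map_def
proof (intro allI impI)
  fix C assume C: "closedin (top_of_set L8_polygon) C"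
  then have CP: "C \<subseteq> L8_polygon" and "compact C"
    using closedin_compact compact_L8_polygon closedin_imp_subset by blast+
  let ?E = "{z. fst z \<in> L8_polygon \<and> snd z \<in> L8_polygon \<and> L8_proj (fst z) = L8_proj
      (snd z)}"
  \<comment> \<open>The saturation of \<open>C\<close> is a projection of a compact part of the
    relation, hence compact.\<close>
  have "{q \<in> L8_polygon. L8_proj q \<in> L8_proj ` C} = snd ` (?E \<inter> C \<times> L8_polygon)"
  proof (intro set_eqI iffI)
    fix q assume "q \<in> {q \<in> L8_polygon. L8_proj q \<in> L8_proj ` C}"
    then obtain p where "p \<in> C" "L8_proj q = L8_proj p" "q \<in> L8_polygon" by blast
    then have "(p, q) \<in> ?E \<inter> C \<times> L8_polygon" using CP by auto
    then show "q \<in> snd ` (?E \<inter> C \<times> L8_polygon)" by (rule image_eqI[rotated]) simp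
  next
    fix q assume "q \<in> snd ` (?E \<inter> C \<times> L8_polygon)"
    then obtain p where "L8_proj p = L8_proj q" "p \<in> C" "q \<in> L8_polygon" by auto
    then show "q \<in> {q \<in> L8_polygon. L8_proj q \<in> L8_proj ` C}" by (auto intro: image_eqI[of
        _ _ p])
  qed
  moreover have "compact (snd ` (?E \<inter> C \<times> L8_polygon))"
  proof (rule compact_continuous_image)
    show "continuous_on (?E \<inter> C \<times> L8_polygon) snd" by (rule continuous_on_snd[OF
        continuous_on_id])
    have "compact (C \<times> L8_polygon)" using \<open>compact C\<close> compact_L8_polygon by (rule
        compact_Times)
    then show "compact (?E \<inter> C \<times> L8_polygon)" using closed_proj_relation
        closed_Int_compact by blast
  qed
  ultimately have "compact {q \<in> L8_polygon. L8_proj q \<in> L8_proj ` C}" by simp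
  then have "closed {q \<in> L8_polygon. L8_proj q \<in> L8_proj ` C}" by (rule compact_imp_closed)
  then have "closedin (top_of_set L8_polygon) {q \<in> L8_polygon. L8_proj q \<in> L8_proj ` C}"
    by (rule closed_subset[rotated]) blast
  then show "closedin L8 (L8_proj ` C)"
    using quotient_map_L8_proj image_mono[OF CP, of L8_proj]
    unfolding quotient_map_closedin by (simp add: topspace_L8)
qed

text \<open>A neighbourhood of a fibre of a closed map contains a saturated one. This turns
  estimates around each representative of \<open>P\<close> in the polygon into an estimate on a
  neighbourhood of \<open>P\<close> in the surface.\<close>

lemma fibre_neighbourhood:
  assumes "P \<in> topspace L8" "open S" "\<And>p. p \<in> L8_polygon \<Longrightarrow> L8_proj p = P
      \<Longrightarrow> p \<in> S"
  obtains W where "openin L8 W" "P \<in> W" "\<And>q. q \<in> L8_polygon \<Longrightarrow> L8_proj q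
      \<in> W \<Longrightarrow> q \<in> S"
proof -
  have "openin (top_of_set L8_polygon) (L8_polygon \<inter> S)" using assms by blast
  moreover have "{q \<in> topspace (top_of_set L8_polygon). L8_proj q = P} \<subseteq> L8_polygon
      \<inter> S"
    using assms(3) by auto
  ultimately obtain W where W: "openin L8 W" "P \<in> W"
      "{q \<in> topspace (top_of_set L8_polygon). L8_proj q \<in> W} \<subseteq> L8_polygon \<inter> S"
    using closed_map_proj assms(1) unfolding closed_map_fibre_neighbourhood by blast
  show ?thesis by (rule that[OF W(1,2)]) (use W(3) in auto)
qed

section \<open>Strips covering the closed cylinders\<close>

text \<open>
  The surface decomposes into two cylinders in either coordinate direction \<open>k\<close>; \<open>j = False\<close> is
  the one of height \<open>1\<close> and circumference \<open>len k\<close>, and \<open>j = True\<close> is the one of circumference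
  \<open>1\<close>.
\<close>

definition lo :: "bool \<Rightarrow> real" where "lo j = (if j then 1 else 0)"
definition hi :: "2 \<Rightarrow> bool \<Rightarrow> real" where "hi k j = (if j then len (oth k) else 1)"
definition per :: "2 \<Rightarrow> bool \<Rightarrow> real" where "per k j = (if j then 1 else len k)"

lemma per_pos [simp]: "0 < per k j" "per k j \<noteq> 0" "1 \<le> per k j" "0 \<le> per k j"
  by (auto simp: per_def)

lemma lo_hi [simp]: "lo j < hi k j" "0 \<le> lo j"
  by (auto simp: lo_def hi_def)

text \<open>The unrolled cylinder: a point of the strip is reduced modulo the circumference and then
  projected. The strip is unbounded in direction \<open>k\<close>, so that shears act on it
  directly.\<close>

definition cyl :: "2 \<Rightarrow> bool \<Rightarrow> real^2 \<Rightarrow> surface_point" where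
  "cyl k j s = L8_proj (s - (of_int \<lfloor>s $ k / per k j\<rfloor> * per k j) *\<^sub>R dir k)"

definition cstrip :: "2 \<Rightarrow> bool \<Rightarrow> (real^2) set" where
  "cstrip k j = {s. lo j \<le> s $ oth k \<and> s $ oth k \<le> hi k j}"
definition ostrip :: "2 \<Rightarrow> bool \<Rightarrow> (real^2) set" where
  "ostrip k j = {s. lo j < s $ oth k \<and> s $ oth k < hi k j}"

lemma ostrip_cstrip: "ostrip k j \<subseteq> cstrip k j"
  by (auto simp: ostrip_def cstrip_def)

lemma open_ostrip: "open (ostrip k j)"
  unfolding ostrip_def by (intro open_Collect_conj open_Collect_less continuous_intros)

lemma strip_shift [simp]:
  "s + c *\<^sub>R dir k \<in> cstrip k j \<longleftrightarrow> s \<in> cstrip k j" "s - c *\<^sub>R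
      dir k \<in> cstrip k j \<longleftrightarrow> s \<in> cstrip k j"
  "s + c *\<^sub>R dir k \<in> ostrip k j \<longleftrightarrow> s \<in> ostrip k j" "s - c *\<^sub>R
      dir k \<in> ostrip k j \<longleftrightarrow> s \<in> ostrip k j"
  by (auto simp: cstrip_def ostrip_def)

lemma cyl_shift: "cyl k j (s + (of_int m * per k j) *\<^sub>R dir k) = cyl k j s"
  by (simp add: cyl_def add_divide_distrib algebra_simps)

lemma strip_polygon:
  assumes "s \<in> cstrip k j" "0 \<le> s $ k" "s $ k \<le> per k j"
  shows "s \<in> L8_polygon"
  using assms len_pos[of k] len_pos[of "oth k"] unfolding mem_L8_polygon[where k=k]
  by (cases j) (auto simp: cstrip_def lo_def hi_def per_def simp del: len_pos)

lemma cyl_eq_proj: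
  assumes "s \<in> cstrip k j" "0 \<le> s $ k" "s $ k \<le> per k j"
  shows "cyl k j s = L8_proj s"
proof (cases "s $ k = per k j")
  case True
  then have "cyl k j s = L8_proj (s - per k j *\<^sub>R dir k)" by (simp add: cyl_def)
  moreover have "glue k (s - per k j *\<^sub>R dir k) s"
    using assms True by (cases j) (auto simp: glue_def cstrip_def lo_def hi_def per_def)
  ultimately show ?thesis using glue_eqv L8_proj_eq_iff by metis
next
  case False
  then have "\<lfloor>s $ k / per k j\<rfloor> = 0"
    using assms by (simp add: floor_eq_iff less_le)
  then show ?thesis by (simp add: cyl_def)
qed

lemma cyl_eq_proj_shift:
  assumes "s \<in> cstrip k j" "of_int m * per k j \<le> s $ k" "s $ k \<le> (of_int m + 1) * per k j"
  shows "cyl k j s = L8_proj (s - (of_int m * per k j) *\<^sub>R dir k)"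
    and "s - (of_int m * per k j) *\<^sub>R dir k \<in> L8_polygon"
proof -
  let ?s = "s - (of_int m * per k j) *\<^sub>R dir k"
  have *: "?s \<in> cstrip k j" "0 \<le> ?s $ k" "?s $ k \<le> per k j"
    using assms by (auto simp: algebra_simps)
  show "?s \<in> L8_polygon" using strip_polygon[OF *] .
  show "cyl k j s = L8_proj ?s"
    using cyl_eq_proj[OF *] cyl_shift[of k j ?s m] by simp
qed

lemma floor_bounds:
  fixes L x :: real assumes "0 < L"
  shows "of_int \<lfloor>x / L\<rfloor> * L \<le> x" "x \<le> (of_int \<lfloor>x / L\<rfloor> + 1) * L"
      "x < (of_int \<lfloor>x / L\<rfloor> + 1) * L"
  using assms floor_divide_lower[of L x] floor_divide_upper[of L x] by auto

lemma cyl_topspace: "s \<in> cstrip k j \<Longrightarrow> cyl k j s \<in> topspace L8"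
  using cyl_eq_proj_shift[OF _ floor_bounds(1,2)] per_pos by (metis proj_topspace)

text \<open>The floor jumps, but the jump is absorbed by the gluing: the pieces over the closed
  fundamental domains agree on common ends, and they form a locally finite closed cover of the
  strip.\<close>

lemma continuous_map_cyl: "continuous_map (top_of_set (cstrip k j)) L8 (cyl k j)"
proof -
  let ?T = "\<lambda>m::int. {s \<in> cstrip k j. of_int m * per k j \<le> s $ k \<and> s $ k \<le>
      (of_int m + 1) * per k j}"
  let ?f = "\<lambda>(m::int) s. L8_proj (s - (of_int m * per k j) *\<^sub>R dir k)"
  show ?thesis
  proof (rule pasting_lemma_locally_finite[where I = UNIV and T = ?T and f = ?f])
  show "closedin (top_of_set (cstrip k j)) (?T m)" for m
  proof -
    have "closed {s::real^2. of_int m * per k j \<le> s $ k \<and> s $ k \<le> (of_int m + 1) * per k j}"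
      by (intro closed_Collect_conj closed_Collect_le continuous_intros)
    then show ?thesis by (auto simp: closedin_closed)
  qed
  show "continuous_map (subtopology (top_of_set (cstrip k j)) (?T m)) L8 (?f m)" for m
  proof -
    have "?T m \<subseteq> cstrip k j" by auto
    have "continuous_map (top_of_set (?T m)) (top_of_set L8_polygon) (\<lambda>s. s - (of_int m * per k
        j) *\<^sub>R dir k)"
      using cyl_eq_proj_shift(2)[of _ k j m] by (auto intro!: continuous_intros)
    from continuous_map_compose[OF this continuous_map_proj] 
    show ?thesis by (simp add: o_def subtopology_subtopology Int_absorb1 \<open>?T m \<subseteq> _\<close>)
  qed
  show "?f m s = ?f n s" if "s \<in> topspace (top_of_set (cstrip k j)) \<inter> ?T m \<inter> ?T n"
      for m n s
    using that cyl_eq_proj_shift(1)[of s k j] by auto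
  fix s assume "s \<in> topspace (top_of_set (cstrip k j))"
  then have s: "s \<in> cstrip k j" by simp
  show "\<exists>m. m \<in> UNIV \<and> s \<in> ?T m \<and> cyl k j s = ?f m s"
    using floor_bounds[of "per k j" "s $ k"] s cyl_eq_proj_shift(1)[OF s] by auto
  let ?V = "cstrip k j \<inter> ball s 1"
  \<comment> \<open>Circumferences are at least 1, so a unit ball meets only fundamental domains
    whose index is bounded in terms of \<open>s $ k\<close>.\<close>
  have "{m \<in> UNIV. ?T m \<inter> ?V \<noteq> {}} \<subseteq> {m. \<bar>m\<bar> \<le>
      \<lceil>\<bar>s $ k\<bar> + 2\<rceil>}"
  proof
    fix m :: int assume "m \<in> {m \<in> UNIV. ?T m \<inter> ?V \<noteq> {}}"
    then obtain t where t: "t \<in> ball s 1" "of_int m * per k j \<le> t $ k" "t $ k \<le> (of_int m +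
        1) * per k j"
      by auto
    have "\<bar>t $ k - s $ k\<bar> < 1"
      using t(1) component_le_norm_cart[of "t - s" k] by (simp add: dist_norm norm_minus_commute)
    then have "\<bar>t $ k\<bar> < \<bar>s $ k\<bar> + 1" by arith
    moreover have "\<bar>of_int m :: real\<bar> \<le> \<bar>t $ k\<bar> + 1"
    proof (cases "0 \<le> m")
      case True
      then have "of_int m * 1 \<le> of_int m * per k j" by (intro mult_left_mono) auto
      then show ?thesis using True t by auto
    next
      case False
      then have "(of_int m + 1) * per k j \<le> (of_int m + 1) * 1" by (intro mult_left_mono_neg) auto
      then show ?thesis using False t by auto
    qed
    ultimately have "\<bar>of_int m :: real\<bar> \<le> \<bar>s $ k\<bar> + 2" by linarith
    then show "m \<in> {m. \<bar>m\<bar> \<le> \<lceil>\<bar>s $ k\<bar> + 2\<rceil>}" unfolding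
        mem_Collect_eq by linarith
  qed
  moreover have "finite {m::int. \<bar>m\<bar> \<le> \<lceil>\<bar>s $ k\<bar> + 2\<rceil>}"
    by (rule finite_subset[of _ "{-\<lceil>\<bar>s $ k\<bar> + 2\<rceil>..\<lceil>\<bar>s $ k\<bar> +
        2\<rceil>}"]) auto
  ultimately have "finite {m \<in> UNIV. ?T m \<inter> ?V \<noteq> {}}" by (rule finite_subset)
  then show "\<exists>V. openin (top_of_set (cstrip k j)) V \<and> s \<in> V \<and> finite {m \<in>
      UNIV. ?T m \<inter> V \<noteq> {}}"
    using s by (intro exI[of _ ?V]) auto
  qed
qed

lemma ostrip_polygon_bounds:
  assumes "p \<in> L8_polygon" "p \<in> ostrip k j"
  shows "0 \<le> p $ k" "p $ k \<le> per k j"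
  using assms by (auto simp: mem_L8_polygon[where k=k] ostrip_def lo_def hi_def per_def split: if_splits)

lemma ostrip_polygon_cyl: "p \<in> L8_polygon \<Longrightarrow> p \<in> ostrip k j \<Longrightarrow>
    cyl k j p = L8_proj p"
  using cyl_eq_proj ostrip_polygon_bounds ostrip_cstrip by blast

lemma ostrip_not_vertex: "p \<in> ostrip k j \<Longrightarrow> p \<notin> vertices"
  by (auto simp: mem_vertices[where k=k] ostrip_def lo_def hi_def split: if_splits)

lemma rep_ostrip_iff:
  assumes "p \<in> L8_polygon" shows "rep p \<in> ostrip k j \<longleftrightarrow> p \<in> ostrip k j"
proof (cases "p \<in> vertices")
  case True
  then show ?thesis
    using ostrip_not_vertex zero_vertex by (metis rep_vertex)
next
  case False
  have "p $ oth k \<noteq> len (oth k)" "\<not> (p $ oth k = 1 \<and> 1 \<le> p $ k)" if "p \<in>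
      ostrip k j"
    using that by (auto simp: ostrip_def lo_def hi_def split: if_splits)
  moreover have "0 \<le> p $ oth k" using assms by (simp add: mem_L8_polygon[where k=k])
  ultimately show ?thesis
    unfolding ostrip_def by (auto simp: rep_nth[OF False] lo_def split: if_splits)
qed

lemma rep_ostrip:
  assumes "p \<in> L8_polygon" "p \<in> ostrip k j"
  shows "rep p = (if p $ k = per k j then p - per k j *\<^sub>R dir k else p)"
  using assms ostrip_not_vertex[OF assms(2)]
  by (auto simp: vec2_eq_iff[where k=k] rep_nth ostrip_def lo_def hi_def per_def mem_L8_polygon[where
      k=k] split: if_splits)

text \<open>Over an open cylinder full turns are the only identifications, since \<open>rep\<close>
  can change the coordinate in direction \<open>k\<close> only. Injectivity, openness and the
  translation property of the charts below all rest on this.\<close>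

lemma proj_eq_cyl_iff:
  assumes "p \<in> L8_polygon" "s \<in> ostrip k j"
  shows "L8_proj p = cyl k j s \<longleftrightarrow> (\<exists>m::int. s = p + (of_int m * per k j)
      *\<^sub>R dir k)"
proof
  assume "\<exists>m::int. s = p + (of_int m * per k j) *\<^sub>R dir k"
  then show "L8_proj p = cyl k j s"
    using assms ostrip_polygon_cyl[of p k j] by (auto simp: cyl_shift)
next
  assume eq: "L8_proj p = cyl k j s"
  let ?n = "\<lfloor>s $ k / per k j\<rfloor>"
  let ?s = "s - (of_int ?n * per k j) *\<^sub>R dir k"
  have s: "?s \<in> L8_polygon" "?s \<in> ostrip k j" "?s $ k \<noteq> per k j" "L8_proj p = L8_proj ?s"
    using cyl_eq_proj_shift[OF _ floor_bounds(1,2), of s k j] floor_bounds(3)[of "per k j" "s $ k"]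
        assms ostrip_cstrip eq
    by (auto simp: algebra_simps)
  have "rep p = ?s" using s rep_ostrip[of ?s k j] assms by (simp add: L8_proj_eq_rep)
  moreover have "p \<in> ostrip k j" using \<open>rep p = ?s\<close> s assms rep_ostrip_iff by metis
  ultimately have "?s = p \<or> ?s = p - per k j *\<^sub>R dir k" using rep_ostrip[OF assms(1), of k j]
      by metis
  then have "s = p + (of_int ?n * per k j) *\<^sub>R dir k \<or> s = p + (of_int (?n - 1) * per k j)
      *\<^sub>R dir k"
    by (auto simp: algebra_simps)
  then show "\<exists>m::int. s = p + (of_int m * per k j) *\<^sub>R dir k" by blast
qed

lemma cyl_inj:
  assumes "s \<in> ostrip k j" "t \<in> ostrip k j" "cyl k j s = cyl k j t" "\<bar>s $ k - t $ k\<bar>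
      < per k j"
  shows "s = t"
proof -
  obtain p where p: "p \<in> L8_polygon" "L8_proj p = cyl k j s"
    using cyl_topspace[of s k j] ostrip_cstrip assms topspace_L8_cases by (metis subsetD)
  then obtain m n :: int where m: "s = p + (of_int m * per k j) *\<^sub>R dir k" "t = p + (of_int n *
      per k j) *\<^sub>R dir k"
    using proj_eq_cyl_iff assms by metis
  then have "s $ k - t $ k = of_int (m - n) * per k j" by (simp add: algebra_simps)
  then have "\<bar>of_int (m - n) :: real\<bar> < 1" using assms(4) by (simp add: abs_mult)
  then have "m = n" by linarith
  then show ?thesis using m by simp
qed

section \<open>Charts obtained from the strips\<close>

lemma openin_cyl_image:
  assumes "open W" "W \<subseteq> ostrip k j" shows "openin L8 (cyl k j ` W)"
proof -
  have sub: "cyl k j ` W \<subseteq> topspace L8"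
    using cyl_topspace ostrip_cstrip assms by blast
  have "{p \<in> L8_polygon. L8_proj p \<in> cyl k j ` W}
      = L8_polygon \<inter> (\<Union>m::int. (\<lambda>s. - (of_int m * per k j) *\<^sub>R dir k + s) `
          W)" (is "?L = ?R")
  proof (intro set_eqI iffI)
    fix p assume "p \<in> ?L"
    then obtain s where "s \<in> W" "L8_proj p = cyl k j s" "p \<in> L8_polygon" by auto
    then show "p \<in> ?R" using proj_eq_cyl_iff[of p s k j] assms by force
  next
    fix p assume "p \<in> ?R"
    then obtain s m where *: "s \<in> W" "p = - (of_int m * per k j) *\<^sub>R dir k + s" "p \<in>
        L8_polygon" by auto
    then have "s = p + (of_int m * per k j) *\<^sub>R dir k" by simp
    then show "p \<in> ?L" using * proj_eq_cyl_iff[of p s k j] assms by blast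
  qed
  also have "openin (top_of_set L8_polygon) \<dots>"
    using assms(1) by (intro openin_open_Int open_UN ballI open_translation)
  finally show ?thesis using sub by (simp add: openin_L8 topspace_L8)
qed

text \<open>A part of the strip narrower than the circumference embeds in the surface. The inverse
  of the embedding differs from the polygon coordinates by a whole number of turns, which is
  constant near each polygon point.\<close>

lemma translation_chart_cyl:
  assumes W: "open W" "W \<subseteq> ostrip k j" and small: "\<And>s t. s \<in> W \<Longrightarrow> t
      \<in> W \<Longrightarrow> \<bar>s $ k - t $ k\<bar> < per k j"
  shows "translation_chart (cyl k j ` W) (inv_into W (cyl k j))"
proof -
  let ?U = "cyl k j ` W" and ?\<phi> = "inv_into W (cyl k j)"
  have inj: "inj_on (cyl k j) W"
  proof (rule inj_onI)
    fix s t assume "s \<in> W" "t \<in> W" "cyl k j s = cyl k j t"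
    then show "s = t" using cyl_inj[of s k j t] W(2) small by blast
  qed
  have op: "openin L8 ?U" using openin_cyl_image W by blast
  have im: "?\<phi> ` ?U = W" using inj by (simp add: inv_into_image_cancel)
  have "homeomorphic_map (top_of_set W) (subtopology L8 ?U) (cyl k j)"
  proof (rule bijective_open_imp_homeomorphic_map)
    show "continuous_map (top_of_set W) (subtopology L8 ?U) (cyl k j)"
      using continuous_map_from_subtopology[OF continuous_map_cyl[of k j], of W] W ostrip_cstrip[of k j]
      by (simp add: continuous_map_in_subtopology subtopology_subtopology Int_absorb1 subset_trans)
    show "open_map (top_of_set W) (subtopology L8 ?U) (cyl k j)"
      unfolding open_map_def
    proof (intro allI impI)
      fix S assume S: "openin (top_of_set W) S"
      then have "open S" "S \<subseteq> W" using W openin_open_eq by blast+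
      then have "openin L8 (cyl k j ` S)" using openin_cyl_image W by blast
      then show "openin (subtopology L8 ?U) (cyl k j ` S)"
        using \<open>S \<subseteq> W\<close> by (simp add: image_mono openin_open_subtopology op)
    qed
    show "cyl k j ` topspace (top_of_set W) = topspace (subtopology L8 ?U)"
      using openin_subset[OF op] by auto
    show "inj_on (cyl k j) (topspace (top_of_set W))" using inj by simp
  qed
  then obtain g where g: "homeomorphic_maps (top_of_set W) (subtopology L8 ?U) (cyl k j) g"
    by (auto simp: homeomorphic_map_maps)
  have geq: "g Q = ?\<phi> Q" if "Q \<in> ?U" for Q
    using g that inj by (auto simp: homeomorphic_maps_def)
  have "homeomorphic_map (subtopology L8 ?U) (top_of_set W) g"
    using g homeomorphic_maps_map by blast
  then have hom: "homeomorphic_map (subtopology L8 ?U) (top_of_set W) ?\<phi>"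
    by (rule homeomorphic_map_eq) (use geq in auto)
  have ns: "?U \<inter> L8_singularities = {}"
  proof -
    have "cyl k j s \<noteq> L8_proj 0" if "s \<in> W" for s
    proof
      assume "cyl k j s = L8_proj 0"
      moreover have s: "s \<in> ostrip k j" using that W by blast
      ultimately obtain m :: int where "s = 0 + (of_int m * per k j) *\<^sub>R dir k"
        using proj_eq_cyl_iff[OF zero_polygon s] by metis
      then have "0 \<in> ostrip k j" using s by (metis strip_shift(3))
      then show False using ostrip_not_vertex zero_vertex by blast
    qed
    then show ?thesis by (auto simp: L8_singularities_eq)
  qed
  have "\<exists>c. \<exists>e>0. \<forall>q \<in> L8_polygon \<inter> ball p e. L8_proj q \<in> ?U
      \<longrightarrow> ?\<phi> (L8_proj q) = q + c"
    if p: "p \<in> L8_polygon" "L8_proj p \<in> ?U" for p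
  proof -
    obtain s where s: "s \<in> W" "L8_proj p = cyl k j s" using p by auto
    then have "s \<in> ostrip k j" using W by blast
    then obtain m :: int where m: "s = p + (of_int m * per k j) *\<^sub>R dir k"
      using proj_eq_cyl_iff[OF p(1)] s(2) by blast
    obtain e where e: "e > 0" "ball s e \<subseteq> W" using W s open_contains_ball by blast
    have "?\<phi> (L8_proj q) = q + (of_int m * per k j) *\<^sub>R dir k" if "q \<in> L8_polygon
        \<inter> ball p e" for q
    proof -
      have "q + (of_int m * per k j) *\<^sub>R dir k \<in> W"
        using that e m by (intro subsetD[OF e(2)]) (simp add: dist_norm)
      moreover have "L8_proj q = cyl k j (q + (of_int m * per k j) *\<^sub>R dir k)"
        using calculation W that proj_eq_cyl_iff[of q _ k j] by blast
      ultimately show ?thesis using inv_into_f_f[OF inj] by simp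
    qed
    then show ?thesis using e(1) by blast
  qed
  then show ?thesis
    unfolding translation_chart_def using op ns im hom W(1) by simp
qed

lemma cylinder_chart:
  assumes "s \<in> ostrip k j" "0 < e"
  obtains r where "0 < r" "r \<le> e" "ball s r \<subseteq> ostrip k j" "inj_on (cyl k j) (ball s r)"
    "translation_chart (cyl k j ` ball s r) (inv_into (ball s r) (cyl k j))"
proof -
  obtain d where d: "d > 0" "ball s d \<subseteq> ostrip k j"
    using open_ostrip assms open_contains_ball by blast
  define r where "r = min (min d e) (1/2)"
  have r: "r > 0" "r \<le> 1/2" "r \<le> e" "ball s r \<subseteq> ostrip k j" using d assms by (auto
      simp: r_def)
  have small: "\<bar>x $ k - y $ k\<bar> < per k j" if "x \<in> ball s r" "y \<in> ball s r" for x y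
  proof -
    have "\<bar>x $ k - y $ k\<bar> \<le> dist x y" using component_le_norm_cart[of "x - y" k] by (simp
        add: dist_norm)
    also have "\<dots> < 1" using that r(2) dist_triangle_half_r[of s x 1 y] by auto
    finally show ?thesis using per_pos(3)[of k j] by linarith
  qed
  have "inj_on (cyl k j) (ball s r)"
  proof (rule inj_onI)
    fix x y assume "x \<in> ball s r" "y \<in> ball s r" "cyl k j x = cyl k j y"
    then show "x = y" using cyl_inj[of x k j y] r(4) small by blast
  qed
  then show ?thesis
    using that[of r] r translation_chart_cyl[OF open_ball r(4) small] by blast
qed

text \<open>A point lying on cylinder boundaries in both directions is a vertex. So the open
  cylinders of the two directions together cover the nonsingular part, and charts from strips
  suffice everywhere.\<close>

lemma nonsingular_ostrip:
  assumes "p \<in> L8_polygon" "p \<notin> vertices"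
  obtains k j where "p \<in> ostrip k j" "cyl k j p = L8_proj p"
proof -
  have "\<exists>k. p $ oth k \<notin> {0, 1, len (oth k)}"
    using assms by (metis (no_types, lifting) mem_vertices oth_oth)
  then obtain k where k: "p $ oth k \<notin> {0, 1, len (oth k)}" by blast
  then have "p \<in> ostrip k (1 < p $ oth k)"
    using assms(1) by (auto simp: ostrip_def lo_def hi_def mem_L8_polygon[where k=k])
  then show ?thesis using that ostrip_polygon_cyl assms by blast
qed

text \<open>Reduces affinity of a map of the surface to a formula in strip coordinates. The ball
  around \<open>s\<close> is shrunk until it embeds and its affine image stays in an embedded ball
  of the target strip.\<close>

lemma affine_near_cyl:
  assumes "s \<in> ostrip k j" "A *v s + b \<in> ostrip k' j'" "0 < e"
    and f: "\<And>t. t \<in> ball s e \<Longrightarrow> f (cyl k j t) = cyl k' j' (A *v t + b)"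
  shows "affine_near f A (cyl k j s)"
proof -
  let ?M = "\<lambda>t. A *v t + b"
  obtain r' where r': "0 < r'" "ball (?M s) r' \<subseteq> ostrip k' j'" "inj_on (cyl k' j') (ball (?M
      s) r')"
    "translation_chart (cyl k' j' ` ball (?M s) r') (inv_into (ball (?M s) r') (cyl k' j'))"
    using cylinder_chart[OF assms(2) zero_less_one] .
  have "isCont ((*v) A) s"
    by (intro linear_continuous_at matrix_vector_mul_bounded_linear)
  then have "isCont ?M s" by (intro continuous_add continuous_const)
  then obtain d where d: "d > 0" "\<And>t. dist t s < d \<Longrightarrow> dist (?M t) (?M s) < r'"
    using r'(1) unfolding continuous_at_eps_delta by blast
  obtain r where r: "0 < r" "r \<le> min d e" "ball s r \<subseteq> ostrip k j" "inj_on (cyl k j) (ball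
      s r)"
    "translation_chart (cyl k j ` ball s r) (inv_into (ball s r) (cyl k j))"
    using cylinder_chart[OF assms(1), of "min d e"] d(1) assms(3) by auto
  have *: "f (cyl k j t) = cyl k' j' (?M t)" "?M t \<in> ball (?M s) r'" if "t \<in> ball s r" for t
    using that r(2) d(2)[of t] f by (auto simp: dist_commute)
  let ?U = "cyl k j ` ball s r" and ?V = "cyl k' j' ` ball (?M s) r'"
  let ?\<phi> = "inv_into (ball s r) (cyl k j)" and ?\<psi> = "inv_into (ball (?M s) r') (cyl k' j')"
  have "cyl k j s \<in> ?U" using r(1) by (intro imageI) simp
  moreover have "f ` ?U \<subseteq> ?V" using * by (auto intro!: imageI simp del: mem_ball)
  moreover have "\<forall>Q\<in>?U. ?\<psi> (f Q) = A *v ?\<phi> Q + b"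
  proof
    fix Q assume "Q \<in> ?U"
    then obtain t where t: "t \<in> ball s r" "Q = cyl k j t" by blast
    then have "?\<psi> (f Q) = ?M t" using * inv_into_f_f[OF r'(3)] by metis
    then show "?\<psi> (f Q) = A *v ?\<phi> Q + b" using t inv_into_f_f[OF r(4) t(1)] by simp
  qed
  ultimately show ?thesis unfolding affine_near_def using r(5) r'(4) by blast
qed

section \<open>The group of affine automorphisms\<close>

lemma chart_openin: "translation_chart U \<phi> \<Longrightarrow> openin L8 U"
  by (simp add: translation_chart_def)

lemma chart_inj_on:
  assumes "translation_chart U \<phi>" shows "inj_on \<phi> U"
proof -
  have "topspace (subtopology L8 U) = U"
    using openin_subset[OF chart_openin[OF assms]] by auto
  then show ?thesis
    using assms homeomorphic_imp_injective_map unfolding translation_chart_def by metis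
qed

lemma chart_local:
  assumes "translation_chart U \<phi>" "p \<in> L8_polygon" "L8_proj p \<in> U"
  obtains e where "e > 0"
    "\<And>q. q \<in> L8_polygon \<Longrightarrow> dist p q < e \<Longrightarrow> L8_proj q \<in> U
        \<Longrightarrow> \<phi> (L8_proj q) = \<phi> (L8_proj p) + (q - p)"
proof -
  obtain c e where e: "e > 0" "\<And>q. q \<in> L8_polygon \<inter> ball p e \<Longrightarrow> L8_proj
      q \<in> U \<Longrightarrow> \<phi> (L8_proj q) = q + c"
    using assms unfolding translation_chart_def by meson
  then have "\<phi> (L8_proj p) = p + c" using assms by simp
  then show ?thesis using that[OF e(1)] e(2) by simp
qed

text \<open>A point may have several polygon representatives, and the translation constant of a
  chart depends on the representative. Here one representative \<open>p\<close> serves both charts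
  at once, so the constants cancel when the charts are compared.\<close>

lemma charts_near:
  assumes "translation_chart U \<phi>" "translation_chart V \<psi>" "P \<in> U" "P \<in> V" "d > 0"
  obtains W where "openin L8 W" "P \<in> W" "W \<subseteq> U" "W \<subseteq> V"
    "\<And>q. q \<in> L8_polygon \<Longrightarrow> L8_proj q \<in> W \<Longrightarrow> \<exists>p \<in>
        L8_polygon. L8_proj p = P \<and> dist p q < d \<and>
        \<phi> (L8_proj q) = \<phi> P + (q - p) \<and> \<psi> (L8_proj q) = \<psi> P + (q - p)"
proof -
  have PT: "P \<in> topspace L8" using assms(1,3) chart_openin openin_subset by blast
  define good where "good p e \<longleftrightarrow> e > 0 \<and> e \<le> d \<and> (\<forall>q \<in>
      L8_polygon. dist p q < e \<longrightarrow> L8_proj q \<in> U \<inter> V \<longrightarrow>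
     \<phi> (L8_proj q) = \<phi> P + (q - p) \<and> \<psi> (L8_proj q) = \<psi> P + (q - p))" for p e
  have "\<exists>e. good p e" if p: "p \<in> L8_polygon" "L8_proj p = P" for p
  proof -
    obtain e1 where e1: "e1 > 0" "\<And>q. q \<in> L8_polygon \<Longrightarrow> dist p q < e1
        \<Longrightarrow> L8_proj q \<in> U \<Longrightarrow> \<phi> (L8_proj q) = \<phi> (L8_proj p) +
        (q - p)"
      using chart_local[OF assms(1) p(1)] p assms by metis
    obtain e2 where e2: "e2 > 0" "\<And>q. q \<in> L8_polygon \<Longrightarrow> dist p q < e2
        \<Longrightarrow> L8_proj q \<in> V \<Longrightarrow> \<psi> (L8_proj q) = \<psi> (L8_proj p) +
        (q - p)"
      using chart_local[OF assms(2) p(1)] p assms by metis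
    have "good p (min d (min e1 e2))" unfolding good_def using e1 e2 assms(5) p by auto
    then show ?thesis by blast
  qed
  then obtain e where e: "\<And>p. p \<in> L8_polygon \<Longrightarrow> L8_proj p = P \<Longrightarrow>
      good p (e p)" by metis
  let ?S = "\<Union>p \<in> {p \<in> L8_polygon. L8_proj p = P}. ball p (e p)"
  obtain W where W: "openin L8 W" "P \<in> W" "\<And>q. q \<in> L8_polygon \<Longrightarrow> L8_proj q
      \<in> W \<Longrightarrow> q \<in> ?S"
  proof (rule fibre_neighbourhood[OF PT, of ?S])
    show "open ?S" by (intro open_UN ballI open_ball)
    show "p \<in> ?S" if "p \<in> L8_polygon" "L8_proj p = P" for p
    proof (rule UN_I)
      show "p \<in> ball p (e p)" using e that unfolding good_def by simp
    qed (use that in simp)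
  qed blast
  show ?thesis
  proof (rule that[of "W \<inter> U \<inter> V"])
    show "openin L8 (W \<inter> U \<inter> V)" using W(1) assms chart_openin by (intro openin_Int) auto
    fix q assume q: "q \<in> L8_polygon" "L8_proj q \<in> W \<inter> U \<inter> V"
    then obtain p where p: "p \<in> L8_polygon" "L8_proj p = P" "dist p q < e p" using W(3)[of q] by auto
    have "good p (e p)" using e p by blast
    then show "\<exists>p \<in> L8_polygon. L8_proj p = P \<and> dist p q < d \<and>
        \<phi> (L8_proj q) = \<phi> P + (q - p) \<and> \<psi> (L8_proj q) = \<psi> P + (q - p)"
      using p q unfolding good_def by (intro bexI[of _ p]) auto
  qed (use W assms in auto)
qed

lemma chart_transition:
  assumes "translation_chart U \<phi>" "translation_chart V \<psi>" "P \<in> U" "P \<in> V"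
  obtains W where "openin L8 W" "P \<in> W" "W \<subseteq> U" "W \<subseteq> V" "\<forall>Q\<in>W.
      \<psi> Q = \<phi> Q + (\<psi> P - \<phi> P)"
proof (rule charts_near[OF assms zero_less_one])
  fix W assume W: "openin L8 W" "P \<in> W" "W \<subseteq> U" "W \<subseteq> V"
    "\<And>q. q \<in> L8_polygon \<Longrightarrow> L8_proj q \<in> W \<Longrightarrow> \<exists>p \<in>
        L8_polygon. L8_proj p = P \<and> dist p q < 1 \<and>
        \<phi> (L8_proj q) = \<phi> P + (q - p) \<and> \<psi> (L8_proj q) = \<psi> P + (q - p)"
  have "\<psi> Q = \<phi> Q + (\<psi> P - \<phi> P)" if "Q \<in> W" for Q
  proof -
    have "Q \<in> topspace L8" using W(1) that openin_subset by blast
    then obtain q where q: "q \<in> L8_polygon" "Q = L8_proj q" by (rule topspace_L8_cases)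
    then obtain p where "\<phi> (L8_proj q) = \<phi> P + (q - p)" "\<psi> (L8_proj q) = \<psi> P + (q - p)"
      using W(5) \<open>Q \<in> W\<close> by blast
    then show ?thesis using q by simp
  qed
  then show thesis using that W(1-4) by blast
qed

lemma chart_restrict:
  assumes "translation_chart U \<phi>" "openin L8 W" "W \<subseteq> U" shows "translation_chart W \<phi>"
proof -
  have U: "openin L8 U" "U \<inter> L8_singularities = {}" "open (\<phi> ` U)"
    "homeomorphic_map (subtopology L8 U) (top_of_set (\<phi> ` U)) \<phi>"
    "\<forall>p\<in>L8_polygon. L8_proj p \<in> U \<longrightarrow>
        (\<exists>c. \<exists>e>0. \<forall>q \<in> L8_polygon \<inter> ball p e. L8_proj q \<in> U
            \<longrightarrow> \<phi> (L8_proj q) = q + c)"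
    using assms(1) unfolding translation_chart_def by auto
  have tU: "topspace (subtopology L8 U) = U" using openin_subset[OF U(1)] by auto
  have "openin (subtopology L8 U) W" using assms(2,3) U(1) by (simp add: openin_open_subtopology)
  then have "openin (top_of_set (\<phi> ` U)) (\<phi> ` W)"
    using U(4) homeomorphic_imp_open_map open_map_def by blast
  then have op: "open (\<phi> ` W)" using U(3) openin_open_eq by blast
  have "homeomorphic_map (subtopology (subtopology L8 U) W) (subtopology (top_of_set (\<phi> ` U))
      (\<phi> ` W)) \<phi>"
    by (rule homeomorphic_map_subtopologies[OF U(4)]) (use assms(3) tU in auto)
  then have "homeomorphic_map (subtopology L8 W) (top_of_set (\<phi> ` W)) \<phi>"
    using Int_absorb1[OF assms(3)] Int_absorb1[OF image_mono[OF assms(3), of \<phi>]]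
    by (simp add: subtopology_subtopology)
  moreover have "\<forall>p\<in>L8_polygon. L8_proj p \<in> W \<longrightarrow>
        (\<exists>c. \<exists>e>0. \<forall>q \<in> L8_polygon \<inter> ball p e. L8_proj q \<in> W
            \<longrightarrow> \<phi> (L8_proj q) = q + c)"
  proof (intro ballI impI)
    fix p assume "p \<in> L8_polygon" "L8_proj p \<in> W"
    moreover from this have "L8_proj p \<in> U" using assms(3) by blast
    ultimately obtain c e where "e > 0" "\<forall>q \<in> L8_polygon \<inter> ball p e. L8_proj q \<in>
        U \<longrightarrow> \<phi> (L8_proj q) = q + c"
      using U(5) by blast
    then show "\<exists>c. \<exists>e>0. \<forall>q \<in> L8_polygon \<inter> ball p e. L8_proj q \<in>
        W \<longrightarrow> \<phi> (L8_proj q) = q + c"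
      using assms(3) by (intro exI[of _ c] exI[of _ e]) auto
  qed
  ultimately show ?thesis
    unfolding translation_chart_def using assms(2,3) U(2) op by blast
qed

lemma affine_nearE:
  assumes "affine_near f A P"
  obtains U \<phi> V \<psi> b where "translation_chart U \<phi>" "translation_chart V \<psi>" "P \<in>
      U" "f ` U \<subseteq> V"
    "\<forall>Q\<in>U. \<psi> (f Q) = A *v \<phi> Q + b"
proof -
  obtain U \<phi> V \<psi> b where "translation_chart U \<phi> \<and> translation_chart V \<psi> \<and>
      P \<in> U \<and> f ` U \<subseteq> V \<and>
        (\<forall>Q\<in>U. \<psi> (f Q) = A *v \<phi> Q + b)"
    using assms unfolding affine_near_def by (elim exE)
  then show ?thesis using that[of U \<phi> V \<psi> b] by blast
qed

lemma affine_near_compose: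
  assumes f: "affine_near f A P" "continuous_map L8 L8 f" and g: "affine_near g B (f P)"
  shows "affine_near (g \<circ> f) (B ** A) P"
proof -
  obtain U \<phi> V \<psi> b where 1: "translation_chart U \<phi>" "translation_chart V \<psi>" "P
      \<in> U" "f ` U \<subseteq> V"
    "\<forall>Q\<in>U. \<psi> (f Q) = A *v \<phi> Q + b" using affine_nearE[OF f(1)] .
  obtain U' \<phi>' V' \<psi>' b' where 2: "translation_chart U' \<phi>'" "translation_chart V'
      \<psi>'" "f P \<in> U'" "g ` U' \<subseteq> V'"
    "\<forall>Q\<in>U'. \<psi>' (g Q) = B *v \<phi>' Q + b'" using affine_nearE[OF g] .
  have "f P \<in> V" using 1 by blast
  obtain W where W: "openin L8 W" "f P \<in> W" "W \<subseteq> V" "W \<subseteq> U'"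
      "\<forall>Q\<in>W. \<phi>' Q = \<psi> Q + (\<phi>' (f P) - \<psi> (f P))"
    using chart_transition[OF 1(2) 2(1) \<open>f P \<in> V\<close> 2(3)] .
  define U0 where "U0 = U \<inter> {Q \<in> topspace L8. f Q \<in> W}"
  have op: "openin L8 U0" unfolding U0_def
    using chart_openin[OF 1(1)] openin_continuous_map_preimage[OF f(2) W(1)] by (rule openin_Int)
  have "translation_chart U0 \<phi>" by (rule chart_restrict[OF 1(1) op]) (simp add: U0_def)
  moreover have "P \<in> U0" using 1(3) W(2) openin_subset[OF chart_openin[OF 1(1)]] by (auto simp: U0_def)
  moreover have "(g \<circ> f) ` U0 \<subseteq> V'" using 2(4) W(4) by (auto simp: U0_def)
  moreover have "\<psi>' ((g \<circ> f) Q) = (B ** A) *v \<phi> Q + (B *v (b + (\<phi>' (f P) - \<psi>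
      (f P))) + b')" if "Q \<in> U0" for Q
  proof -
    have "f Q \<in> W" "Q \<in> U" using that by (auto simp: U0_def)
    then have "\<psi>' (g (f Q)) = B *v (A *v \<phi> Q + b + (\<phi>' (f P) - \<psi> (f P))) + b'"
      using 2(5) W(4,5) 1(5) by auto
    then show ?thesis by (simp add: matrix_vector_mul_assoc[symmetric] matrix_vector_right_distrib
        add.assoc)
  qed
  ultimately show ?thesis unfolding affine_near_def using 2(2) by blast
qed

lemma matrix_inv_mult:
  fixes A :: "real^'n^'n" assumes "invertible A"
  shows "matrix_inv A ** A = mat 1" "A ** matrix_inv A = mat 1"
  using someI_ex[OF assms[unfolded invertible_def]] unfolding matrix_inv_def by auto

lemma affine_near_inverse:
  assumes f: "affine_near f A P" and hom: "homeomorphic_maps L8 L8 f g" and A: "invertible A"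
  shows "affine_near g (matrix_inv A) (f P)"
proof -
  obtain U \<phi> V \<psi> b where 1: "translation_chart U \<phi>" "translation_chart V \<psi>" "P
      \<in> U" "f ` U \<subseteq> V"
    "\<forall>Q\<in>U. \<psi> (f Q) = A *v \<phi> Q + b" using affine_nearE[OF f(1)] .
  have "openin L8 (f ` U)"
    using hom homeomorphic_maps_map homeomorphic_imp_open_map chart_openin[OF 1(1)] open_map_def by metis
  then have "translation_chart (f ` U) \<psi>" using chart_restrict[OF 1(2)] 1(4) by blast
  moreover have gf: "g (f Q) = Q" if "Q \<in> U" for Q
    using that openin_subset[OF chart_openin[OF 1(1)]] hom by (auto simp: homeomorphic_maps_def)
  moreover have "g ` f ` U \<subseteq> U" using gf by auto
  moreover have "\<phi> (g Q) = matrix_inv A *v \<psi> Q + (- (matrix_inv A *v b))" if Q: "Q \<in> f `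
      U" for Q
  proof -
    obtain R where R: "R \<in> U" "Q = f R" using Q by blast
    have "matrix_inv A *v (A *v \<phi> R) = \<phi> R"
      using A by (simp add: matrix_vector_mul_assoc matrix_inv_mult(1))
    then show ?thesis using R gf 1(5) by (simp add: matrix_vector_right_distrib)
  qed
  ultimately show ?thesis unfolding affine_near_def using 1(1,3) by blast
qed

text \<open>In \<open>Aff_L8\<close> the positive determinant belongs to a matrix chosen for each
  point, not to the given derivative. Invertibility of the latter comes from injectivity: a kernel
  vector would collapse a short segment in a chart.\<close>

lemma affine_near_imp_invertible:
  assumes "affine_near f A P" "inj_on f (topspace L8)"
  shows "invertible A"
proof -
  obtain U \<phi> V \<psi> b where 1: "translation_chart U \<phi>" "translation_chart V \<psi>" "P
      \<in> U" "f ` U \<subseteq> V"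
    "\<forall>Q\<in>U. \<psi> (f Q) = A *v \<phi> Q + b" using affine_nearE[OF assms(1)] .
  have "open (\<phi> ` U)" using 1(1) unfolding translation_chart_def by blast
  then obtain e where e: "e > 0" "cball (\<phi> P) e \<subseteq> \<phi> ` U" using 1(3)
      open_contains_cball by blast
  have "x = 0" if x: "A *v x = 0" for x
  proof (rule ccontr)
    assume "x \<noteq> 0"
    let ?y = "(e / norm x) *\<^sub>R x"
    have "\<phi> P + ?y \<in> cball (\<phi> P) e" using \<open>x \<noteq> 0\<close> e(1) by (simp add:
        dist_norm)
    then obtain Q where Q: "Q \<in> U" "\<phi> Q = \<phi> P + ?y" using e(2) by (metis (no_types,
        lifting) imageE subsetD)
    have "\<psi> (f Q) = \<psi> (f P)" using Q 1(3,5) x by (simp add: matrix_vector_right_distrib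
        matrix_vector_mult_scaleR)
    then have "f Q = f P" using chart_inj_on[OF 1(2)] Q(1) 1(3,4) by (meson image_subset_iff inj_onD)
    then have "Q = P" using assms(2) Q(1) 1(3) openin_subset[OF chart_openin[OF 1(1)]] by (meson
        inj_onD subsetD)
    then show False using Q(2) e(1) \<open>x \<noteq> 0\<close> by simp
  qed
  then show ?thesis using invertible_left_inverse matrix_left_invertible_ker by blast
qed

definition affine_aut :: "(surface_point \<Rightarrow> surface_point) \<Rightarrow> real^2^2
    \<Rightarrow> bool" where
  "affine_aut f A \<longleftrightarrow> f \<in> Aff_L8 \<and> affine_derivative f A"

lemma SL_L8_orbit_eq: "SL_L8_orbit P = {f P | f A. affine_aut f A}"
  by (auto simp: SL_L8_orbit_def SL_L8_def affine_aut_def)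

lemma affine_autI:
  assumes "homeomorphic_map L8 L8 f" "f (L8_proj 0) = L8_proj 0" "det A > 0"
    "\<And>P. P \<in> topspace L8 - L8_singularities \<Longrightarrow> affine_near f A P"
  shows "affine_aut f A"
  using assms by (auto simp: affine_aut_def Aff_L8_def affine_derivative_def L8_singularities_eq)

context
  fixes f A assumes f: "affine_aut f A"
begin

lemma affine_aut_homeomorphic: "homeomorphic_map L8 L8 f"
  using f by (simp add: affine_aut_def Aff_L8_def)

lemma affine_aut_continuous: "continuous_map L8 L8 f"
  by (rule homeomorphic_imp_continuous_map[OF affine_aut_homeomorphic])

lemma affine_aut_inj: "inj_on f (topspace L8)"
  by (rule homeomorphic_imp_injective_map[OF affine_aut_homeomorphic])

lemma affine_aut_topspace: "P \<in> topspace L8 \<Longrightarrow> f P \<in> topspace L8"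
  using homeomorphic_imp_surjective_map[OF affine_aut_homeomorphic] by blast

lemma affine_aut_singular: "f (L8_proj 0) = L8_proj 0"
  using f by (simp add: affine_aut_def Aff_L8_def L8_singularities_eq)

lemma affine_aut_singular_iff: "P \<in> topspace L8 \<Longrightarrow> f P \<in> L8_singularities
    \<longleftrightarrow> P \<in> L8_singularities"
  unfolding L8_singularities_eq using affine_aut_inj affine_aut_singular
  by (metis inj_on_eq_iff proj_topspace singleton_iff zero_polygon)

lemma affine_aut_near: "P \<in> topspace L8 - L8_singularities \<Longrightarrow> affine_near f A P"
  using f by (simp add: affine_aut_def affine_derivative_def)

end

lemma nonsingular_exists: "\<exists>P. P \<in> topspace L8 - L8_singularities"
proof
  let ?p = "(1/2) *\<^sub>R dir 1 + (1/2) *\<^sub>R dir 2 :: real^2"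
  have "?p $ 1 = 1/2" "?p $ oth 1 = 1/2" by (simp_all add: dir_def axis_def oth_def)
  then have "?p \<in> L8_polygon" "?p \<notin> vertices"
    using len_bounds[of 1] len_bounds[of "oth 1"] by (auto simp: mem_L8_polygon[where k=1]
        mem_vertices[where k=1])
  then show "L8_proj ?p \<in> topspace L8 - L8_singularities" by (simp add: proj_singular_iff)
qed

lemma affine_aut_invertible: "affine_aut f A \<Longrightarrow> invertible A"
  using nonsingular_exists affine_near_imp_invertible affine_aut_near affine_aut_inj by blast

lemma affine_aut_compose:
  assumes f: "affine_aut f A" and g: "affine_aut g B" shows "affine_aut (g \<circ> f) (B ** A)"
proof -
  have N: "P \<in> topspace L8 - L8_singularities \<Longrightarrow> f P \<in> topspace L8 -
      L8_singularities" for P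
    using affine_aut_singular_iff[OF f] affine_aut_topspace[OF f] by auto
  have hom: "homeomorphic_map L8 L8 (g \<circ> f)"
    using affine_aut_homeomorphic[OF f] affine_aut_homeomorphic[OF g] by (rule homeomorphic_map_compose)
  have "\<exists>C. det C > 0 \<and> affine_near (g \<circ> f) C P" if P: "P \<in> topspace L8 -
      L8_singularities" for P
  proof -
    obtain A' where "det A' > 0" "affine_near f A' P" using f P unfolding affine_aut_def Aff_L8_def by blast
    moreover obtain B' where "det B' > 0" "affine_near g B' (f P)" using g N[OF P] unfolding
        affine_aut_def Aff_L8_def by blast
    ultimately show ?thesis using affine_near_compose[OF _ affine_aut_continuous[OF f]]
      by (intro exI[of _ "B' ** A'"]) (auto simp: det_mul)
  qed
  moreover have "affine_near (g \<circ> f) (B ** A) P" if "P \<in> topspace L8 - L8_singularities" for P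
    using affine_near_compose[OF affine_aut_near[OF f that] affine_aut_continuous[OF f]
        affine_aut_near[OF g N[OF that]]] .
  ultimately show ?thesis
    unfolding affine_aut_def Aff_L8_def affine_derivative_def
    using hom affine_aut_singular[OF f] affine_aut_singular[OF g] by (auto simp: L8_singularities_eq)
qed

lemma affine_aut_inverse:
  assumes f: "affine_aut f A"
  obtains g where "affine_aut g (matrix_inv A)"
    "\<forall>P \<in> topspace L8. g (f P) = P" "\<forall>P \<in> topspace L8. f (g P) = P"
proof -
  obtain g where g: "homeomorphic_maps L8 L8 f g"
    using affine_aut_homeomorphic[OF f] homeomorphic_map_maps by blast
  then have gf: "g (f P) = P" "f (g P) = P" "g P \<in> topspace L8" if "P \<in> topspace L8" for P
    using that by (auto simp: homeomorphic_maps_def continuous_map_def)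
  have hg: "homeomorphic_map L8 L8 g" using g homeomorphic_maps_map by blast
  have sing: "g (L8_proj 0) = L8_proj 0"
    using gf(1)[of "L8_proj 0"] affine_aut_singular[OF f] by simp
  have N: "g P \<in> topspace L8 - L8_singularities" if "P \<in> topspace L8 - L8_singularities" for P
    using that gf affine_aut_singular_iff[OF f, of "g P"] by auto
  have "\<exists>C. det C > 0 \<and> affine_near g C P" if P: "P \<in> topspace L8 - L8_singularities" for P
  proof -
    obtain A' where A': "det A' > 0" "affine_near f A' (g P)"
      using f N[OF P] unfolding affine_aut_def Aff_L8_def by blast
    then have inv: "invertible A'" by (simp add: invertible_det_nz)
    have "det (matrix_inv A') * det A' = 1" using matrix_inv_mult(1)[OF inv] by (metis det_I det_mul)
    then have "det (matrix_inv A') > 0" using A'(1) by (metis zero_less_mult_pos2 zero_less_one)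
    then show ?thesis using affine_near_inverse[OF A'(2) g inv] gf P by auto
  qed
  moreover have "affine_near g (matrix_inv A) P" if P: "P \<in> topspace L8 - L8_singularities" for P
    using affine_near_inverse[OF affine_aut_near[OF f N[OF P]] g affine_aut_invertible[OF f]] gf P by auto
  ultimately have "affine_aut g (matrix_inv A)"
    unfolding affine_aut_def Aff_L8_def affine_derivative_def using hg sing by (auto simp:
        L8_singularities_eq)
  then show ?thesis using that gf by blast
qed

lemma affine_aut_id: "affine_aut id (mat 1)"
proof (rule affine_autI)
  fix P assume "P \<in> topspace L8 - L8_singularities"
  then obtain p where p: "p \<in> L8_polygon" "p \<notin> vertices" "P = L8_proj p"
    by (metis DiffE proj_singular_iff topspace_L8_cases)
  then obtain k j where kj: "p \<in> ostrip k j" "cyl k j p = P" using nonsingular_ostrip by metis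
  show "affine_near id (mat 1) P"
    unfolding kj(2)[symmetric]
    by (rule affine_near_cyl[where b = 0 and e = 1 and k' = k and j' = j]) (use kj in simp_all)
qed (auto simp: homeomorphic_map_id)

lemma orbit_refl: "P \<in> SL_L8_orbit P"
  unfolding SL_L8_orbit_eq using affine_aut_id by (metis (mono_tags, lifting) id_apply mem_Collect_eq)

lemma orbitI: "affine_aut f A \<Longrightarrow> f P \<in> SL_L8_orbit P"
  unfolding SL_L8_orbit_eq by blast

lemma orbitE:
  assumes "Q \<in> SL_L8_orbit P" obtains f A where "affine_aut f A" "Q = f P"
  using assms unfolding SL_L8_orbit_eq by blast

lemma orbit_trans:
  assumes "Q \<in> SL_L8_orbit P" "R \<in> SL_L8_orbit Q" shows "R \<in> SL_L8_orbit P"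
proof -
  obtain f A where f: "affine_aut f A" "Q = f P" using orbitE[OF assms(1)] .
  obtain g B where g: "affine_aut g B" "R = g Q" using orbitE[OF assms(2)] .
  show ?thesis using orbitI[OF affine_aut_compose[OF f(1) g(1)], of P] f(2) g(2) by simp
qed

lemma orbit_sym:
  assumes "P \<in> topspace L8" "Q \<in> SL_L8_orbit P" shows "P \<in> SL_L8_orbit Q"
proof -
  obtain f A where f: "affine_aut f A" "Q = f P" using orbitE[OF assms(2)] .
  obtain g where "affine_aut g (matrix_inv A)" "\<forall>P \<in> topspace L8. g (f P) = P"
    using affine_aut_inverse[OF f(1)] .
  then show ?thesis using orbitI[of g _ Q] f(2) assms(1) by metis
qed

lemma orbit_eq: "P \<in> topspace L8 \<Longrightarrow> Q \<in> SL_L8_orbit P \<Longrightarrow>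
    SL_L8_orbit Q = SL_L8_orbit P"
  using orbit_trans orbit_sym by blast

section \<open>Transport of separatrices and connection points\<close>

lemma straight_path_affine:
  assumes f: "affine_aut f A" and g: "straight_path I v g"
  shows "straight_path I (A *v v) (f \<circ> g)"
  unfolding straight_path_def
proof (intro conjI ballI impI)
  have cg: "continuous_map (top_of_set I) L8 g" using g by (simp add: straight_path_def)
  show "continuous_map (top_of_set I) L8 (f \<circ> g)"
    using cg affine_aut_continuous[OF f] by (rule continuous_map_compose)
  fix t assume t: "t \<in> I" "(f \<circ> g) t \<notin> L8_singularities"
  have gt: "g t \<in> topspace L8" using cg t(1) by (auto simp: continuous_map_def)
  then have ns: "g t \<in> topspace L8 - L8_singularities"
    using t(2) affine_aut_singular_iff[OF f] by auto
  obtain U \<phi> b e where 1: "e > 0" "translation_chart U \<phi>"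
    "\<And>s. s \<in> I \<Longrightarrow> \<bar>s - t\<bar> < e \<Longrightarrow> g s \<in> U \<and>
        \<phi> (g s) = s *\<^sub>R v + b"
    using g t(1) ns unfolding straight_path_def by blast
  obtain U' \<phi>' V \<psi> b' where 2: "translation_chart U' \<phi>'" "translation_chart V \<psi>" "g
      t \<in> U'" "f ` U' \<subseteq> V"
    "\<forall>Q\<in>U'. \<psi> (f Q) = A *v \<phi>' Q + b'" using affine_nearE[OF affine_aut_near[OF f
        ns]] .
  have "g t \<in> U" using 1(1,3) t(1) by simp
  obtain W where W: "openin L8 W" "g t \<in> W" "W \<subseteq> U" "W \<subseteq> U'"
      "\<forall>Q\<in>W. \<phi>' Q = \<phi> Q + (\<phi>' (g t) - \<phi> (g t))"
    using chart_transition[OF 1(2) 2(1) \<open>g t \<in> U\<close> 2(3)] .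
  have "openin (top_of_set I) {s \<in> I. g s \<in> W}"
    using openin_continuous_map_preimage[OF cg W(1)] by simp
  then obtain d where d: "d > 0" "\<And>s. s \<in> I \<Longrightarrow> dist s t < d \<Longrightarrow> g
      s \<in> W"
    using t(1) W(2) unfolding openin_euclidean_subtopology_iff by blast
  have "(f \<circ> g) s \<in> V \<and> \<psi> ((f \<circ> g) s) = s *\<^sub>R (A *v v) + (A *v (b +
      (\<phi>' (g t) - \<phi> (g t))) + b')"
    if s: "s \<in> I" "\<bar>s - t\<bar> < min d e" for s
  proof -
    have "g s \<in> W" "\<phi> (g s) = s *\<^sub>R v + b" using d s 1 by (auto simp: dist_real_def)
    then have "\<psi> (f (g s)) = A *v (s *\<^sub>R v + b + (\<phi>' (g t) - \<phi> (g t))) + b'"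
      using W(4,5) 2(5) by auto
    then show ?thesis using \<open>g s \<in> W\<close> W(4) 2(4)
      by (auto simp: matrix_vector_right_distrib matrix_vector_mult_scaleR add.assoc)
  qed
  moreover have "min d e > 0" using d(1) 1(1) by simp
  ultimately show "\<exists>U \<phi> b. \<exists>e>0. translation_chart U \<phi> \<and>
      (\<forall>s\<in>I. \<bar>s - t\<bar> < e \<longrightarrow> (f \<circ> g) s \<in> U \<and> \<phi>
          ((f \<circ> g) s) = s *\<^sub>R (A *v v) + b)"
    using 2(2) by blast
qed

lemma separatrix_affine:
  assumes f: "affine_aut f A" and g: "separatrix I v g"
  shows "separatrix I (A *v v) (f \<circ> g)"
proof -
  have g': "straight_path I v g" "v \<noteq> 0" "0 \<in> I" "g 0 \<in> L8_singularities" "\<forall>t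
      \<in> interior I. g t \<notin> L8_singularities"
    using g by (auto simp: separatrix_def)
  have gt: "g t \<in> topspace L8" if "t \<in> I" for t
    using g'(1) that by (auto simp: straight_path_def continuous_map_def)
  have "A *v v \<noteq> 0"
    using affine_aut_invertible[OF f] g'(2) by (metis matrix_inv_mult(1) matrix_vector_mul_assoc
        matrix_vector_mul_lid matrix_vector_mult_0_right)
  then show ?thesis
    using g straight_path_affine[OF f g'(1)] g' gt affine_aut_singular_iff[OF f] interior_subset[of I]
    by (auto simp: separatrix_def)
qed

text \<open>A separatrix through \<open>f P\<close> is pulled back by the inverse automorphism,
  extended to a saddle connection there, and pushed forward again.\<close>

lemma connection_point_affine:
  assumes f: "affine_aut f A" and P: "connection_point P"
  shows "connection_point (f P)"
proof -
  have PT: "P \<in> topspace L8 - L8_singularities" using P by (simp add: connection_point_def)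
  have "f P \<in> topspace L8 - L8_singularities"
    using PT affine_aut_singular_iff[OF f] affine_aut_topspace[OF f] by auto
  moreover have "\<exists>T h. saddle_connection T v h \<and> I \<subseteq> {0..T} \<and>
      (\<forall>t\<in>I. h t = g t)"
    if g: "separatrix I v g" "f P \<in> g ` I" for I v g
  proof -
    obtain f' where f': "affine_aut f' (matrix_inv A)" "\<forall>P \<in> topspace L8. f' (f P) = P"
      "\<forall>P \<in> topspace L8. f (f' P) = P" using affine_aut_inverse[OF f] .
    have gt: "g t \<in> topspace L8" if "t \<in> I" for t
      using g(1) that by (auto simp: separatrix_def straight_path_def continuous_map_def)
    have "separatrix I (matrix_inv A *v v) (f' \<circ> g)" by (rule separatrix_affine[OF f'(1) g(1)])
    moreover have "P \<in> (f' \<circ> g) ` I" using g(2) f'(2) PT by force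
    ultimately obtain T h where h: "saddle_connection T (matrix_inv A *v v) h" "I \<subseteq> {0..T}"
        "\<forall>t\<in>I. h t = (f' \<circ> g) t"
      using P unfolding connection_point_def by blast
    have "A *v (matrix_inv A *v v) = v"
      using affine_aut_invertible[OF f] by (simp add: matrix_vector_mul_assoc matrix_inv_mult(2))
    then have "saddle_connection T v (f \<circ> h)"
      using h(1) separatrix_affine[OF f] affine_aut_singular[OF f] unfolding saddle_connection_def
      by (metis L8_singularities_eq comp_apply singleton_iff)
    then show ?thesis using h(2,3) f'(3) gt by (intro exI[of _ T] exI[of _ "f \<circ> h"]) auto
  qed
  ultimately show ?thesis unfolding connection_point_def by blast
qed

section \<open>Holonomy\<close>

definition Zw :: "real set" where "Zw = {of_int a + of_int b * sqrt 2 | a b. True}"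
definition lattice :: "(real^2) set" where "lattice = {p. \<forall>i. p $ i \<in> Zw}"

lemma ZwI: "of_int a + of_int b * sqrt 2 \<in> Zw"
  by (auto simp: Zw_def)

lemma Zw_add: "x \<in> Zw \<Longrightarrow> y \<in> Zw \<Longrightarrow> x + y \<in> Zw"
proof -
  assume "x \<in> Zw" "y \<in> Zw"
  then obtain a b c d where "x = of_int a + of_int b * sqrt 2" "y = of_int c + of_int d * sqrt 2" by
      (auto simp: Zw_def)
  then have "x + y = of_int (a + c) + of_int (b + d) * sqrt 2" by (simp add: algebra_simps)
  then show ?thesis using ZwI by metis
qed

lemma Zw_mult_int: "x \<in> Zw \<Longrightarrow> of_int n * x \<in> Zw"
proof -
  assume "x \<in> Zw"
  then obtain a b where "x = of_int a + of_int b * sqrt 2" by (auto simp: Zw_def)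
  then have "of_int n * x = of_int (n * a) + of_int (n * b) * sqrt 2" by (simp add: algebra_simps)
  then show ?thesis using ZwI by metis
qed

lemma Zw_simps [simp]: "0 \<in> Zw" "1 \<in> Zw" "len k \<in> Zw" "sqrt 2 \<in> Zw"
  using ZwI[of 0 0] ZwI[of 1 0] ZwI[of 1 1] ZwI[of 0 1] by (auto simp: len_def)

lemma lattice_add: "x \<in> lattice \<Longrightarrow> y \<in> lattice \<Longrightarrow> x + y \<in> lattice"
  by (simp add: lattice_def Zw_add)

lemma lattice_scale_int: "x \<in> lattice \<Longrightarrow> of_int n *\<^sub>R x \<in> lattice"
  by (simp add: lattice_def Zw_mult_int)

lemma lattice_scale_nat: "x \<in> lattice \<Longrightarrow> of_nat n *\<^sub>R x \<in> lattice"
  using lattice_scale_int[of x "int n"] by simp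

lemma lattice_minus: "x \<in> lattice \<Longrightarrow> - x \<in> lattice"
  using lattice_scale_int[of x "-1"] by simp

lemma lattice_diff: "x \<in> lattice \<Longrightarrow> y \<in> lattice \<Longrightarrow> x - y \<in>
    lattice"
  using lattice_add[OF _ lattice_minus, of x y] by simp

lemma lattice_dir: "c \<in> Zw \<Longrightarrow> c *\<^sub>R dir k \<in> lattice"
  by (auto simp: lattice_def dir_def axis_def)

lemma lattice_zero [simp]: "0 \<in> lattice"
  by (simp add: lattice_def)

lemma vertices_lattice: "p \<in> vertices \<Longrightarrow> p \<in> lattice"
proof -
  assume "p \<in> vertices"
  then have "p $ i = 0 \<or> p $ i = 1 \<or> p $ i = len i" for i by (auto simp: vertices_def)
  then show "p \<in> lattice" unfolding lattice_def mem_Collect_eq using Zw_simps by metis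
qed

lemma glue_lattice: "glue k p q \<Longrightarrow> q - p \<in> lattice"
  using lattice_dir[of "len k" k] lattice_dir[of 1 k] by (auto simp: glue_def)

text \<open>Gluing translations lie in the lattice, and so do the vertices. Polygon coordinates are
  therefore well defined on the surface modulo the lattice.\<close>

lemma proj_eq_lattice:
  assumes "p \<in> L8_polygon" "q \<in> L8_polygon" "L8_proj p = L8_proj q"
  shows "q - p \<in> lattice"
  using assms proj_eq_cases[OF assms(1,2)] glue_lattice lattice_minus[of "p - q"] lattice_diff
      vertices_lattice
  by (auto dest!: glue_lattice)

text \<open>Each coordinate of a vertex is one of 0, 1 and \<open>len i\<close>, and these are more
  than 2/5 apart.\<close>

lemma vertex_unique:
  assumes "v \<in> vertices" "v' \<in> vertices" "dist v v' < 1/4" shows "v = v'"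
proof -
  have "v $ i = v' $ i" for i
  proof -
    have "\<bar>v $ i - v' $ i\<bar> < 1/4"
      using component_le_norm_cart[of "v - v'" i] assms(3) by (simp add: dist_norm)
    moreover have "v $ i = 0 \<or> v $ i = 1 \<or> v $ i = len i" "v' $ i = 0 \<or> v' $ i = 1 \<or> v'
        $ i = len i"
      using assms(1,2) by (auto simp: vertices_def)
    ultimately show ?thesis using len_bounds[of i] by auto
  qed
  then show ?thesis by (simp add: vec_eq_iff)
qed

text \<open>The glued sides end in vertices, so the translation that glues \<open>p\<close> to
  \<open>q\<close> also carries the nearby vertex \<open>v\<close> to a vertex. The radius 1/8
  ensures that the position of \<open>p\<close> determines the coordinates of
  \<open>v\<close>.\<close>

lemma vertex_offset:
  assumes "p \<in> L8_polygon" "q \<in> L8_polygon" "L8_proj p = L8_proj q" "v \<in> vertices" "dist p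
      v < 1/8"
  obtains v' where "v' \<in> vertices" "q - v' = p - v"
proof -
  have near: "\<bar>p $ i - v $ i\<bar> < 1/8" for i
    using component_le_norm_cart[of "p - v" i] assms(5) by (simp add: dist_norm)
  have v: "v $ i = 0 \<or> v $ i = 1 \<or> v $ i = len i" for i using assms(4) by (auto simp: vertices_def)
  note b = len_bounds
  have coord: "v $ i = 0 \<and> \<bar>p $ i\<bar> < 1/8 \<or> v $ i = 1 \<and> \<bar>p $ i - 1\<bar> <
      1/8 \<or> v $ i = len i \<and> \<bar>p $ i - len i\<bar> < 1/8" for i
    using v[of i] near[of i] by auto
  have vv: "x \<in> vertices" if "x $ k \<in> {0,1,len k}" "x $ oth k \<in> {0,1,len (oth k)}" "x $ k
      \<le> 1 \<or> x $ oth k \<le> 1" for x k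
    using that by (auto simp: mem_vertices[where k=k] mem_L8_polygon[where k=k])
  consider "p = q" | k where "glue k p q" | k where "glue k q p" | "p \<in> vertices" "q \<in> vertices"
    using proj_eq_cases[OF assms(1,2)] assms(3) by blast
  then show ?thesis
  proof cases
    case 1
    then show ?thesis using that assms(4) by simp
  next
    case (2 k)
    have vk: "v $ k = 0" using 2 coord[of k] b[of k] by (auto simp: glue_def)
    show ?thesis
    proof (cases "p $ oth k \<le> 1 \<and> q = p + len k *\<^sub>R dir k")
      case True
      then have "v $ oth k \<in> {0, 1}" using coord[of "oth k"] b[of "oth k"] by auto
      then have "v + len k *\<^sub>R dir k \<in> vertices" using vk by (intro vv[where k=k]) auto
      then show ?thesis using that True by force
    next
      case False
      then have p: "1 \<le> p $ oth k" "q = p + dir k" using 2 by (auto simp: glue_def)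
      then have "v $ oth k \<in> {1, len (oth k)}" using coord[of "oth k"] by auto
      then have "v + dir k \<in> vertices" using vk by (intro vv[where k=k]) auto
      then show ?thesis using that p by force
    qed
  next
    case (3 k)
    show ?thesis
    proof (cases "q $ oth k \<le> 1 \<and> p = q + len k *\<^sub>R dir k")
      case True
      then have "p $ k = len k" "p $ oth k \<le> 1" using 3 by (auto simp: glue_def)
      then have "v $ oth k \<in> {0, 1}" "v $ k = len k" using coord[of "oth k"] coord[of k] b[of "oth
          k"] b[of k] by auto
      then have "v - len k *\<^sub>R dir k \<in> vertices" by (intro vv[where k=k]) auto
      then show ?thesis using that True by force
    next
      case False
      then have p: "1 \<le> p $ oth k" "p = q + dir k" "p $ k = 1" using 3 by (auto simp: glue_def)
      then have "v $ oth k \<in> {1, len (oth k)}" "v $ k = 1" using coord[of "oth k"] coord[of k] b[of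
          k] by auto
      then have "v - dir k \<in> vertices" by (intro vv[where k=k]) auto
      then show ?thesis using that p by force
    qed
  next
    case 4
    then have "p = v" using vertex_unique[of p v] assms(4,5) by simp
    then show ?thesis using that[of q] 4 by simp
  qed
qed

section \<open>Straight paths in polygon coordinates\<close>

lemma path_near:
  fixes g :: "real \<Rightarrow> surface_point"
  assumes "continuous_map (top_of_set I) L8 g" "openin L8 W" "t \<in> I" "g t \<in> W"
  obtains e where "e > 0" "\<forall>s\<in>I. \<bar>s - t\<bar> < e \<longrightarrow> g s \<in> W"
proof -
  have "openin (top_of_set I) {s \<in> I. g s \<in> W}"
    using openin_continuous_map_preimage[OF assms(1,2)] by simp
  then obtain e where "e > 0" "\<forall>s\<in>I. dist s t < e \<longrightarrow> g s \<in> W"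
    using assms(3,4) unfolding openin_euclidean_subtopology_iff by blast
  then show ?thesis using that by (simp add: dist_real_def)
qed

text \<open>The chart in the definition of a straight path is replaced by displacements between
  polygon points: every representative of \<open>g s\<close> is reached from some representative of
  \<open>g t\<close> by the expected vector.\<close>

lemma straight_path_local:
  assumes g: "straight_path I d g" and t: "t \<in> I" "g t \<notin> L8_singularities" and r: "r > 0"
  obtains e where "e > 0" "\<forall>s\<in>I. \<bar>s - t\<bar> < e \<longrightarrow>
      (\<forall>q\<in>L8_polygon. L8_proj q = g s \<longrightarrow>
      (\<exists>p\<in>L8_polygon. L8_proj p = g t \<and> dist p q < r \<and> q - p = (s - t) *\<^sub>R d))"
proof -
  have cg: "continuous_map (top_of_set I) L8 g" using g by (simp add: straight_path_def)
  obtain U \<phi> b e where 1: "e > 0" "translation_chart U \<phi>"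
    "\<forall>s\<in>I. \<bar>s - t\<bar> < e \<longrightarrow> g s \<in> U \<and> \<phi> (g s) = s
        *\<^sub>R d + b"
    using g t unfolding straight_path_def by blast
  then have gU: "g t \<in> U" "\<phi> (g t) = t *\<^sub>R d + b" using t(1) by auto
  obtain W where W: "openin L8 W" "g t \<in> W" "\<And>q. q \<in> L8_polygon \<Longrightarrow> L8_proj
      q \<in> W \<Longrightarrow> \<exists>p \<in> L8_polygon. L8_proj p = g t \<and> dist p q < r \<and>
        \<phi> (L8_proj q) = \<phi> (g t) + (q - p) \<and> \<phi> (L8_proj q) = \<phi> (g t) + (q - p)"
    by (rule charts_near[OF 1(2) 1(2) gU(1) gU(1) r]) blast
  obtain e' where e': "e' > 0" "\<forall>s\<in>I. \<bar>s - t\<bar> < e' \<longrightarrow> g s \<in> W"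
    using path_near[OF cg W(1) t(1) W(2)] .
  show ?thesis
  proof (rule that[of "min e e'"], use 1(1) e'(1) in simp, intro ballI impI)
    fix s q assume s: "s \<in> I" "\<bar>s - t\<bar> < min e e'" and q: "q \<in> L8_polygon" "L8_proj q
        = g s"
    then obtain p where p: "p \<in> L8_polygon" "L8_proj p = g t" "dist p q < r" "\<phi> (L8_proj q) =
        \<phi> (g t) + (q - p)"
      using W(3)[of q] e'(2) by auto
    moreover have "\<phi> (g s) = s *\<^sub>R d + b" using 1(3) s by simp
    ultimately have "q - p = (s - t) *\<^sub>R d" using q gU(2) by (simp add: algebra_simps)
    then show "\<exists>p\<in>L8_polygon. L8_proj p = g t \<and> dist p q < r \<and> q - p = (s - t)
        *\<^sub>R d" using p by blast
  qed
qed

text \<open>There is no chart at the singularity. Continuity only says that representatives come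
  close to some vertex, and which vertex it is may vary.\<close>

lemma near_singular:
  assumes "r > 0"
  obtains W where "openin L8 W" "L8_proj 0 \<in> W"
    "\<forall>q\<in>L8_polygon. L8_proj q \<in> W \<longrightarrow> (\<exists>v\<in>vertices. dist q v < r)"
proof -
  obtain W where W: "openin L8 W" "L8_proj 0 \<in> W" "\<And>q. q \<in> L8_polygon \<Longrightarrow>
      L8_proj q \<in> W \<Longrightarrow> q \<in> (\<Union>v\<in>vertices. ball v r)"
  proof (rule fibre_neighbourhood[of "L8_proj 0" "\<Union>v\<in>vertices. ball v r"])
    show "p \<in> (\<Union>v\<in>vertices. ball v r)" if "p \<in> L8_polygon" "L8_proj p = L8_proj 0" for p
      using that assms proj_vertex_iff by (intro UN_I[of p]) auto
  qed auto
  show ?thesis by (rule that[OF W(1,2)]) (use W(3) in \<open>force simp: dist_commute\<close>)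
qed

text \<open>
  The lattice is dense, so passing to the limit at a singular endpoint has to be done with the
  exact offset from the nearest vertex and not modulo the lattice.
\<close>

lemma straight_path_singular_end:
  assumes g: "straight_path {0..1} d g" and ns: "\<forall>s\<in>{0<..<1}. g s \<notin> L8_singularities"
    and t: "t \<in> {0, 1}" "g t = L8_proj 0"
  obtains e where "e > 0" "\<forall>s\<in>{0<..<1}. \<bar>s - t\<bar> < e \<longrightarrow>
      (\<exists>q\<in>L8_polygon. L8_proj q = g s \<and> q - (s - t) *\<^sub>R d \<in> vertices)"
proof -
  have cg: "continuous_map (top_of_set {0..1}) L8 g" using g by (simp add: straight_path_def)
  have t01: "t \<in> {0..1}" using t by auto
  have near: "\<exists>e>0. \<forall>s\<in>{0..1}. \<bar>s - t\<bar> < e \<longrightarrow>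
      (\<forall>q\<in>L8_polygon. L8_proj q = g s \<longrightarrow> (\<exists>v\<in>vertices. dist q v
      < r))"
    if "r > 0" for r
  proof -
    obtain W where W: "openin L8 W" "L8_proj 0 \<in> W"
      "\<forall>q\<in>L8_polygon. L8_proj q \<in> W \<longrightarrow> (\<exists>v\<in>vertices. dist q
          v < r)" using near_singular[OF \<open>r > 0\<close>] .
    obtain e where "e > 0" "\<forall>s\<in>{0..1}. \<bar>s - t\<bar> < e \<longrightarrow> g s \<in> W"
      using path_near[OF cg W(1) t01] W(2) t(2) by metis
    then show ?thesis using W(3) by metis
  qed
  obtain e where e: "e > 0" "\<forall>s\<in>{0..1}. \<bar>s - t\<bar> < e \<longrightarrow>
      (\<forall>q\<in>L8_polygon. L8_proj q = g s \<longrightarrow> (\<exists>v\<in>vertices. dist q v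
      < 1/16))"
    using near[of "1/16"] by auto
  define J where "J = {0<..<1} \<inter> ball t e"
  have J: "s \<in> J \<longleftrightarrow> s \<in> {0<..<1} \<and> \<bar>s - t\<bar> < e" for s
    by (auto simp: J_def dist_real_def)
  have lift: "\<exists>q v. q \<in> L8_polygon \<and> L8_proj q = g s \<and> v \<in> vertices \<and>
      dist q v < 1/16" if s: "s \<in> J" for s
  proof -
    have s01: "s \<in> {0..1}" using s J by simp
    then have "g s \<in> topspace L8" using cg by (auto simp: continuous_map_def)
    then obtain q where "q \<in> L8_polygon" "g s = L8_proj q" by (rule topspace_L8_cases)
    then show ?thesis using e(2) s01 s J by (metis (no_types, lifting))
  qed
  then obtain Q V where QV: "\<And>s. s \<in> J \<Longrightarrow> Q s \<in> L8_polygon \<and> L8_proj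
      (Q s) = g s \<and> V s \<in> vertices \<and> dist (Q s) (V s) < 1/16"
    by metis
  \<comment> \<open>The defect between the offset from the nearest vertex and the expected
    displacement. It is locally constant on the connected set \<open>J\<close> and arbitrarily small
    near \<open>t\<close>, hence zero.\<close>
  define h where "h s = Q s - V s - (s - t) *\<^sub>R d" for s
  have loc: "\<forall>\<^sub>F s in at u within J. h u = h s" if u: "u \<in> J" for u
  proof -
    have u01: "u \<in> {0..1}" "g u \<notin> L8_singularities" using u J ns by auto
    obtain e' where e': "e' > 0" "\<forall>s\<in>{0..1}. \<bar>s - u\<bar> < e' \<longrightarrow>
        (\<forall>q\<in>L8_polygon. L8_proj q = g s \<longrightarrow>
      (\<exists>p\<in>L8_polygon. L8_proj p = g u \<and> dist p q < 1/16 \<and> q - p = (s - u)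
          *\<^sub>R d))"
      using straight_path_local[OF g u01, of "1/16"] by auto
    have "h u = h s" if s: "s \<in> J" "\<bar>s - u\<bar> < e'" for s
    proof -
      have s01: "s \<in> {0..1}" using s J by auto
      then obtain p where p: "p \<in> L8_polygon" "L8_proj p = g u" "dist p (Q s) < 1/16" "Q s - p = (s
          - u) *\<^sub>R d"
        using e'(2) s QV[OF s(1)] by blast
      obtain v' where v': "v' \<in> vertices" "p - v' = Q u - V u"
        by (rule vertex_offset[of "Q u" p "V u"]) (use QV[OF u] p in auto)
      have "dist v' p < 1/16" using v'(2) QV[OF u] by (metis dist_commute dist_norm)
      \<comment> \<open>Three distances below 1/16 stay below the separation bound of
        \<open>vertex_unique\<close>.\<close>
      then have "dist v' (V s) < 1/4"
        using p(3) QV[OF s(1)] dist_triangle[of v' "V s" p] dist_triangle[of p "V s" "Q s"] by auto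
      then have "v' = V s" using vertex_unique v'(1) QV[OF s(1)] by blast
      then have 1: "Q u - V u = p - V s" using v'(2) by simp
      have 2: "Q s = p + (s - u) *\<^sub>R d" using p(4) by (simp add: algebra_simps)
      show ?thesis unfolding h_def 1 2 by (simp add: algebra_simps)
    qed
    then show ?thesis unfolding eventually_at using e'(1) by (auto simp: dist_real_def)
  qed
  have "connected J" unfolding J_def by (intro convex_connected convex_Int convex_ball) (simp add:
      convex_real_interval)
  then have const: "h u = h s" if "u \<in> J" "s \<in> J" for u s
    using connected_local_const[of J u s h] that loc by blast
  have h0: "h s = 0" if s: "s \<in> J" for s
  proof (rule ccontr)
    assume "h s \<noteq> 0"
    \<comment> \<open>At a parameter \<open>u\<close> at distance \<open>c\<close> from
      \<open>t\<close>, both the offset from the vertex and the displacement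
      \<open>c * norm d\<close> will be below \<open>r\<close>, which gives
      \<open>norm (h u) < 2 * r \<le> norm (h s)\<close>.\<close>
    define r where "r = min (norm (h s) / 2) (1/16)"
    have r: "r > 0" "r \<le> norm (h s) / 2" "r \<le> 1/16" using \<open>h s \<noteq> 0\<close> by
        (auto simp: r_def)
    obtain e2 where e2: "e2 > 0" "\<forall>s\<in>{0..1}. \<bar>s - t\<bar> < e2 \<longrightarrow>
        (\<forall>q\<in>L8_polygon. L8_proj q = g s \<longrightarrow> (\<exists>v\<in>vertices. dist q
        v < r))"
      using near[OF r(1)] by auto
    define c where "c = min (min e e2) (min 1 (r / (norm d + 1))) / 2"
    have c: "c > 0" "c < e" "c < e2" "c < 1" "c < r / (norm d + 1)"
    proof -
      have "r / (norm d + 1) > 0" using r(1) by (intro divide_pos_pos add_nonneg_pos) auto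
      then have m: "min (min e e2) (min 1 (r / (norm d + 1))) > 0" using e(1) e2(1) by simp
      then have "c < min (min e e2) (min 1 (r / (norm d + 1)))" "c > 0"
        unfolding c_def using half_gt_zero[OF m] m by linarith+
      then show "c > 0" "c < e" "c < e2" "c < 1" "c < r / (norm d + 1)" by simp_all
    qed
    have cd: "c * norm d < r"
    proof -
      have "c * (norm d + 1) < r" using c(5) by (simp add: pos_less_divide_eq add_nonneg_pos)
      then show ?thesis using c(1) by (simp add: algebra_simps)
    qed
    define u where "u = (if t = 0 then c else 1 - c)"
    have ut: "u \<in> {0<..<1}" "\<bar>u - t\<bar> = c" using c(1,4) t(1) by (auto simp: u_def)
    then have u: "u \<in> J" unfolding J using c(2) by simp
    have "u \<in> {0..1}" "\<bar>u - t\<bar> < e2" using ut c(3) by auto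
    then obtain v where v: "v \<in> vertices" "dist (Q u) v < r" using e2(2) QV[OF u] by blast
    have "dist v (V u) < 1/4" using v(2) r(3) QV[OF u] dist_triangle2[of v "V u" "Q u"] by (auto simp:
        dist_commute)
    then have "v = V u" using vertex_unique v(1) QV[OF u] by blast
    then have "norm (Q u - V u) < r" using v(2) by (simp add: dist_norm)
    moreover have "norm (h u) \<le> norm (Q u - V u) + c * norm d"
      unfolding h_def using norm_triangle_ineq4[of "Q u - V u" "(u - t) *\<^sub>R d"] ut(2) by simp
    ultimately have "norm (h u) < 2 * r" using cd by linarith
    then show False using const[OF u s] r(2) by simp
  qed
  show ?thesis
  proof (rule that[OF e(1)], intro ballI impI)
    fix s :: real assume s: "s \<in> {0<..<1}" "\<bar>s - t\<bar> < e"
    then have "s \<in> J" using J by blast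
    then have "Q s - (s - t) *\<^sub>R d = V s" using h0 by (simp add: h_def algebra_simps)
    then show "\<exists>q\<in>L8_polygon. L8_proj q = g s \<and> q - (s - t) *\<^sub>R d \<in>
        vertices" using QV[OF \<open>s \<in> J\<close>] by metis
  qed
qed

text \<open>That the displacement from \<open>p\<close> is the expected one modulo the lattice is a
  locally constant property along the path, so it passes from the start to the end by connectedness.
  A singularity can occur only at the two ends, where the exact offsets from vertices are
  used.\<close>

lemma straight_path_holonomy:
  assumes g: "straight_path {0..1} d g" and ns: "\<forall>s\<in>{0<..<1}. g s \<notin> L8_singularities"
    and p: "p \<in> L8_polygon" "L8_proj p = g 0" and q: "q \<in> L8_polygon" "L8_proj q = g 1"
  shows "q - p - d \<in> lattice"
proof -
  have cg: "continuous_map (top_of_set {0..1}) L8 g" using g by (simp add: straight_path_def)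
  have lift: "\<exists>q\<in>L8_polygon. L8_proj q = g s" if "s \<in> {0..1}" for s
  proof -
    have "g s \<in> topspace L8" using cg that by (auto simp: continuous_map_def)
    then show ?thesis using topspace_L8_cases by metis
  qed
  have loc: "\<exists>e>0. \<forall>s\<in>{0..1}. \<bar>s - t\<bar> < e \<longrightarrow>
      (\<forall>a\<in>L8_polygon. \<forall>b\<in>L8_polygon. L8_proj a = g t \<longrightarrow> L8_proj
      b = g s \<longrightarrow>
      b - a - (s - t) *\<^sub>R d \<in> lattice)" if t: "t \<in> {0..1}" for t
  proof (cases "g t \<in> L8_singularities")
    case False
    obtain e where e: "e > 0" "\<forall>s\<in>{0..1}. \<bar>s - t\<bar> < e \<longrightarrow>
        (\<forall>q\<in>L8_polygon. L8_proj q = g s \<longrightarrow>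
      (\<exists>p\<in>L8_polygon. L8_proj p = g t \<and> dist p q < 1 \<and> q - p = (s - t) *\<^sub>R d))"
      using straight_path_local[OF g t False, of 1] by auto
    have "b - a - (s - t) *\<^sub>R d \<in> lattice" if s: "s \<in> {0..1}" "\<bar>s - t\<bar> < e" and
        ab: "a \<in> L8_polygon" "b \<in> L8_polygon" "L8_proj a = g t" "L8_proj b = g s" for s a b
    proof -
      obtain c where c: "c \<in> L8_polygon" "L8_proj c = g t" "b - c = (s - t) *\<^sub>R d" using e(2)
          s ab by blast
      have "c - a \<in> lattice" using proj_eq_lattice[of a c] ab c by simp
      moreover have E: "b - a - (s - t) *\<^sub>R d = c - a" using c(3) by (simp add: algebra_simps)
      ultimately show ?thesis unfolding E by blast
    qed
    then show ?thesis using e(1) by blast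
  next
    case True
    then have t': "t \<in> {0, 1}" "g t = L8_proj 0" using ns t by (auto simp: L8_singularities_eq)
    obtain e where e: "e > 0" "\<forall>s\<in>{0<..<1}. \<bar>s - t\<bar> < e \<longrightarrow>
        (\<exists>q\<in>L8_polygon. L8_proj q = g s \<and> q - (s - t) *\<^sub>R d \<in> vertices)"
      using straight_path_singular_end[OF g ns t'] .
    have "b - a - (s - t) *\<^sub>R d \<in> lattice" if s: "s \<in> {0..1}" "\<bar>s - t\<bar> < min e
        1" and ab: "a \<in> L8_polygon" "b \<in> L8_polygon" "L8_proj a = g t" "L8_proj b = g s" for s a b
    proof (cases "s = t")
      case True
      then show ?thesis using proj_eq_lattice[of a b] ab by simp
    next
      case False
      then have "s \<in> {0<..<1}" using s t' by auto
      then obtain c where c: "c \<in> L8_polygon" "L8_proj c = g s" "c - (s - t) *\<^sub>R d \<in>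
          vertices" using e(2) s by auto
      have "b - c \<in> lattice" using proj_eq_lattice[of c b] ab c by simp
      moreover have "a \<in> lattice" using ab(1,3) t'(2) proj_vertex_iff vertices_lattice by metis
      ultimately have "(b - c) + (c - (s - t) *\<^sub>R d) - a \<in> lattice"
        using c(3) lattice_add lattice_diff vertices_lattice by blast
      then show ?thesis by (simp add: algebra_simps)
    qed
    then show ?thesis using e(1) by (intro exI[of _ "min e 1"]) auto
  qed
  define F where "F s \<longleftrightarrow> (\<forall>b\<in>L8_polygon. L8_proj b = g s
      \<longrightarrow> b - p - s *\<^sub>R d \<in> lattice)" for s
  have "F 0 = F 1"
  proof (rule connected_local_const[of "{0..1}"])
    show "\<forall>t\<in>{0..1}. \<forall>\<^sub>F s in at t within {0..1}. F t = F s"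
    proof
      fix t :: real assume t: "t \<in> {0..1}"
      then obtain e where e: "e > 0" "\<forall>s\<in>{0..1}. \<bar>s - t\<bar> < e \<longrightarrow>
          (\<forall>a\<in>L8_polygon. \<forall>b\<in>L8_polygon. L8_proj a = g t \<longrightarrow>
          L8_proj b = g s \<longrightarrow>
        b - a - (s - t) *\<^sub>R d \<in> lattice)" using loc by blast
      have "F t = F s" if s: "s \<in> {0..1}" "\<bar>s - t\<bar> < e" for s
      proof -
        have L: "b - a - (s - t) *\<^sub>R d \<in> lattice" if "a \<in> L8_polygon" "b \<in>
            L8_polygon" "L8_proj a = g t" "L8_proj b = g s" for a b
          using e(2) s that by blast
        have E: "b - p - s *\<^sub>R d = (a - p - t *\<^sub>R d) + (b - a - (s - t) *\<^sub>R d)" 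
             "a - p - t *\<^sub>R d = (b - p - s *\<^sub>R d) - (b - a - (s - t) *\<^sub>R d)" for a b
          by (simp_all add: algebra_simps)
        obtain a0 b0 where ab: "a0 \<in> L8_polygon" "L8_proj a0 = g t" "b0 \<in> L8_polygon" "L8_proj
            b0 = g s" using lift s t by metis
        show ?thesis
        proof
          assume "F t"
          then have "a0 - p - t *\<^sub>R d \<in> lattice" using ab by (simp add: F_def)
          then show "F s" unfolding F_def using L[of a0] ab E(1)[of _ a0] lattice_add by (metis
              (no_types, lifting))
        next
          assume "F s"
          then have "b0 - p - s *\<^sub>R d \<in> lattice" using ab by (simp add: F_def)
          then show "F t" unfolding F_def using L[of _ b0] ab E(2)[of _ b0] lattice_diff by (metis
              (no_types, lifting))
        qed
      qed
      then show "\<forall>\<^sub>F s in at t within {0..1}. F t = F s"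
        unfolding eventually_at using e(1) by (auto simp: dist_real_def)
    qed
  qed auto
  moreover have "F 0" unfolding F_def using proj_eq_lattice[OF p(1)] p(2) by simp
  ultimately show ?thesis using q by (simp add: F_def)
qed

lemma straight_path_segment:
  assumes "\<And>s. s \<in> {0..1} \<Longrightarrow> p + s *\<^sub>R d \<in> L8_polygon"
  shows "straight_path {0..1} d (\<lambda>s. L8_proj (p + s *\<^sub>R d))"
  unfolding straight_path_def
proof (intro conjI ballI impI)
  have "continuous_map (top_of_set {0..1}) (top_of_set L8_polygon) (\<lambda>s. p + s *\<^sub>R d)"
    using assms by (auto intro!: continuous_intros)
  from continuous_map_compose[OF this continuous_map_proj]
  show cg: "continuous_map (top_of_set {0..1}) L8 (\<lambda>s. L8_proj (p + s *\<^sub>R d))" by (simp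
      add: o_def)
  fix t :: real assume t: "t \<in> {0..1}" "L8_proj (p + t *\<^sub>R d) \<notin> L8_singularities"
  let ?q = "p + t *\<^sub>R d"
  have q: "?q \<in> L8_polygon" "?q \<notin> vertices" using t assms proj_singular_iff by auto
  then obtain k j where kj: "?q \<in> ostrip k j" "cyl k j ?q = L8_proj ?q" using nonsingular_ostrip by
      metis
  obtain r where r: "0 < r" "r \<le> 1" "ball ?q r \<subseteq> ostrip k j" "inj_on (cyl k j) (ball ?q r)"
    "translation_chart (cyl k j ` ball ?q r) (inv_into (ball ?q r) (cyl k j))"
    using cylinder_chart[OF kj(1) zero_less_one] .
  let ?U = "cyl k j ` ball ?q r" and ?\<phi> = "inv_into (ball ?q r) (cyl k j)"
  have "L8_proj ?q \<in> ?U" using r(1) kj(2) by (metis centre_in_ball imageI)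
  then obtain e where e: "e > 0" "\<And>x. x \<in> L8_polygon \<Longrightarrow> dist ?q x < e
      \<Longrightarrow> L8_proj x \<in> ?U \<Longrightarrow> ?\<phi> (L8_proj x) = ?\<phi> (L8_proj ?q)
      + (x - ?q)"
    using chart_local[OF r(5) q(1)] by blast
  obtain e' where e': "e' > 0" "\<forall>s\<in>{0..1}. \<bar>s - t\<bar> < e' \<longrightarrow> L8_proj
      (p + s *\<^sub>R d) \<in> ?U"
    using path_near[OF cg chart_openin[OF r(5)] t(1) \<open>L8_proj ?q \<in> ?U\<close>] .
  let ?e = "min e' (e / (norm d + 1))"
  have "L8_proj (p + s *\<^sub>R d) \<in> ?U \<and> ?\<phi> (L8_proj (p + s *\<^sub>R d)) = s *\<^sub>R
      d + (?\<phi> (L8_proj ?q) - t *\<^sub>R d)"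
    if s: "s \<in> {0..1}" "\<bar>s - t\<bar> < ?e" for s
  proof -
    have U: "L8_proj (p + s *\<^sub>R d) \<in> ?U" using e' s by simp
    have "\<bar>s - t\<bar> * (norm d + 1) < e" using s(2) by (simp add: pos_less_divide_eq add_nonneg_pos)
    then have "\<bar>s - t\<bar> * norm d < e" by (simp add: algebra_simps)
    moreover have "dist ?q (p + s *\<^sub>R d) = \<bar>s - t\<bar> * norm d"
      by (simp add: dist_norm scaleR_diff_left[symmetric] abs_minus_commute)
    ultimately have "?\<phi> (L8_proj (p + s *\<^sub>R d)) = ?\<phi> (L8_proj ?q) + ((p + s *\<^sub>R
        d) - ?q)"
      using e(2)[OF assms[OF s(1)] _ U] by metis
    then show ?thesis using U by (simp add: algebra_simps)
  qed
  moreover have "?e > 0" using e(1) e'(1) by (simp add: add_nonneg_pos)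
  ultimately show "\<exists>U \<phi> b. \<exists>e>0. translation_chart U \<phi> \<and>
      (\<forall>s\<in>{0..1}. \<bar>s - t\<bar> < e \<longrightarrow> L8_proj (p + s *\<^sub>R d) \<in>
          U \<and> \<phi> (L8_proj (p + s *\<^sub>R d)) = s *\<^sub>R d + b)"
    using r(5) by blast
qed

section \<open>The action of derivatives on the lattice\<close>

text \<open>The image of a segment is a straight path in direction \<open>A *v d\<close>. As
  vertices are excluded from the interior of the segment, the image meets the singularity at most at
  its ends.\<close>

lemma affine_aut_segment:
  assumes f: "affine_aut f A"
    and seg: "\<And>s. s \<in> {0..1} \<Longrightarrow> p + s *\<^sub>R d \<in> L8_polygon" "\<And>s. s
        \<in> {0<..<1} \<Longrightarrow> p + s *\<^sub>R d \<notin> vertices"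
    and "x \<in> L8_polygon" "L8_proj x = f (L8_proj p)" "y \<in> L8_polygon" "L8_proj y = f (L8_proj
        (p + d))"
  shows "y - x - A *v d \<in> lattice"
proof (rule straight_path_holonomy[OF straight_path_affine[OF f straight_path_segment[OF seg(1)]]])
  show "\<forall>s\<in>{0<..<1}. (f \<circ> (\<lambda>s. L8_proj (p + s *\<^sub>R d))) s \<notin>
      L8_singularities"
  proof
    fix s :: real assume s: "s \<in> {0<..<1}"
    then have "p + s *\<^sub>R d \<in> L8_polygon" using seg(1) by auto
    then show "(f \<circ> (\<lambda>s. L8_proj (p + s *\<^sub>R d))) s \<notin> L8_singularities"
      using affine_aut_singular_iff[OF f] seg(2)[OF s] by (simp add: proj_singular_iff)
  qed
qed (use assms in auto)

lemma affine_aut_vertex_diff: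
  assumes f: "affine_aut f A"
    and seg: "\<And>s. s \<in> {0..1} \<Longrightarrow> p + s *\<^sub>R d \<in> L8_polygon" "\<And>s. s
        \<in> {0<..<1} \<Longrightarrow> p + s *\<^sub>R d \<notin> vertices"
    and "p \<in> vertices" "p + d \<in> vertices"
  shows "A *v d \<in> lattice"
proof -
  have "f (L8_proj p) = L8_proj 0" "f (L8_proj (p + d)) = L8_proj 0"
    using assms(4,5) affine_aut_singular[OF f] proj_vertex_iff vertices_polygon by metis+
  \<comment> \<open>Both image points are represented by the vertex \<open>0\<close>.\<close>
  then have "0 - 0 - A *v d \<in> lattice"
    by (intro affine_aut_segment[OF f seg]) simp_all
  then show ?thesis using lattice_minus by fastforce
qed

lemma dir_scaled_polygon: "c *\<^sub>R dir k \<in> L8_polygon \<longleftrightarrow> 0 \<le> c \<and> c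
    \<le> len k"
  by (auto simp: mem_L8_polygon[where k=k])

lemma dir_scaled_vertices: "c *\<^sub>R dir k \<in> vertices \<longleftrightarrow> c \<in> {0, 1, len k}"
  by (auto simp: mem_vertices[where k=k] dir_scaled_polygon)

lemma dir_scaled_not_vertex: "1 < c \<Longrightarrow> c < len k \<Longrightarrow> c *\<^sub>R dir k
    \<notin> vertices"
  by (auto simp: dir_scaled_vertices)

text \<open>The side on the axis consists of two saddle connections, of lengths 1 and
  \<open>len k - 1\<close>. The second has length \<open>sqrt 2\<close> for \<open>k = 1\<close>;
  for \<open>k = 2\<close> it has length \<open>sqrt 2 - 1\<close>, and the first has to be
  added.\<close>

lemma affine_aut_dir:
  assumes f: "affine_aut f A"
  shows "A *v dir k \<in> lattice" "A *v (sqrt 2 *\<^sub>R dir k) \<in> lattice"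
proof -
  have len1: "s \<le> len k" if "s \<le> 1" for s using len_pos(3)[of k] that by linarith
  have 1: "A *v dir k \<in> lattice"
  proof (rule affine_aut_vertex_diff[OF f, where p = 0])
    show "0 + dir k \<in> vertices" using dir_scaled_vertices[of 1 k] by simp
    show "0 + s *\<^sub>R dir k \<notin> vertices" if "s \<in> {0<..<1}" for s
      using that len_pos(3)[of k] dir_scaled_vertices[of s k] by auto
  qed (use len1 in \<open>auto simp: dir_scaled_polygon\<close>)
  have 2: "A *v ((len k - 1) *\<^sub>R dir k) \<in> lattice"
  proof (rule affine_aut_vertex_diff[OF f, where p = "dir k"])
    have E: "dir k + s *\<^sub>R ((len k - 1) *\<^sub>R dir k) = (1 + s * (len k - 1)) *\<^sub>R dir k"
        for s
      by (simp add: algebra_simps)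
    show "dir k \<in> vertices" "dir k + (len k - 1) *\<^sub>R dir k \<in> vertices"
      using dir_scaled_vertices[of 1 k] dir_scaled_vertices[of "len k" k] by (simp_all add: algebra_simps)
    show "dir k + s *\<^sub>R ((len k - 1) *\<^sub>R dir k) \<in> L8_polygon" if "s \<in> {0..1}" for s
    proof -
      have "s * (len k - 1) \<le> len k - 1" using that by (intro mult_left_le_one_le) auto
      moreover have "0 \<le> s * (len k - 1)" using that by auto
      ultimately show ?thesis unfolding E dir_scaled_polygon by (intro conjI) linarith+
    qed
    show "dir k + s *\<^sub>R ((len k - 1) *\<^sub>R dir k) \<notin> vertices" if "s \<in> {0<..<1}" for s
    proof -
      have "s * (len k - 1) < len k - 1" using that by simp
      moreover have "0 < s * (len k - 1)" using that by simp
      ultimately show ?thesis unfolding E by (intro dir_scaled_not_vertex) linarith+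
    qed
  qed
  have "sqrt 2 *\<^sub>R dir k = (len k - 1) *\<^sub>R dir k + (if k = 1 then 0 else 1) *\<^sub>R dir k"
    by (simp add: len_def algebra_simps)
  then have "A *v (sqrt 2 *\<^sub>R dir k) = A *v ((len k - 1) *\<^sub>R dir k) + of_int (if k = 1 then
      0 else 1) *\<^sub>R (A *v dir k)"
    by (simp add: matrix_vector_right_distrib)
  then show "A *v (sqrt 2 *\<^sub>R dir k) \<in> lattice" using lattice_add[OF 2 lattice_scale_int[OF
      1]] by metis
  show "A *v dir k \<in> lattice" by (rule 1)
qed

lemma affine_aut_lattice:
  assumes f: "affine_aut f A" and x: "x \<in> lattice"
  shows "A *v x \<in> lattice"
proof -
  obtain a b where ab: "\<And>i. x $ i = of_int (a i) + of_int (b i) * sqrt 2"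
    using x unfolding lattice_def Zw_def mem_Collect_eq by metis
  have "x = (of_int (a 1) *\<^sub>R dir 1 + of_int (b 1) *\<^sub>R (sqrt 2 *\<^sub>R dir 1)) + (of_int
      (a 2) *\<^sub>R dir 2 + of_int (b 2) *\<^sub>R (sqrt 2 *\<^sub>R dir 2))"
    by (simp add: vec_eq_iff forall_2 ab dir_def axis_def)
  then have "A *v x = (of_int (a 1) *\<^sub>R (A *v dir 1) + of_int (b 1) *\<^sub>R (A *v (sqrt 2
      *\<^sub>R dir 1)))
      + (of_int (a 2) *\<^sub>R (A *v dir 2) + of_int (b 2) *\<^sub>R (A *v (sqrt 2 *\<^sub>R dir 2)))"
    by (metis (no_types, lifting) matrix_vector_right_distrib matrix_vector_mult_scaleR)
  moreover have "\<dots> \<in> lattice"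
    by (intro lattice_add lattice_scale_int affine_aut_dir[OF f])
  ultimately show ?thesis by simp
qed

text \<open>The point is joined to a vertex whose image is known. The L is star-shaped around the
  origin, so the segment from \<open>0\<close> works unless \<open>p\<close> lies on an axis beyond
  the vertex \<open>dir k\<close>; then the segment starts at \<open>dir k\<close>.\<close>

lemma affine_aut_coords:
  assumes f: "affine_aut f A" and p: "p \<in> L8_polygon" and q: "q \<in> L8_polygon" "L8_proj q = f
      (L8_proj p)"
  shows "q - A *v p \<in> lattice"
proof (cases "\<exists>k. p $ oth k = 0 \<and> 1 < p $ k")
  case True
  then obtain k where k: "p $ oth k = 0" "1 < p $ k" by blast
  let ?c = "p $ k"
  have pk: "p = ?c *\<^sub>R dir k" using k by (simp add: vec2_eq_iff[where k=k])
  then have c: "?c \<le> len k" using p dir_scaled_polygon by metis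
  have E: "dir k + s *\<^sub>R ((?c - 1) *\<^sub>R dir k) = (1 + s * (?c - 1)) *\<^sub>R dir k" for s
    by (simp add: algebra_simps)
  have "q - 0 - A *v ((?c - 1) *\<^sub>R dir k) \<in> lattice"
  proof (rule affine_aut_segment[OF f, where p = "dir k"])
    show "dir k + s *\<^sub>R ((?c - 1) *\<^sub>R dir k) \<in> L8_polygon" if "s \<in> {0..1}" for s
    proof -
      have "s * (?c - 1) \<le> ?c - 1" using that k by (intro mult_left_le_one_le) auto
      moreover have "0 \<le> s * (?c - 1)" using that k by auto
      ultimately show ?thesis unfolding E dir_scaled_polygon using c by (intro conjI) linarith+
    qed
    show "dir k + s *\<^sub>R ((?c - 1) *\<^sub>R dir k) \<notin> vertices" if "s \<in> {0<..<1}" for s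
    proof -
      have "s * (?c - 1) < ?c - 1" using that k by simp
      moreover have "0 < s * (?c - 1)" using that k by simp
      ultimately show ?thesis unfolding E using c by (intro dir_scaled_not_vertex) linarith+
    qed
    have "dir k \<in> vertices" using dir_scaled_vertices[of 1 k] by simp
    then show "L8_proj 0 = f (L8_proj (dir k))" using affine_aut_singular[OF f] proj_vertex_iff
        vertices_polygon by metis
    show "L8_proj q = f (L8_proj (dir k + (?c - 1) *\<^sub>R dir k))"
      using q(2) pk by (simp add: algebra_simps)
  qed (use q in auto)
  from lattice_diff[OF this affine_aut_dir(1)[OF f, of k]]
  have "q - A *v ((?c - 1) *\<^sub>R dir k + dir k) \<in> lattice"
    by (simp add: matrix_vector_right_distrib diff_diff_eq)
  also have "(?c - 1) *\<^sub>R dir k + dir k = p" by (subst (2) pk) (simp add: algebra_simps)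
  finally show ?thesis .
next
  case False
  have ax: "p $ k \<le> 1" if "p $ oth k = 0" for k using False that by (auto simp: not_less)
  show ?thesis
  proof (cases "p = 0")
    case True
    then have "q \<in> vertices" using q affine_aut_singular[OF f] proj_vertex_iff by simp
    then show ?thesis using True vertices_lattice by simp
  next
    case False
    have pp: "0 \<le> p $ k" "p $ k \<le> len k" "p $ k \<le> 1 \<or> p $ oth k \<le> 1" for k
      using p by (auto simp: mem_L8_polygon[where k=k])
    have "q - 0 - A *v p \<in> lattice"
    proof (rule affine_aut_segment[OF f, where p = 0])
      fix s :: real
      show "0 + s *\<^sub>R p \<in> L8_polygon" if s: "s \<in> {0..1}"
      proof -
        have "0 \<le> s * p $ k" "s * p $ k \<le> p $ k" for k
          using s pp(1)[of k] mult_right_mono[of s 1 "p $ k"] by auto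
        note this[of 1] this[of "oth 1"]
        then show ?thesis using pp(2)[of 1] pp(2)[of "oth 1"] pp(3)[of 1]
          by (auto simp: mem_L8_polygon[where k=1])
      qed
      show "0 + s *\<^sub>R p \<notin> vertices" if s: "s \<in> {0<..<1}"
      proof
        assume "0 + s *\<^sub>R p \<in> vertices"
        then have v: "s * p $ k \<in> {0, 1, len k}" for k by (auto simp: vertices_def)
        \<comment> \<open>An inner point of the segment has smaller coordinates than
          \<open>p\<close> wherever those of \<open>p\<close> are nonzero. If it is a vertex, such
          coordinates of \<open>p\<close> exceed 1, and in the L at most one coordinate
          does.\<close>
        have lt: "p $ k = 0 \<or> 1 < p $ k" for k
        proof -
          have "s * p $ k < p $ k" if "p $ k \<noteq> 0" using that pp(1)[of k] s
              mult_strict_right_mono[of s 1 "p $ k"] by auto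
          then show ?thesis using v[of k] s len_pos(3)[of k] by fastforce
        qed
        have "p $ 1 = 0 \<or> p $ oth 1 = 0" using lt[of 1] lt[of "oth 1"] pp(3)[of 1] by linarith
        then obtain k where "p $ oth k = 0" by (metis oth_oth)
        then have "p $ k = 0" using ax[of k] lt[of k] by linarith
        then have "p = 0" using \<open>p $ oth k = 0\<close> by (simp add: vec2_eq_iff[where k=k])
        then show False using False by simp
      qed
    qed (use q affine_aut_singular[OF f] in auto)
    then show ?thesis by simp
  qed
qed

section \<open>Denominators\<close>

lemma sqrt2_irrational: "sqrt 2 \<notin> \<rat>"
proof
  assume "sqrt 2 \<in> \<rat>"
  then obtain m n :: nat where mn: "n \<noteq> 0" "\<bar>sqrt 2\<bar> = real m / real n" "coprime m n"
    by (rule Rats_abs_nat_div_natE)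
  then have "real m = sqrt 2 * real n" by simp
  then have "(real m)\<^sup>2 = 2 * (real n)\<^sup>2" by (simp add: power_mult_distrib)
  then have eq: "m\<^sup>2 = 2 * n\<^sup>2" by (metis of_nat_eq_iff of_nat_mult of_nat_numeral of_nat_power)
  then have "even m" by (metis dvd_triv_left even_power)
  then obtain k where "m = 2 * k" by (rule evenE)
  then have "n\<^sup>2 = 2 * k\<^sup>2" using eq by (simp add: power2_eq_square)
  then have "even n" by (metis dvd_triv_left even_power)
  then show False using \<open>even m\<close> mn(3) by (meson coprime_common_divisor odd_one)
qed

lemma rat_sqrt2_eq_iff:
  "(of_rat a + of_rat b * sqrt 2 :: real) = of_rat c + of_rat d * sqrt 2 \<longleftrightarrow> a = c
      \<and> b = d"
proof (intro iffI; (elim conjE)?)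
  assume eq: "(of_rat a + of_rat b * sqrt 2 :: real) = of_rat c + of_rat d * sqrt 2"
  have "b = d"
  proof (rule ccontr)
    assume "b \<noteq> d"
    have "sqrt 2 * of_rat (b - d) = of_rat (c - a)" using eq by (simp add: of_rat_diff algebra_simps)
    then have "sqrt 2 = of_rat ((c - a) / (b - d))" using \<open>b \<noteq> d\<close> by (simp add:
        of_rat_divide field_simps)
    then show False using sqrt2_irrational by (metis Rats_of_rat)
  qed
  then show "a = c \<and> b = d" using eq by simp
qed auto

lemma denominator_pos: "0 < denominator r"
  using quotient_of_denom_pos'[of r] by (simp add: denominator_def)

lemma denominator_dvd_iff: "denominator r dvd n \<longleftrightarrow> (\<exists>m::int. of_nat n * r =
    of_int m)"
proof -
  obtain p q where pq: "quotient_of r = (p, q)" by fastforce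
  have q: "q > 0" "coprime p q" "r = of_int p / of_int q"
    using quotient_of_denom_pos[OF pq] quotient_of_coprime[OF pq] quotient_of_div[OF pq] by auto
  have "denominator r dvd n \<longleftrightarrow> q dvd int n"
    using pq q(1) by (simp add: denominator_def) (metis int_dvd_int_iff nat_0_le less_imp_le)
  also have "\<dots> \<longleftrightarrow> q dvd p * int n"
    using q(2) by (simp add: coprime_dvd_mult_right_iff coprime_commute)
  also have "\<dots> \<longleftrightarrow> (\<exists>m. p * int n = q * m)" by (auto simp: dvd_def)
  also have "\<dots> \<longleftrightarrow> (\<exists>m::int. of_nat n * r = of_int m)"
  proof (intro ex_cong1)
    fix m
    have "of_nat n * r = of_int m \<longleftrightarrow> (of_int (p * int n) :: rat) = of_int (q * m)"
      using q(1) by (simp add: q(3) field_simps)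
    then show "p * int n = q * m \<longleftrightarrow> of_nat n * r = of_int m" by (metis of_int_eq_iff)
  qed
  finally show ?thesis .
qed

lemma Zw_rat_iff:
  "of_nat n * (of_rat a + of_rat b * sqrt 2) \<in> Zw \<longleftrightarrow> denominator a dvd n \<and>
      denominator b dvd n"
proof -
  have "of_nat n * (of_rat a + of_rat b * sqrt 2 :: real) = of_rat (of_nat n * a) + of_rat (of_nat n *
      b) * sqrt 2"
    by (simp add: of_rat_mult algebra_simps)
  moreover have "(of_rat x + of_rat y * sqrt 2 :: real) \<in> Zw \<longleftrightarrow> (\<exists>c d. x
      = of_int c \<and> y = of_int d)" for x y
  proof -
    have "(of_rat x + of_rat y * sqrt 2 :: real) = of_int c + of_int d * sqrt 2 \<longleftrightarrow> x
        = of_int c \<and> y = of_int d" for c d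
      using rat_sqrt2_eq_iff[of x y "of_int c" "of_int d"] by simp
    then show ?thesis by (simp add: Zw_def)
  qed
  ultimately show ?thesis by (auto simp: denominator_dvd_iff)
qed

lemma lattice_rat_iff:
  "of_nat n *\<^sub>R (vector [of_rat xr + of_rat xi * sqrt 2, of_rat yr + of_rat yi * sqrt 2] ::
      real^2) \<in> lattice
    \<longleftrightarrow> Lcm (denominator ` {xr, xi, yr, yi}) dvd n"
  by (simp add: lattice_def forall_2 Zw_rat_iff)

lemma lattice_scale_rational:
  assumes "of_nat n *\<^sub>R p \<in> lattice" "n > 0"
  shows "\<exists>xr xi yr yi. p = vector [of_rat xr + of_rat xi * sqrt 2, of_rat yr + of_rat yi * sqrt 2]"
proof -
  have "\<exists>a b. p $ i = of_rat a + of_rat b * sqrt 2" for i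
  proof -
    have "of_nat n * p $ i \<in> Zw" using assms(1) by (simp add: lattice_def)
    then obtain c d where "of_nat n * p $ i = of_int c + of_int d * sqrt 2"
      by (auto simp: Zw_def)
    then have "p $ i = of_rat (of_int c / of_nat n) + of_rat (of_int d / of_nat n) * sqrt 2"
      using assms(2) by (simp add: of_rat_divide field_simps)
    then show ?thesis by blast
  qed
  note this[of 1] this[of 2]
  then obtain a b c d where "p $ 1 = of_rat a + of_rat b * sqrt 2" "p $ 2 = of_rat c + of_rat d * sqrt
      2" by blast
  then have "p = vector [of_rat a + of_rat b * sqrt 2, of_rat c + of_rat d * sqrt 2]"
    by (simp add: vec_eq_iff forall_2)
  then show ?thesis by blast
qed

text \<open>The denominator is the order of the coordinates modulo the lattice, a form on which
  affine maps can act. Positivity encodes rationality: for other points only the zero multiple lies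
  in the lattice, which would match \<open>N = 0\<close>.\<close>

lemma has_common_denominator_iff:
  "has_common_denominator P N \<longleftrightarrow> N > 0 \<and> (\<forall>n. of_nat n *\<^sub>R
      L8_coords P \<in> lattice \<longleftrightarrow> N dvd n)"
proof
  assume "has_common_denominator P N"
  then obtain xr xi yr yi where
    *: "L8_coords P = vector [of_rat xr + of_rat xi * sqrt 2, of_rat yr + of_rat yi * sqrt 2]"
    "N = Lcm (denominator ` {xr, xi, yr, yi})"
    unfolding has_common_denominator_def by blast
  have "denominator xr * denominator xi * denominator yr * denominator yi \<noteq> 0"
    using denominator_pos[of xr] denominator_pos[of xi] denominator_pos[of yr] denominator_pos[of yi]
        by simp
  moreover have "N dvd denominator xr * denominator xi * denominator yr * denominator yi"
    unfolding *(2) by (rule Lcm_least) auto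
  ultimately have "N \<noteq> 0" by (metis dvd_0_left)
  moreover have "\<forall>n. of_nat n *\<^sub>R L8_coords P \<in> lattice \<longleftrightarrow> N dvd n"
    unfolding *(1) lattice_rat_iff *(2) by simp
  ultimately show "N > 0 \<and> (\<forall>n. of_nat n *\<^sub>R L8_coords P \<in> lattice
      \<longleftrightarrow> N dvd n)" by blast
next
  assume R: "N > 0 \<and> (\<forall>n. of_nat n *\<^sub>R L8_coords P \<in> lattice
      \<longleftrightarrow> N dvd n)"
  then have "of_nat N *\<^sub>R L8_coords P \<in> lattice" "0 < N" by simp_all
  from lattice_scale_rational[OF this] obtain xr xi yr yi where
    *: "L8_coords P = vector [of_rat xr + of_rat xi * sqrt 2, of_rat yr + of_rat yi * sqrt 2]"
    by (elim exE)
  have iff: "Lcm (denominator ` {xr, xi, yr, yi}) dvd n \<longleftrightarrow> N dvd n" for n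
    using R unfolding * lattice_rat_iff by (elim conjE allE[of _ n])
  have "N = Lcm (denominator ` {xr, xi, yr, yi})"
    by (rule dvd_antisym) (use iff[of N] iff[of "Lcm (denominator ` {xr, xi, yr, yi})"] in
        \<open>simp_all only: dvd_refl\<close>)
  then show "has_common_denominator P N" unfolding has_common_denominator_def using * by blast
qed

lemma affine_aut_scale_lattice:
  assumes f: "affine_aut f A" and P: "P \<in> topspace L8" and n: "of_nat n *\<^sub>R L8_coords P \<in>
      lattice"
  shows "of_nat n *\<^sub>R L8_coords (f P) \<in> lattice"
proof -
  obtain p where p: "p \<in> L8_polygon" "P = L8_proj p" using P by (rule topspace_L8_cases)
  obtain q where q: "q \<in> L8_polygon" "f P = L8_proj q" using affine_aut_topspace[OF f P] by (rule
      topspace_L8_cases)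
  have "rep q - A *v rep p \<in> lattice"
    using p q by (intro affine_aut_coords[OF f]) (simp_all add: rep_polygon L8_proj_rep)
  then have "of_nat n *\<^sub>R (rep q - A *v rep p) + A *v (of_nat n *\<^sub>R rep p) \<in> lattice"
    using n p affine_aut_lattice[OF f] lattice_add lattice_scale_nat by (simp add: L8_coords_proj)
  then show ?thesis using q by (simp add: L8_coords_proj matrix_vector_mult_scaleR algebra_simps)
qed

text \<open>An automorphism keeps multiples in the lattice; applying this to the inverse as well
  shows that the order does not drop.\<close>

lemma has_common_denominator_affine:
  assumes f: "affine_aut f A" and P: "P \<in> topspace L8" and N: "has_common_denominator P N"
  shows "has_common_denominator (f P) N"
proof -
  obtain g where g: "affine_aut g (matrix_inv A)" "\<forall>P \<in> topspace L8. g (f P) = P"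
    using affine_aut_inverse[OF f] .
  have "of_nat n *\<^sub>R L8_coords (f P) \<in> lattice \<longleftrightarrow> of_nat n *\<^sub>R
      L8_coords P \<in> lattice" for n
    using affine_aut_scale_lattice[OF f P] affine_aut_scale_lattice[OF g(1) affine_aut_topspace[OF f
        P], of n]
      g(2) P by auto
  then show ?thesis using N by (simp add: has_common_denominator_iff)
qed

section \<open>Orbits form a partition\<close>

lemma partition_on_orbits:
  "partition_on (connection_points N) (SL_L8_orbit ` connection_points N)"
proof (rule partition_onI)
  have top: "P \<in> topspace L8" if "P \<in> connection_points N" for P
    using that by (simp add: connection_points_def connection_point_def)
  have "Q \<in> connection_points N" if P: "P \<in> connection_points N" and Q: "Q \<in> SL_L8_orbit P"
      for P Q
  proof -
    obtain f A where "affine_aut f A" "Q = f P" using orbitE[OF Q] .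
    then show ?thesis using P top[OF P] connection_point_affine has_common_denominator_affine
      unfolding connection_points_def by blast
  qed
  then show "\<Union> (SL_L8_orbit ` connection_points N) = connection_points N"
    using orbit_refl by blast
  fix X Y assume XY: "X \<in> SL_L8_orbit ` connection_points N" "Y \<in> SL_L8_orbit `
      connection_points N" "X \<noteq> Y"
  then obtain P Q where PQ: "P \<in> connection_points N" "Q \<in> connection_points N" "X =
      SL_L8_orbit P" "Y = SL_L8_orbit Q" by blast
  show "disjnt X Y"
  proof (rule ccontr)
    assume "\<not> disjnt X Y"
    then obtain R where "R \<in> SL_L8_orbit P" "R \<in> SL_L8_orbit Q" using PQ by (auto simp: disjnt_def)
    then have "X = Y" using orbit_eq top PQ by metis
    then show False using XY by blast
  qed
qed (use orbit_refl in blast)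

section \<open>Multitwists\<close>

definition shear :: "2 \<Rightarrow> real \<Rightarrow> real^2^2" where
  "shear k c = (\<chi> i l. if i = l then 1 else if i = k then c else 0)"

lemma shear_apply: "shear k c *v s = s + (c * s $ oth k) *\<^sub>R dir k"
  using exhaust_2[of k]
  by (auto simp: vec_eq_iff forall_2 matrix_vector_mult_def sum_2 shear_def dir_def axis_def oth_def)

lemma det_shear: "det (shear k c) = 1"
  using exhaust_2[of k] by (auto simp: det_2 shear_def)

text \<open>The shear is normalised to fix the lower boundary of the strip pointwise; the upper
  boundary then moves by full turns.\<close>

definition strip_shear :: "2 \<Rightarrow> bool \<Rightarrow> int \<Rightarrow> real^2 \<Rightarrow>
    real^2" where
  "strip_shear k j n s = s + (of_int n * len k * (s $ oth k - lo j)) *\<^sub>R dir k"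

definition twist_polygon :: "2 \<Rightarrow> int \<Rightarrow> real^2 \<Rightarrow> surface_point" where
  "twist_polygon k n p = (let j = 1 < p $ oth k in cyl k j (strip_shear k j n p))"

definition twist :: "2 \<Rightarrow> int \<Rightarrow> surface_point \<Rightarrow> surface_point" where
  "twist k n P = twist_polygon k n (L8_coords P)"

lemma strip_shear_strip [simp]:
  "strip_shear k j n s \<in> cstrip k j' \<longleftrightarrow> s \<in> cstrip k j'" "strip_shear k j n
      s \<in> ostrip k j' \<longleftrightarrow> s \<in> ostrip k j'"
  by (simp_all add: strip_shear_def)

lemma strip_shear_shift: "strip_shear k j n (s + c *\<^sub>R dir k) = strip_shear k j n s + c *\<^sub>R
    dir k"
  by (simp add: strip_shear_def)

text \<open>
  The ratios of circumference to height of the two cylinders are commensurable, which is why a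
  single shear restricts to full twists on both.
\<close>

lemma full_twist: "\<exists>m::int. of_int n * len k * (hi k j - lo j) = of_int m * per k j"
proof (cases j)
  case True
  \<comment> \<open>One turn of the cylinder of circumference \<open>len k\<close> comes with
    \<open>(1 + sqrt 2) * (sqrt 2 - 1) = 1\<close> turn of the other one for \<open>k = 1\<close>,
    and with \<open>sqrt 2 * sqrt 2 = 2\<close> turns for \<open>k = 2\<close>.\<close>
  have "\<exists>m::int. len k * (len (oth k) - 1) = of_int m"
    using exhaust_2[of k]
  proof
    assume "k = 1"
    then have "len k * (len (oth k) - 1) = of_int 1" by (simp add: len_def oth_def algebra_simps)
    then show ?thesis by blast
  next
    assume "k = 2"
    then have "len k * (len (oth k) - 1) = of_int 2" by (simp add: len_def oth_def)
    then show ?thesis by blast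
  qed
  then obtain m :: int where "len k * (len (oth k) - 1) = of_int m" by blast
  then have "of_int n * len k * (hi k j - lo j) = of_int (n * m) * per k j"
    using True by (simp add: hi_def lo_def per_def)
  then show ?thesis by blast
next
  case False
  then show ?thesis by (intro exI[of _ n]) (simp add: hi_def lo_def per_def)
qed

lemma cyl_strip_shear_boundary:
  assumes "s $ oth k = lo j \<or> s $ oth k = hi k j"
  shows "cyl k j (strip_shear k j n s) = cyl k j s"
  using assms
proof
  assume "s $ oth k = hi k j"
  moreover obtain m :: int where "of_int n * len k * (hi k j - lo j) = of_int m * per k j" using
      full_twist by blast
  ultimately show ?thesis by (simp add: strip_shear_def cyl_shift)
qed (simp add: strip_shear_def)

lemma twist_polygon_boundary:
  assumes "p \<in> L8_polygon" "p $ oth k \<in> {0, 1, len (oth k)}"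
  shows "twist_polygon k n p = L8_proj p"
proof -
  define j where "j = (1 < p $ oth k)"
  have "p $ oth k = lo j \<or> p $ oth k = hi k j"
    using assms(2) by (auto simp: j_def lo_def hi_def)
  moreover have "cyl k j p = L8_proj p"
    using assms(1) by (intro cyl_eq_proj) (auto simp: j_def mem_L8_polygon[where k=k] cstrip_def lo_def
        hi_def per_def)
  ultimately show ?thesis by (simp add: twist_polygon_def Let_def j_def[symmetric] cyl_strip_shear_boundary)
qed

lemma twist_polygon_ostrip: "p \<in> ostrip k j \<Longrightarrow> twist_polygon k n p = cyl k j
    (strip_shear k j n p)"
  by (cases j) (auto simp: twist_polygon_def Let_def ostrip_def lo_def hi_def)

lemma polygon_ostrip_or_boundary:
  assumes "p \<in> L8_polygon"
  shows "(\<exists>j. p \<in> ostrip k j) \<or> p $ oth k \<in> {0, 1, len (oth k)}"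
proof (cases "p $ oth k \<in> {0, 1, len (oth k)}")
  case False
  then have "p \<in> ostrip k (1 < p $ oth k)"
    using assms by (auto simp: ostrip_def lo_def hi_def mem_L8_polygon[where k=k])
  then show ?thesis by blast
qed simp

lemma proj_eq_ostrip:
  assumes "p \<in> L8_polygon" "q \<in> L8_polygon" "L8_proj p = L8_proj q" "p \<in> ostrip k j"
  obtains m :: int where "p = q + (of_int m * per k j) *\<^sub>R dir k" "q \<in> ostrip k j"
proof -
  obtain m :: int where m: "p = q + (of_int m * per k j) *\<^sub>R dir k"
    using proj_eq_cyl_iff[OF assms(2,4)] ostrip_polygon_cyl[OF assms(1,4)] assms(3) by metis
  then have "q \<in> ostrip k j" using assms(4) by simp
  then show ?thesis using that m by blast
qed

text \<open>Inside a cylinder two representatives differ by full turns, which commute with the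
  shear. On cylinder boundaries the twist is the identity.\<close>

lemma twist_polygon_cong:
  assumes "p \<in> L8_polygon" "q \<in> L8_polygon" "L8_proj p = L8_proj q"
  shows "twist_polygon k n p = twist_polygon k n q"
proof (cases "\<exists>j. p \<in> ostrip k j")
  case True
  then obtain j where j: "p \<in> ostrip k j" by blast
  obtain m :: int where m: "p = q + (of_int m * per k j) *\<^sub>R dir k" "q \<in> ostrip k j"
    using proj_eq_ostrip[OF assms j] .
  have "twist_polygon k n p = cyl k j (strip_shear k j n p)" by (rule twist_polygon_ostrip[OF j])
  also have "\<dots> = cyl k j (strip_shear k j n q)" unfolding m(1) strip_shear_shift by (rule cyl_shift)
  also have "\<dots> = twist_polygon k n q" by (rule twist_polygon_ostrip[OF m(2), symmetric])
  finally show ?thesis .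
next
  case False
  then have "\<not> (\<exists>j. q \<in> ostrip k j)"
    using proj_eq_ostrip[OF assms(2,1) assms(3)[symmetric]] by metis
  then show ?thesis
    using polygon_ostrip_or_boundary[of _ k] twist_polygon_boundary assms False by metis
qed

lemma twist_proj: "p \<in> L8_polygon \<Longrightarrow> twist k n (L8_proj p) = twist_polygon k n p"
  unfolding twist_def L8_coords_proj by (intro twist_polygon_cong) (simp_all add: L8_proj_rep rep_polygon)

lemma twist_cyl:
  assumes "s \<in> cstrip k j"
  shows "twist k n (cyl k j s) = cyl k j (strip_shear k j n s)"
proof -
  define m where "m = \<lfloor>s $ k / per k j\<rfloor>"
  define t where "t = s - (of_int m * per k j) *\<^sub>R dir k"
  have t: "cyl k j s = L8_proj t" "t \<in> L8_polygon" "t \<in> cstrip k j"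
    using cyl_eq_proj_shift[OF assms floor_bounds(1,2)] assms by (auto simp: t_def m_def)
  have s: "s = t + (of_int m * per k j) *\<^sub>R dir k" by (simp add: t_def)
  have eq: "cyl k j (strip_shear k j n s) = cyl k j (strip_shear k j n t)"
    unfolding s strip_shear_shift by (rule cyl_shift)
  show ?thesis
  proof (cases "t \<in> ostrip k j")
    case True
    then show ?thesis using eq t twist_proj twist_polygon_ostrip by simp
  next
    case False
    then have b: "t $ oth k = lo j \<or> t $ oth k = hi k j" using t(3) by (auto simp: ostrip_def
        cstrip_def)
    then have "t $ oth k \<in> {0, 1, len (oth k)}" by (cases j) (auto simp: lo_def hi_def)
    then have "twist k n (cyl k j s) = L8_proj t" using t twist_proj twist_polygon_boundary by simp
    moreover have "cyl k j (strip_shear k j n t) = cyl k j s"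
      using cyl_strip_shear_boundary[OF b] cyl_shift[of k j t m] s by simp
    ultimately show ?thesis using eq t(1) by simp
  qed
qed

lemma polygon_cstrip:
  assumes "p \<in> L8_polygon" obtains j where "p \<in> cstrip k j" "0 \<le> p $ k" "p $ k \<le> per k j"
proof (rule that[of "1 < p $ oth k"])
qed (use assms in \<open>auto simp: cstrip_def lo_def hi_def per_def mem_L8_polygon[where k=k]\<close>)

lemma topspace_L8_cyl:
  assumes "P \<in> topspace L8" obtains j s where "s \<in> cstrip k j" "P = cyl k j s"
  using assms polygon_cstrip cyl_eq_proj topspace_L8_cases by metis

lemma twist_inverse: "P \<in> topspace L8 \<Longrightarrow> twist k (- n) (twist k n P) = P"
proof -
  assume "P \<in> topspace L8"
  then obtain j s where s: "s \<in> cstrip k j" "P = cyl k j s" by (rule topspace_L8_cyl)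
  have "strip_shear k j (- n) (strip_shear k j n s) = s" by (simp add: strip_shear_def)
  then show ?thesis using s by (simp add: twist_cyl)
qed

lemma continuous_map_twist: "continuous_map L8 L8 (twist k n)"
proof (rule continuous_compose_quotient_map[OF quotient_map_L8_proj])
  \<comment> \<open>The bound on \<open>p $ k\<close> matters for \<open>j = True\<close>: the lower
    boundary line of that strip continues in the polygon along points that border only the long
    cylinder.\<close>
  let ?T = "\<lambda>j. {p \<in> L8_polygon. p \<in> cstrip k j \<and> p $ k \<le> per k j}"
  let ?f = "\<lambda>j p. cyl k j (strip_shear k j n p)"
  show "continuous_map (top_of_set L8_polygon) L8 (twist k n \<circ> L8_proj)"
  proof (rule pasting_lemma_closed[where I = UNIV and T = ?T and f = ?f])
    fix j
    have "closed {p. p \<in> cstrip k j \<and> p $ k \<le> per k j}"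
      unfolding cstrip_def mem_Collect_eq
      by (intro closed_Collect_conj closed_Collect_le continuous_intros)
    then show "closedin (top_of_set L8_polygon) (?T j)" by (auto simp: closedin_closed)
    have "continuous_map (top_of_set (?T j)) (top_of_set (cstrip k j)) (strip_shear k j n)"
      by (auto simp: strip_shear_def intro!: continuous_intros)
    from continuous_map_compose[OF this continuous_map_cyl]
    have "continuous_map (top_of_set (?T j)) L8 (?f j)" by (simp add: o_def)
    moreover have "?T j \<subseteq> L8_polygon" by blast
    ultimately show "continuous_map (subtopology (top_of_set L8_polygon) (?T j)) L8 (?f j)"
      by (simp add: subtopology_subtopology Int_absorb1)
  next
    have eq: "?f j p = (twist k n \<circ> L8_proj) p" if "p \<in> ?T j" for j p
    proof -
      have "0 \<le> p $ k" using that by (auto simp: mem_L8_polygon[where k=k])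
      then show ?thesis using that twist_cyl[of p k j n] cyl_eq_proj[of p k j] by simp
    qed
    show "?f i p = ?f j p" if "p \<in> topspace (top_of_set L8_polygon) \<inter> ?T i \<inter> ?T j"
        for i j p
      using eq[of p i] eq[of p j] that by blast
    fix p assume "p \<in> topspace (top_of_set L8_polygon)"
    then have "p \<in> L8_polygon" by simp
    moreover from this obtain j where "p \<in> cstrip k j" "0 \<le> p $ k" "p $ k \<le> per k j" by
        (rule polygon_cstrip)
    ultimately have "p \<in> ?T j" by simp
    then show "\<exists>j. j \<in> UNIV \<and> p \<in> ?T j \<and> (twist k n \<circ> L8_proj) p = ?f j p"
      using eq[of p j] by (intro exI[of _ j]) simp
  qed simp
qed

lemma homeomorphic_map_twist: "homeomorphic_map L8 L8 (twist k n)"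
proof -
  have "homeomorphic_maps L8 L8 (twist k n) (twist k (- n))"
    unfolding homeomorphic_maps_def
    using continuous_map_twist twist_inverse[of _ k n] twist_inverse[of _ k "- n"] by simp
  then show ?thesis by (auto simp: homeomorphic_map_maps)
qed

text \<open>
  Across the boundary of two cylinders in direction \<open>k\<close>, the twist is an affine map of the
  strip in the other direction: the translation parts on the two sides differ by a full turn.
\<close>

lemma twist_transverse_aux:
  fixes r m :: int
  assumes s: "s \<in> ostrip (oth k) j'" "s + c *\<^sub>R dir k \<in> ostrip (oth k) j'"
    and t: "t = s + (of_int m * per (oth k) j') *\<^sub>R dir (oth k)"
    and J: "t \<in> cstrip k J" "j' \<Longrightarrow> \<not> J" "0 \<le> t $ oth k" "t $ oth k \<le>
        per (oth k) j'"
    and c: "of_int n * len k * (t $ oth k - lo J) = c + of_int r * per k J"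
  shows "twist k n (cyl (oth k) j' s) = cyl (oth k) j' (s + c *\<^sub>R dir k)"
proof -
  have b: "0 \<le> x $ k \<and> x $ k \<le> per k J" if "x \<in> ostrip (oth k) j'" for x
    using that J(2) len_bounds[of k] by (cases j'; cases J) (auto simp: ostrip_def lo_def hi_def per_def)
  have t': "t \<in> cstrip (oth k) j'" using s(1) ostrip_cstrip by (auto simp: t)
  have tc: "t + c *\<^sub>R dir k = s + c *\<^sub>R dir k + (of_int m * per (oth k) j') *\<^sub>R dir
      (oth k)" by (simp add: t)
  have tc': "t + c *\<^sub>R dir k \<in> cstrip (oth k) j'" unfolding tc using s(2) ostrip_cstrip by auto
  have bt: "0 \<le> t $ k" "t $ k \<le> per k J" "0 \<le> (t + c *\<^sub>R dir k) $ k" "(t + c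
      *\<^sub>R dir k) $ k \<le> per k J"
    using b[OF s(1)] b[OF s(2)] by (simp_all add: t)
  have "cyl (oth k) j' s = cyl (oth k) j' t" unfolding t by (rule cyl_shift[symmetric])
  also have "\<dots> = L8_proj t" using t' J(3,4) by (rule cyl_eq_proj)
  also have "\<dots> = cyl k J t" using J(1) bt(1,2) by (rule cyl_eq_proj[symmetric])
  finally have "twist k n (cyl (oth k) j' s) = cyl k J (strip_shear k J n t)" using twist_cyl[OF J(1)]
      by simp
  also have "strip_shear k J n t = (t + c *\<^sub>R dir k) + (of_int r * per k J) *\<^sub>R dir k"
    unfolding strip_shear_def c by (simp add: scaleR_add_left)
  also have "cyl k J \<dots> = cyl k J (t + c *\<^sub>R dir k)" by (rule cyl_shift)
  also have "\<dots> = L8_proj (t + c *\<^sub>R dir k)" using J(1) bt(3,4) by (intro cyl_eq_proj) simp_all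
  also have "\<dots> = cyl (oth k) j' (t + c *\<^sub>R dir k)" using tc' J(3,4) by (intro
      cyl_eq_proj[symmetric]) simp_all
  also have "\<dots> = cyl (oth k) j' (s + c *\<^sub>R dir k)" unfolding tc by (rule cyl_shift)
  finally show ?thesis .
qed

text \<open>The boundary circle crosses the transverse strip at height \<open>u\<close>. Above it
  the displacement is \<open>c\<close> itself, below it \<open>c\<close> plus full turns. Points
  below height 0 are first lifted by one period: they land at the top of the cylinder
  \<open>J = True\<close> if the transverse strip is the long one, and of \<open>J = False\<close>
  otherwise.\<close>

lemma twist_transverse:
  assumes s: "s \<in> ostrip (oth k) j'" "s + c *\<^sub>R dir k \<in> ostrip (oth k) j'"
    and u: "u = 0 \<or> u = 1 \<and> \<not> j'" and near: "\<bar>s $ oth k - u\<bar> < 1/4"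
    and c: "c = of_int n * len k * (s $ oth k - u)"
  shows "twist k n (cyl (oth k) j' s) = cyl (oth k) j' (s + c *\<^sub>R dir k)"
proof -
  note b = len_bounds[of "oth k"] len_bounds[of k]
  consider "u = 0" "0 \<le> s $ oth k" | "u = 1" "\<not> j'" "1 \<le> s $ oth k" | "u = 1" "\<not> j'"
      "s $ oth k < 1"
    | "u = 0" "s $ oth k < 0" "\<not> j'" | "u = 0" "s $ oth k < 0" "j'"
    using u by force
  then show ?thesis
  proof cases
    case 1
    then show ?thesis using near c b
      by (intro twist_transverse_aux[OF s, where m = 0 and r = 0 and J = False])
        (auto simp: cstrip_def lo_def hi_def per_def)
  next
    case 2
    then show ?thesis using near c b
      by (intro twist_transverse_aux[OF s, where m = 0 and r = 0 and J = True])
        (auto simp: cstrip_def lo_def hi_def per_def)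
  next
    case 3
    then show ?thesis using near c b
      by (intro twist_transverse_aux[OF s, where m = 0 and r = n and J = False])
        (auto simp: cstrip_def lo_def hi_def per_def algebra_simps)
  next
    case 4
    obtain m :: int where m: "of_int n * len k * (hi k True - lo True) = of_int m * per k True" using
        full_twist by blast
    show ?thesis using near c b 4 m
      by (intro twist_transverse_aux[OF s, where m = 1 and r = m and J = True])
        (auto simp: cstrip_def lo_def hi_def per_def algebra_simps)
  next
    case 5
    then show ?thesis using near c b
      by (intro twist_transverse_aux[OF s, where m = 1 and r = n and J = False])
        (auto simp: cstrip_def lo_def hi_def per_def algebra_simps)
  qed
qed

text \<open>A point at the end of the transverse period is shifted back to height 0, so that only
  the heights treated by \<open>twist_transverse\<close> remain.\<close>

lemma transverse_strip:
  assumes p: "p \<in> L8_polygon" "p \<notin> vertices" "p $ oth k \<in> {0, 1, len (oth k)}"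
  obtains j' s where "s \<in> ostrip (oth k) j'" "cyl (oth k) j' s = L8_proj p"
    "s $ oth k = 0 \<or> s $ oth k = 1 \<and> \<not> j'"
proof -
  define j' where "j' = (1 < p $ k)"
  have k: "p $ k \<notin> {0, 1, len k}" using p by (auto simp: mem_vertices[where k=k])
  have o: "p \<in> ostrip (oth k) j'"
    using p(1) k by (auto simp: j'_def ostrip_def lo_def hi_def mem_L8_polygon[where k=k])
  have e: "cyl (oth k) j' p = L8_proj p" by (rule ostrip_polygon_cyl[OF p(1) o])
  show ?thesis
  proof (cases "p $ oth k = 0 \<or> p $ oth k = 1 \<and> \<not> j'")
    case True
    then show ?thesis using that o e by blast
  next
    case False
    then have "p $ oth k = per (oth k) j'"
      using p(1,3) by (auto simp: j'_def per_def mem_L8_polygon[where k=k] split: if_splits)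
    then have "(p - per (oth k) j' *\<^sub>R dir (oth k)) $ oth k = 0" by simp
    moreover have "cyl (oth k) j' (p - per (oth k) j' *\<^sub>R dir (oth k)) = L8_proj p"
      using cyl_shift[of "oth k" j' p "-1"] e by simp
    moreover have "p - per (oth k) j' *\<^sub>R dir (oth k) \<in> ostrip (oth k) j'" using o by simp
    ultimately show ?thesis using that by blast
  qed
qed

lemma twist_singular: "twist k n (L8_proj 0) = L8_proj 0"
  by (simp add: twist_proj twist_polygon_boundary)

text \<open>Inside a cylinder the strip formula is affine as it stands. At a boundary point the
  transverse strip is used, with the translation part chosen so that the boundary height is
  fixed.\<close>

lemma affine_near_twist:
  assumes "P \<in> topspace L8 - L8_singularities"
  shows "affine_near (twist k n) (shear k (of_int n * len k)) P"
proof -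
  let ?A = "shear k (of_int n * len k)"
  obtain p where p: "p \<in> L8_polygon" "P = L8_proj p" using assms topspace_L8_cases by blast
  have pv: "p \<notin> vertices" using assms p proj_singular_iff by blast
  have M: "?A *v s + (- (of_int n * len k * t)) *\<^sub>R dir k = s + (of_int n * len k * (s $ oth k -
      t)) *\<^sub>R dir k" for s t
    by (simp add: shear_apply algebra_simps)
  show ?thesis
  proof (cases "\<exists>j. p \<in> ostrip k j")
    case True
    then obtain j where j: "p \<in> ostrip k j" by blast
    then obtain e where e: "e > 0" "ball p e \<subseteq> ostrip k j" using open_ostrip
        open_contains_ball by blast
    have M': "?A *v s + (- (of_int n * len k * lo j)) *\<^sub>R dir k = strip_shear k j n s" for s
      unfolding M strip_shear_def ..
    have "affine_near (twist k n) ?A (cyl k j p)"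
    proof (rule affine_near_cyl[OF j _ e(1), where b = "(- (of_int n * len k * lo j)) *\<^sub>R dir k"
        and k' = k and j' = j])
      show "?A *v p + (- (of_int n * len k * lo j)) *\<^sub>R dir k \<in> ostrip k j" unfolding M'
          using j by simp
      fix s assume "s \<in> ball p e"
      then have "s \<in> cstrip k j" using e(2) ostrip_cstrip by blast
      then show "twist k n (cyl k j s) = cyl k j (?A *v s + (- (of_int n * len k * lo j)) *\<^sub>R dir k)"
        unfolding M' by (rule twist_cyl)
    qed
    then show ?thesis using ostrip_polygon_cyl[OF p(1) j] p(2) by simp
  next
    case False
    then have "p $ oth k \<in> {0, 1, len (oth k)}" using polygon_ostrip_or_boundary[OF p(1)] by blast
    then obtain j' s where s: "s \<in> ostrip (oth k) j'" "cyl (oth k) j' s = L8_proj p"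
        "s $ oth k = 0 \<or> s $ oth k = 1 \<and> \<not> j'"
      using transverse_strip[OF p(1) pv] by blast
    let ?b = "(- (of_int n * len k * s $ oth k)) *\<^sub>R dir k"
    let ?M = "\<lambda>x. x + (of_int n * len k * (x $ oth k - s $ oth k)) *\<^sub>R dir k"
    let ?S = "ostrip (oth k) j' \<inter> ?M -` ostrip (oth k) j' \<inter> {x. \<bar>x $ oth k - s $ oth
        k\<bar> < 1/4}"
    have "open ?S"
      by (intro open_Int open_ostrip open_vimage open_Collect_less continuous_intros)
    moreover have "s \<in> ?S" using s(1) by simp
    ultimately obtain e where e: "e > 0" "ball s e \<subseteq> ?S" using open_contains_ball by blast
    have "affine_near (twist k n) ?A (cyl (oth k) j' s)"
    proof (rule affine_near_cyl[OF s(1) _ e(1), where b = ?b and k' = "oth k" and j' = j'])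
      show "?A *v s + ?b \<in> ostrip (oth k) j'" unfolding M using s(1) by simp
      fix x assume "x \<in> ball s e"
      then have "x \<in> ?S" using e(2) by blast
      then show "twist k n (cyl (oth k) j' x) = cyl (oth k) j' (?A *v x + ?b)"
        unfolding M using s(3) by (intro twist_transverse[where u = "s $ oth k"]) auto
    qed
    then show ?thesis using s(2) p(2) by simp
  qed
qed

lemma affine_aut_twist: "affine_aut (twist k n) (shear k (of_int n * len k))"
  by (intro affine_autI homeomorphic_map_twist twist_singular affine_near_twist) (simp_all add: det_shear)

section \<open>Reduction of Galois conjugates\<close>

text \<open>For \<open>N > 0\<close> this is conjugation on the fractions of \<int>[\<surd>2] with
  denominator \<open>N\<close>, kept as a relation so that the denominator travels with each
  pair.\<close>

definition galois :: "nat \<Rightarrow> real \<Rightarrow> real \<Rightarrow> bool" where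
  "galois N x x' \<longleftrightarrow> (\<exists>a b :: int. of_nat N * x = of_int a + of_int b * sqrt
      2 \<and> of_nat N * x' = of_int a - of_int b * sqrt 2)"

definition len' :: "2 \<Rightarrow> real" where "len' k = (if k = 1 then 1 - sqrt 2 else - sqrt 2)"

lemma galois_add: "galois N x x' \<Longrightarrow> galois N y y' \<Longrightarrow> galois N (x + y) (x'
    + y')"
proof -
  assume "galois N x x'" "galois N y y'"
  then obtain a b c d :: int where *: "of_nat N * x = of_int a + of_int b * sqrt 2" "of_nat N * x' =
      of_int a - of_int b * sqrt 2"
    "of_nat N * y = of_int c + of_int d * sqrt 2" "of_nat N * y' = of_int c - of_int d * sqrt 2"
    unfolding galois_def by blast
  show ?thesis unfolding galois_def
    by (intro exI[of _ "a + c"] exI[of _ "b + d"]) (use * in \<open>simp add: algebra_simps\<close>)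
qed

lemma galois_mult: "galois 1 z z' \<Longrightarrow> galois N x x' \<Longrightarrow> galois N (z * x)
    (z' * x')"
proof -
  assume "galois 1 z z'" "galois N x x'"
  then obtain a b c d :: int where *: "z = of_int a + of_int b * sqrt 2" "z' = of_int a - of_int b * sqrt 2"
    "of_nat N * x = of_int c + of_int d * sqrt 2" "of_nat N * x' = of_int c - of_int d * sqrt 2"
    unfolding galois_def by auto
  have 1: "of_nat N * (z * x) = (of_int a + of_int b * sqrt 2) * (of_int c + of_int d * sqrt 2)"
    using *(1,3) by (metis mult.left_commute)
  have 2: "of_nat N * (z' * x') = (of_int a - of_int b * sqrt 2) * (of_int c - of_int d * sqrt 2)"
    using *(2,4) by (metis mult.left_commute)
  show ?thesis unfolding galois_def 1 2
    by (intro exI[of _ "a * c + 2 * (b * d)"] exI[of _ "a * d + b * c"]) (simp add: algebra_simps)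
qed

lemma galois_int: "galois N (of_int m) (of_int m)"
  unfolding galois_def by (intro exI[of _ "int N * m"] exI[of _ 0]) simp

lemma galois_len: "galois 1 (len k) (len' k)"
proof (cases "k = 1")
  case True
  then show ?thesis unfolding galois_def by (intro exI[of _ 1]) (simp add: len_def len'_def)
next
  case False
  then show ?thesis unfolding galois_def by (intro exI[of _ 0] exI[of _ 1]) (simp add: len_def len'_def)
qed

lemma galois_minus: "galois N x x' \<Longrightarrow> galois N (- x) (- x')"
  using galois_mult[OF galois_int[of 1 "-1"]] by simp

lemma len'_bounds: "2/5 < \<bar>len' k\<bar>" "\<bar>len' k\<bar> < 3/2" "\<bar>len' 1\<bar> < 1/2"
  using sqrt2_bounds by (auto simp: len'_def)

definition galois_point :: "nat \<Rightarrow> real^2 \<Rightarrow> real^2 \<Rightarrow> bool" where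
  "galois_point N p p' \<longleftrightarrow> p \<in> L8_polygon \<and> (\<forall>i. galois N (p $ i)
      (p' $ i))"

text \<open>Returning to the polygon removes \<open>m\<close> turns, so the conjugate loses
  \<open>m\<close> conjugate circumferences. Up to less than one turn, \<open>m\<close> is the
  actual displacement divided by the circumference. Its part linear in \<open>n\<close> is absorbed
  into \<theta>, and the remainder is at most twice the conjugate circumference, that is, 3.\<close>

lemma twist_galois:
  assumes "galois_point N p p'"
  obtains \<theta> where "\<bar>\<theta> - len' k * p' $ oth k\<bar> \<le> 6"
    "\<forall>n. \<exists>q q'. galois_point N q q' \<and> L8_proj q = twist k n (L8_proj p) \<and> q'
        $ oth k = p' $ oth k \<and>
      \<bar>q' $ k - (p' $ k + of_int n * \<theta>)\<bar> \<le> 3"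
proof -
  have p: "p \<in> L8_polygon" and g: "\<And>i. galois N (p $ i) (p' $ i)" using assms by (auto simp:
      galois_point_def)
  obtain j where j: "p \<in> cstrip k j" "0 \<le> p $ k" "p $ k \<le> per k j" using polygon_cstrip[OF p] .
  define t where "t = p $ oth k"
  define t' where "t' = p' $ oth k"
  define per' where "per' = (if j then 1 else len' k)"
  define \<rho> where "\<rho> = per' / per k j"
  \<comment> \<open>The factor \<rho> converts lengths removed in the cylinder into their
    conjugates. In the long cylinder this gives \<open>len' k * (t' - t)\<close>; in the other one
    \<rho> is 1 and the correction is the actual displacement itself.\<close>
  define \<theta> where "\<theta> = len' k * (t' - lo j) - \<rho> * (len k * (t - lo j))"
  have per': "\<bar>per'\<bar> \<le> 3/2" "galois 1 (per k j) per'"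
    using len'_bounds(2)[of k] galois_len[of k] galois_int[of 1 1] by (auto simp: per'_def per_def)
  have \<rho>: "per' = \<rho> * per k j" by (simp add: \<rho>_def)
  have lo: "galois N (lo j) (lo j)" using galois_int[of N "if j then 1 else 0"] by (simp add: lo_def
      split: if_splits)
  have tj: "lo j \<le> t" "t \<le> hi k j" using j(1) by (auto simp: cstrip_def t_def)
  have \<theta>: "\<bar>\<theta> - len' k * t'\<bar> \<le> 6"
  proof -
    \<comment> \<open>The bound is (5/2)(3/2), attained by the crude estimates for
      \<open>j = True\<close>. Together with 3/2 for the conjugate of the base point this stays
      below 6.\<close>
    have "\<bar>\<rho> * (len k * (t - lo j))\<bar> \<le> 15/4"
    proof (cases j)
      case True
      then have "\<rho> = 1" "0 \<le> t - lo j" "t - lo j \<le> 3/2" using tj len_bounds(2)[of "oth k"]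
        by (auto simp: \<rho>_def per'_def per_def lo_def hi_def)
      moreover from this have "len k * (t - lo j) \<le> (5/2) * (3/2)"
        using len_bounds(2)[of k] by (intro mult_mono) auto
      ultimately show ?thesis by simp
    next
      case False
      then have "\<rho> * (len k * (t - lo j)) = len' k * t" "0 \<le> t" "t \<le> 1" using tj
        by (auto simp: \<rho>_def per'_def per_def lo_def hi_def)
      moreover from this have "\<bar>len' k\<bar> * t \<le> (3/2) * 1"
        using len'_bounds(2)[of k] by (intro mult_mono) auto
      ultimately show ?thesis by (simp add: abs_mult)
    qed
    moreover have "\<bar>len' k * lo j\<bar> \<le> 3/2" using len'_bounds(2)[of k] by (simp add: lo_def)
    moreover have "\<theta> - len' k * t' = - (len' k * lo j) - \<rho> * (len k * (t - lo j))" by (simp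
        add: \<theta>_def algebra_simps)
    ultimately show ?thesis by linarith
  qed
  have "\<exists>q q'. galois_point N q q' \<and> L8_proj q = twist k n (L8_proj p) \<and> q' $ oth k =
      t' \<and>
      \<bar>q' $ k - (p' $ k + of_int n * \<theta>)\<bar> \<le> 3" for n
  proof -
    define x where "x = p $ k + of_int n * len k * (t - lo j)"
    define m where "m = \<lfloor>x / per k j\<rfloor>"
    define q where "q = strip_shear k j n p - (of_int m * per k j) *\<^sub>R dir k"
    define q' where "q' = p' + (of_int n * len' k * (t' - lo j) - of_int m * per') *\<^sub>R dir k"
    have s: "strip_shear k j n p \<in> cstrip k j" "strip_shear k j n p $ k = x"
      using j(1) by (simp_all add: x_def t_def strip_shear_def)
    have "twist k n (L8_proj p) = cyl k j (strip_shear k j n p)"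
      using twist_cyl[OF j(1)] cyl_eq_proj[OF j] by simp
    then have q: "L8_proj q = twist k n (L8_proj p)" "q \<in> L8_polygon"
      using cyl_eq_proj_shift[OF s(1), of m] floor_bounds[of "per k j" x] by (simp_all add: q_def s m_def)
    have qk: "q $ k = p $ k + (of_int n * (len k * (t + - lo j)) + - (of_int m * per k j))" "q $ oth k = t"
      by (simp_all add: q_def strip_shear_def t_def)
    have qk': "q' $ k = p' $ k + (of_int n * (len' k * (t' + - lo j)) + - (of_int m * per'))" "q' $ oth
        k = t'"
      by (simp_all add: q'_def t'_def)
    have "galois N (q $ k) (q' $ k)"
    proof -
      have "galois N (of_int m * per k j) (of_int m * per')"
        using galois_mult[OF per'(2) galois_int[of N m]] by (simp add: mult.commute)
      moreover have "galois N (of_int n * (len k * (t + - lo j))) (of_int n * (len' k * (t' + - lo j)))"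
        unfolding t_def t'_def
        by (intro galois_mult[OF galois_int] galois_mult[OF galois_len] galois_add galois_minus g lo)
      ultimately show ?thesis unfolding qk qk' by (intro galois_add galois_minus g)
    qed
    moreover have "galois N (q $ oth k) (q' $ oth k)" unfolding qk(2) qk'(2) t_def t'_def by (rule g)
    ultimately have gp: "galois_point N q q'"
      unfolding galois_point_def all_oth[where k=k] using q(2) by blast
    \<comment> \<open>This is the coordinate after the return to the polygon, bounded by the
      circumference.\<close>
    define f where "f = x - of_int m * per k j"
    have f: "0 \<le> f" "f \<le> per k j"
      using floor_bounds[of "per k j" x] by (simp_all add: f_def m_def algebra_simps)
    have "of_int m * per' = \<rho> * (of_int m * per k j)" by (simp add: \<rho>)
    also have "\<dots> = \<rho> * (x - f)" by (simp add: f_def)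
    finally have "q' $ k - (p' $ k + of_int n * \<theta>) = \<rho> * f - \<rho> * p $ k"
      unfolding qk'(1) by (simp add: x_def \<theta>_def algebra_simps)
    also have "\<bar>\<dots>\<bar> \<le> \<bar>\<rho>\<bar> * per k j + \<bar>\<rho>\<bar> * per k j"
      using mult_left_mono[OF f(2), of "\<bar>\<rho>\<bar>"] mult_left_mono[OF j(3), of
          "\<bar>\<rho>\<bar>"] f(1) j(2)
        abs_triangle_ineq4[of "\<rho> * f" "\<rho> * p $ k"] by (simp add: abs_mult)
    also have "\<dots> = 2 * \<bar>per'\<bar>" by (simp add: \<rho> abs_mult)
    finally have "\<bar>q' $ k - (p' $ k + of_int n * \<theta>)\<bar> \<le> 3" using per'(1) by simp
    then show ?thesis using gp q(1) qk'(2) by blast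
  qed
  then show ?thesis using that[of \<theta>] \<theta> unfolding t'_def by blast
qed

lemma arithmetic_progression_window:
  fixes x c \<theta> :: real assumes "\<theta> \<noteq> 0"
  obtains n :: int where "c \<le> x + of_int n * \<theta>" "x + of_int n * \<theta> \<le> c +
      \<bar>\<theta>\<bar>"
proof -
  define m where "m = \<lceil>(c - x) / \<bar>\<theta>\<bar>\<rceil>"
  have "(c - x) / \<bar>\<theta>\<bar> \<le> of_int m" "of_int m \<le> (c - x) / \<bar>\<theta>\<bar> + 1"
    unfolding m_def by linarith+
  then have *: "c - x \<le> of_int m * \<bar>\<theta>\<bar>" "of_int m * \<bar>\<theta>\<bar> \<le> c -
      x + \<bar>\<theta>\<bar>"
    using assms by (simp_all add: field_simps)
  have "of_int (if \<theta> < 0 then - m else m) * \<theta> = of_int m * \<bar>\<theta>\<bar>" by simp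
  then show ?thesis using that[of "if \<theta> < 0 then - m else m"] * by linarith
qed

text \<open>A driving coordinate of size 20 gives a conjugate shear of size at least (2/5) * 20 = 8,
  which exceeds the error 6, so the step \<theta> is nonzero. The window starts at 23 so that 20
  survives the error 3, and 32 is 23 + 6 + 3.\<close>

lemma reduce_step:
  assumes "galois_point N p p'" "20 \<le> \<bar>p' $ oth k\<bar>"
  obtains q q' where "galois_point N q q'" "L8_proj q \<in> SL_L8_orbit (L8_proj p)" "q' $ oth k = p' $
      oth k"
    "20 \<le> \<bar>q' $ k\<bar>" "\<bar>q' $ k\<bar> \<le> 32 + \<bar>len' k\<bar> * \<bar>p' $ oth
        k\<bar>"
proof -
  obtain \<theta> where \<theta>: "\<bar>\<theta> - len' k * p' $ oth k\<bar> \<le> 6"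
    "\<forall>n. \<exists>q q'. galois_point N q q' \<and> L8_proj q = twist k n (L8_proj p) \<and> q'
        $ oth k = p' $ oth k \<and>
      \<bar>q' $ k - (p' $ k + of_int n * \<theta>)\<bar> \<le> 3" using twist_galois[OF assms(1)] .
  have "(2/5) * 20 \<le> \<bar>len' k\<bar> * \<bar>p' $ oth k\<bar>"
    using len'_bounds(1)[of k] assms(2) by (intro mult_mono) auto
  then have "\<theta> \<noteq> 0" "\<bar>\<theta>\<bar> \<le> \<bar>len' k\<bar> * \<bar>p' $ oth
      k\<bar> + 6" using \<theta>(1) by (auto simp: abs_mult[symmetric])
  then obtain n :: int where n: "23 \<le> p' $ k + of_int n * \<theta>" "p' $ k + of_int n * \<theta>
      \<le> 23 + \<bar>\<theta>\<bar>"
    using arithmetic_progression_window by blast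
  obtain q q' where q: "galois_point N q q'" "L8_proj q = twist k n (L8_proj p)" "q' $ oth k = p' $ oth k"
      "\<bar>q' $ k - (p' $ k + of_int n * \<theta>)\<bar> \<le> 3" using \<theta>(2) by blast
  have "20 \<le> q' $ k" "q' $ k \<le> 26 + \<bar>\<theta>\<bar>" using q(4) n by linarith+
  then show ?thesis
    using that[OF q(1) _ q(3)] orbitI[OF affine_aut_twist] q(2) \<open>\<bar>\<theta>\<bar> \<le>
        _\<close> by simp
qed

definition reduced :: "nat \<Rightarrow> real^2 \<Rightarrow> bool" where
  "reduced N q \<longleftrightarrow> (\<exists>q'. galois_point N q q' \<and> (\<forall>i. \<bar>q' $
      i\<bar> \<le> 400))"

text \<open>
  The conjugate shear factors multiply to less than \<open>3/4\<close> in absolute value, so a pair of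
  twists shrinks a large conjugate coordinate. The lower bound \<open>20\<close> keeps the next twist
  effective.
\<close>

lemma reduce_large:
  assumes "galois_point N p p'" "20 \<le> \<bar>p' $ 1\<bar>"
  shows "\<exists>q. reduced N q \<and> L8_proj q \<in> SL_L8_orbit (L8_proj p)"
  using assms
proof (induction "nat \<lfloor>\<bar>p' $ 1\<bar>\<rfloor>" arbitrary: p p' rule: less_induct)
  case less
  have o: "oth 2 = 1" "oth 1 = 2" by (auto simp: oth_def)
  let ?x = "\<bar>p' $ 1\<bar>"
  obtain q q' where q: "galois_point N q q'" "L8_proj q \<in> SL_L8_orbit (L8_proj p)" "20 \<le>
      \<bar>q' $ 2\<bar>"
      "\<bar>q' $ 2\<bar> \<le> 32 + \<bar>len' 2\<bar> * ?x"
    using reduce_step[OF less.prems(1), of 2] less.prems(2) unfolding o by blast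
  obtain r r' where r: "galois_point N r r'" "L8_proj r \<in> SL_L8_orbit (L8_proj q)" "r' $ 2 = q' $
      2" "20 \<le> \<bar>r' $ 1\<bar>"
      "\<bar>r' $ 1\<bar> \<le> 32 + \<bar>len' 1\<bar> * \<bar>q' $ 2\<bar>"
    using reduce_step[OF q(1), of 1] q(3) unfolding o by blast
  have orb: "L8_proj r \<in> SL_L8_orbit (L8_proj p)" using orbit_trans q(2) r(2) by blast
  have "\<bar>len' 2\<bar> * ?x \<le> (3/2) * ?x" using len'_bounds(2)[of 2] by (intro mult_right_mono) auto
  then have q2: "\<bar>q' $ 2\<bar> \<le> 32 + (3/2) * ?x" using q(4) by linarith
  have "\<bar>len' 1\<bar> * \<bar>q' $ 2\<bar> \<le> (1/2) * \<bar>q' $ 2\<bar>" using len'_bounds(3)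
      by (intro mult_right_mono) auto
  then have r1: "\<bar>r' $ 1\<bar> \<le> 48 + (3/4) * ?x" using r(5) q2 by linarith
  show ?case
  \<comment> \<open>A decrease by a full unit is demanded so that the integer part, the induction
    measure, drops.\<close>
  proof (cases "\<bar>r' $ 1\<bar> \<le> ?x - 1")
    case True
    then have "nat \<lfloor>\<bar>r' $ 1\<bar>\<rfloor> < nat \<lfloor>?x\<rfloor>" using r(4) by linarith
    from less.hyps[OF this r(1) r(4)] show ?thesis using orb orbit_trans by blast
  next
    case False
    \<comment> \<open>Failure of the decrease combined with \<open>r1\<close> forces the old
      coordinate below 196, and then \<open>q2\<close> bounds the other one by 326; 400 covers
      both.\<close>
    then have "\<bar>r' $ 1\<bar> \<le> 400" "\<bar>r' $ 2\<bar> \<le> 400" using r1 q2 r(3) by linarith+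
    then have "reduced N r" unfolding reduced_def forall_2 using r(1) by blast
    then show ?thesis using orb by blast
  qed
qed

text \<open>If only the second conjugate is large, one twist in direction 1 makes the first one
  large as well, and the descent can start. If both are below 20, the point is already
  reduced.\<close>

lemma reduce:
  assumes "galois_point N p p'"
  shows "\<exists>q. reduced N q \<and> L8_proj q \<in> SL_L8_orbit (L8_proj p)"
proof (cases "20 \<le> \<bar>p' $ 1\<bar>")
  case True
  then show ?thesis using reduce_large assms by blast
next
  case F: False
  show ?thesis
  proof (cases "20 \<le> \<bar>p' $ 2\<bar>")
    case True
    have o: "oth 1 = 2" by (simp add: oth_def)
    obtain q q' where q: "galois_point N q q'" "L8_proj q \<in> SL_L8_orbit (L8_proj p)" "20 \<le>
        \<bar>q' $ 1\<bar>"
      using reduce_step[OF assms, of 1] True unfolding o by blast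
    then show ?thesis using reduce_large orbit_trans by blast
  next
    case False
    then have "reduced N p" using F assms unfolding reduced_def forall_2 by (intro exI[of _ p']) simp
    then show ?thesis using orbit_refl by blast
  qed
qed

text \<open>Sum and difference of the scaled coordinate and its conjugate are \<open>2 * a\<close>
  and \<open>2 * b * sqrt 2\<close>, so bounds on both embeddings bound the two integers. In 403 the
  polygon contributes 3 and the conjugate 400.\<close>

lemma finite_reduced:
  assumes "N > 0" shows "finite {q. reduced N q}"
proof -
  define S where "S = (\<lambda>(a::int, b::int). (of_int a + of_int b * sqrt 2) / of_nat N) ` ({- int
      (403 * N)..int (403 * N)} \<times> {- int (403 * N)..int (403 * N)})"
  have S: "x \<in> S" if x: "galois N x x'" "0 \<le> x" "x \<le> 5/2" "\<bar>x'\<bar> \<le> 400" for x x'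
  proof -
    obtain a b :: int where ab: "of_nat N * x = of_int a + of_int b * sqrt 2" "of_nat N * x' = of_int a
        - of_int b * sqrt 2"
      using x(1) unfolding galois_def by blast
    have 1: "\<bar>real N * x\<bar> \<le> 3 * real N" using x(2,3) assms by (simp add: abs_mult)
    have 2: "\<bar>real N * x'\<bar> \<le> 400 * real N" using x(4) assms by (simp add: abs_mult)
    have "\<bar>2 * real_of_int a\<bar> \<le> 403 * real N" using 1 2 unfolding ab by linarith
    then have a: "\<bar>a\<bar> \<le> int (403 * N)" by linarith
    have "\<bar>2 * (real_of_int b * sqrt 2)\<bar> \<le> 403 * real N" using 1 2 unfolding ab by linarith
    moreover have "\<bar>real_of_int b\<bar> * 1 \<le> \<bar>real_of_int b\<bar> * sqrt 2" using
        sqrt2_bounds by (intro mult_left_mono) auto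
    ultimately have b: "\<bar>b\<bar> \<le> int (403 * N)" by (simp add: abs_mult)
    have "x = (of_int a + of_int b * sqrt 2) / of_nat N" using ab(1) assms by (simp add: field_simps)
    then show ?thesis unfolding S_def using a b by (intro image_eqI[of _ _ "(a, b)"]) auto
  qed
  have "{q. reduced N q} \<subseteq> (\<lambda>(x, y). vector [x, y]) ` (S \<times> S)"
  proof
    fix q assume "q \<in> {q. reduced N q}"
    then obtain q' where q': "galois_point N q q'" "\<forall>i. \<bar>q' $ i\<bar> \<le> 400" unfolding
        reduced_def by blast
    have "q $ i \<in> S" for i
    proof (rule S)
      have "q \<in> L8_polygon" using q'(1) by (simp add: galois_point_def)
      then show "0 \<le> q $ i" "q $ i \<le> 5/2" using len_bounds(2)[of i] by (auto simp:
          mem_L8_polygon[where k=i])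
    qed (use q' in \<open>auto simp: galois_point_def\<close>)
    moreover have "q = vector [q $ 1, q $ 2]" by (simp add: vec_eq_iff forall_2)
    ultimately show "q \<in> (\<lambda>(x, y). vector [x, y]) ` (S \<times> S)"
      by (intro image_eqI[of _ _ "(q $ 1, q $ 2)"]) auto
  qed
  moreover have "finite S" by (simp add: S_def)
  ultimately show ?thesis by (meson finite_SigmaI finite_imageI finite_subset)
qed

lemma finite_orbits: "finite (SL_L8_orbit ` connection_points N)"
proof (rule finite_subset)
  \<comment> \<open>The condition \<open>N > 0\<close> is kept in the set because
    \<open>reduced 0\<close> holds on the whole polygon; points with common denominator
    \<open>N\<close> supply it.\<close>
  show "SL_L8_orbit ` connection_points N \<subseteq> SL_L8_orbit ` L8_proj ` {q. N > 0 \<and> reduced N q}"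
  proof
    fix X assume "X \<in> SL_L8_orbit ` connection_points N"
    then obtain P where P: "P \<in> topspace L8" "has_common_denominator P N" "X = SL_L8_orbit P"
      by (auto simp: connection_points_def connection_point_def)
    then obtain p where p: "p \<in> L8_polygon" "P = L8_proj p" using topspace_L8_cases by blast
    have N: "N > 0" "of_nat N *\<^sub>R rep p \<in> lattice"
      using P(2) p by (auto simp: has_common_denominator_iff L8_coords_proj)
    have "\<exists>x'. galois N (rep p $ i) x'" for i
    proof -
      have "of_nat N * rep p $ i \<in> Zw" using N(2) by (simp add: lattice_def)
      then obtain a b :: int where "of_nat N * rep p $ i = of_int a + of_int b * sqrt 2" by (auto simp:
          Zw_def)
      moreover have "of_nat N * ((of_int a - of_int b * sqrt 2) / of_nat N) = of_int a - of_int b *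
          sqrt 2" using N(1) by simp
      ultimately show ?thesis unfolding galois_def by blast
    qed
    then obtain f where "\<And>i. galois N (rep p $ i) (f i)" by metis
    then have "galois_point N (rep p) (\<chi> i. f i)" by (simp add: galois_point_def rep_polygon p(1))
    then obtain q where q: "reduced N q" "L8_proj q \<in> SL_L8_orbit P"
      using reduce L8_proj_rep[OF p(1)] p(2) by metis
    then have "X = SL_L8_orbit (L8_proj q)" using orbit_eq P by blast
    then show "X \<in> SL_L8_orbit ` L8_proj ` {q. N > 0 \<and> reduced N q}" using q(1) N(1) by blast
  qed
  show "finite (SL_L8_orbit ` L8_proj ` {q. N > 0 \<and> reduced N q})"
    using finite_reduced[of N] by (cases "N > 0") simp_all
qed

theorem theoremB:
  fixes N :: nat
  shows "finite (SL_L8_orbit ` connection_points N) \<and>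
         partition_on (connection_points N) (SL_L8_orbit ` connection_points N)"
  using finite_orbits partition_on_orbits by blast

end
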